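(* Let $A$ be a selfadjoint operator (i.e., $F(x,Ay)=F(Ax,y)$) on a finite-dimensional vector space with nondegenerate $\varepsilon$-Hermitian form $F$ over a field $K$ of characteristic not $2$ ($\varepsilon=\pm1$; $\varepsilon=1$ for nonidentity involution on $K$). Then there exists a basis in which the pair $(A,F)$ is given by a direct sum of matrix pairs of the following types: (i) $\left(\Phi\oplus\Phi^*,\ \begin{bmatrix}0&\varepsilon I_n\\ I_n&0\end{bmatrix}\right)$, where $\Phi$ is an $n\times n$ Frobenius block and, if $\varepsilon=1$, then $\Phi_1$ does not exist; (ii) $A_\Phi^{f(x)}=(\Phi,\ \Phi_1f(\Phi))$, where $\varepsilon=1$, $0\ne f(x)=\bar f(x)\in K[x]$, and $\deg f<\deg p_\Phi$. The summands are determined as follows: type (i) up to replacement of $\Phi$ by $\Psi$ with $\chi_\Psi(x)=\bar\chi_\Phi(x)$; type (ii) up to replacement of the whole group $A_\Phi^{f_1(x)}\oplus\dots\oplus A_\Phi^{f_s(x)}$ with the same $\Phi$ by $A_\Phi^{g_1(x)}\oplus\dots\oplus A_\Phi^{g_s(x)}$ such that the Hermitian forms $f_1(\omega)x_1^\circ x_1+\dots+f_s(\omega)x_s^\circ x_s$ and $g_1(\omega)x_1^\circ x_1+\dots+g_s(\omega)x_s^\circ x_s$ are equivalent over the field $K[\omega]=K[x]/p_\Phi K[x]$ with involution $f(\omega)^\circ=\bar f(\omega)$.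
   Context: $K$ has an involution $a\mapsto\bar a$ (possibly the identity); $A^*=[\bar a_{ji}]$ for $A=[a_{ij}]$. A pair $(A,F)$ is given by the matrix of the operator and the Gram matrix of the form; direct sums of pairs are componentwise. A Frobenius block is a companion matrix with ones on the subdiagonal and last column $(-c_n,\dots,-c_1)^T$; its characteristic polynomial $\chi_\Phi=x^n+c_1x^{n-1}+\dots+c_n$ is a power of an irreducible polynomial $p_\Phi(x)$. For $f(x)=a_0x^n+\dots+a_n$, $\bar f(x)=\bar a_0x^n+\dots+\bar a_n$. $\Phi_1$ denotes a fixed nonsingular matrix with $\Phi_1=\Phi_1^*$ and $\Phi_1\Phi=(\Phi_1\Phi)^*$ (when it exists). *)

theory Defs
  imports "Jordan_Normal_Form.Char_Poly" "HOL-Library.Multiset"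
begin

definition is_involution :: "('a::field \<Rightarrow> 'a) \<Rightarrow> bool" where
  "is_involution cj \<longleftrightarrow> (\<forall>a b. cj (a + b) = cj a + cj b) \<and> (\<forall>a b. cj (a * b) = cj a * cj b)
     \<and> (\<forall>a. cj (cj a) = a)"

definition cstar :: "('a \<Rightarrow> 'a) \<Rightarrow> 'a mat \<Rightarrow> 'a mat" where
  "cstar cj A = mat (dim_col A) (dim_row A) (\<lambda>(i,j). cj (A $$ (j,i)))"

definition pbar :: "('a::field \<Rightarrow> 'a) \<Rightarrow> 'a poly \<Rightarrow> 'a poly" where
  "pbar cj f = map_poly cj f"

definition companion :: "'a::field poly \<Rightarrow> 'a mat" where
  "companion q = mat (degree q) (degree q)
     (\<lambda>(i,j). if j = degree q - 1 then - coeff q i else if i = j + 1 then 1 else 0)"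

definition frobenius_block :: "'a::field mat \<Rightarrow> bool" where
  "frobenius_block Phi \<longleftrightarrow> (\<exists>q. monic q \<and> degree q \<ge> 1 \<and> Phi = companion q)
     \<and> (\<exists>r k. irreducible r \<and> char_poly Phi = r ^ k)"

definition p_of :: "'a::field mat \<Rightarrow> 'a poly" where
  "p_of Phi = (THE r. monic r \<and> irreducible r \<and> (\<exists>k. char_poly Phi = r ^ k))"

definition poly_mat :: "'a::field poly \<Rightarrow> 'a mat \<Rightarrow> 'a mat" where
  "poly_mat f A = foldr (\<lambda>i M. M + coeff f i \<cdot>\<^sub>m (A ^\<^sub>m i)) [0..<Suc (degree f)] (0\<^sub>m (dim_row A) (dim_col A))"

definition is_phi1 :: "('a::field \<Rightarrow> 'a) \<Rightarrow> 'a mat \<Rightarrow> 'a mat \<Rightarrow> bool" where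
  "is_phi1 cj Phi M \<longleftrightarrow> M \<in> carrier_mat (dim_row Phi) (dim_row Phi) \<and> det M \<noteq> 0
     \<and> M = cstar cj M \<and> M * Phi = cstar cj (M * Phi)"

definition dsum_mat :: "'a::zero mat \<Rightarrow> 'a mat \<Rightarrow> 'a mat" where
  "dsum_mat A B = four_block_mat A (0\<^sub>m (dim_row A) (dim_col B)) (0\<^sub>m (dim_row B) (dim_col A)) B"

fun dsum_pairs :: "('a::zero mat \<times> 'a mat) list \<Rightarrow> 'a mat \<times> 'a mat" where
  "dsum_pairs [] = (0\<^sub>m 0 0, 0\<^sub>m 0 0)"
| "dsum_pairs (p # ps) = (dsum_mat (fst p) (fst (dsum_pairs ps)), dsum_mat (snd p) (snd (dsum_pairs ps)))"

definition pair_equiv :: "('a::field \<Rightarrow> 'a) \<Rightarrow> 'a mat \<times> 'a mat \<Rightarrow> 'a mat \<times> 'a mat \<Rightarrow> bool" where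
  "pair_equiv cj P Q \<longleftrightarrow> (\<exists>n S. fst P \<in> carrier_mat n n \<and> snd P \<in> carrier_mat n n
      \<and> fst Q \<in> carrier_mat n n \<and> snd Q \<in> carrier_mat n n
      \<and> S \<in> carrier_mat n n \<and> det S \<noteq> 0
      \<and> fst P * S = S * fst Q \<and> snd Q = cstar cj S * snd P * S)"

declare [[typedef_overloaded]]
datatype ('a::zero) summand = TypeI "'a mat" | TypeII "'a mat" "'a poly"

text \<open>phi1 is the fixed choice of Phi_1 for each Frobenius block (when it exists).\<close>
fun summand_pair :: "('a::field \<Rightarrow> 'a) \<Rightarrow> 'a \<Rightarrow> ('a mat \<Rightarrow> 'a mat) \<Rightarrow> 'a summand \<Rightarrow> 'a mat \<times> 'a mat" where
  "summand_pair cj eps phi1 (TypeI Phi) =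
     (let n = dim_row Phi in
      (dsum_mat Phi (cstar cj Phi),
       four_block_mat (0\<^sub>m n n) (eps \<cdot>\<^sub>m 1\<^sub>m n) (1\<^sub>m n) (0\<^sub>m n n)))"
| "summand_pair cj eps phi1 (TypeII Phi f) = (Phi, phi1 Phi * poly_mat f Phi)"

fun valid_summand :: "('a::field \<Rightarrow> 'a) \<Rightarrow> 'a \<Rightarrow> 'a summand \<Rightarrow> bool" where
  "valid_summand cj eps (TypeI Phi) \<longleftrightarrow> frobenius_block Phi
      \<and> (eps = 1 \<longrightarrow> \<not> (\<exists>M. is_phi1 cj Phi M))"
| "valid_summand cj eps (TypeII Phi f) \<longleftrightarrow> eps = 1 \<and> frobenius_block Phi
      \<and> (\<exists>M. is_phi1 cj Phi M)
      \<and> f \<noteq> 0 \<and> pbar cj f = f \<and> degree f < degree (p_of Phi)"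

definition canonical_pair :: "('a::field \<Rightarrow> 'a) \<Rightarrow> 'a \<Rightarrow> ('a mat \<Rightarrow> 'a mat) \<Rightarrow> 'a summand list \<Rightarrow> 'a mat \<times> 'a mat" where
  "canonical_pair cj eps phi1 bs = dsum_pairs (map (summand_pair cj eps phi1) bs)"

text \<open>Equivalence of the Hermitian forms f_1(w) x_1^o x_1 + ... + f_s(w) x_s^o x_s and
  g_1(w) ... over the field K[w] = K[x]/pK[x] with involution h(w)^o = bar h(w).
  Elements of K[w] are represented by polynomials, equality in K[w] is congruence mod p.
  Equivalence: there is a matrix S over K[w], invertible over K[w], with S^o diag(f) S = diag(g).\<close>
definition herm_equiv :: "('a::field \<Rightarrow> 'a) \<Rightarrow> 'a poly \<Rightarrow> 'a poly list \<Rightarrow> 'a poly list \<Rightarrow> bool" where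
  "herm_equiv cj p fs gs \<longleftrightarrow> length fs = length gs \<and>
     (let s = length fs in
      \<exists>S R. S \<in> carrier_mat s s \<and> R \<in> carrier_mat s s
        \<and> (\<forall>i<s. \<forall>j<s. p dvd ((R * S) $$ (i,j) - (1\<^sub>m s) $$ (i,j)))
        \<and> (\<forall>i<s. \<forall>j<s. p dvd ((\<Sum>k<s. pbar cj (S $$ (k,i)) * fs ! k * S $$ (k,j))
                                 - (if i = j then gs ! i else 0))))"

fun typeI_blocks :: "'a::zero summand list \<Rightarrow> 'a mat list" where
  "typeI_blocks [] = []"
| "typeI_blocks (TypeI Phi # bs) = Phi # typeI_blocks bs"
| "typeI_blocks (TypeII Phi f # bs) = typeI_blocks bs"

fun typeII_group :: "'a::zero mat \<Rightarrow> 'a summand list \<Rightarrow> 'a poly list" where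
  "typeII_group Psi [] = []"
| "typeII_group Psi (TypeI Phi # bs) = typeII_group Psi bs"
| "typeII_group Psi (TypeII Phi f # bs) = (if Phi = Psi then f # typeII_group Psi bs else typeII_group Psi bs)"

text \<open>Two lists of summands are related iff (up to reordering) the type (i) summands agree up to
  replacing Phi by Psi with chi_Psi = bar chi_Phi, and for each Phi the type (ii) groups give
  equivalent Hermitian forms over K[w].\<close>
definition summands_related :: "('a::field \<Rightarrow> 'a) \<Rightarrow> 'a summand list \<Rightarrow> 'a summand list \<Rightarrow> bool" where
  "summands_related cj bs cs \<longleftrightarrow>
     image_mset (\<lambda>Phi. {char_poly Phi, pbar cj (char_poly Phi)}) (mset (typeI_blocks bs))
       = image_mset (\<lambda>Phi. {char_poly Phi, pbar cj (char_poly Phi)}) (mset (typeI_blocks cs))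
     \<and> (\<forall>Phi. herm_equiv cj (p_of Phi) (typeII_group Phi bs) (typeII_group Phi cs))"

end

(* Let A be selfadjoint. K[x] acts on V through A, and adjunction turns multiplication by f into
   multiplication by its conjugate. A functional on K[x]/(q) is u |-> top_coeff q (g * u) for a
   unique g modulo q, so the form on cyclic submodules is recorded by polynomials.

   Existence: let m be the minimal polynomial and m = p^k c with p irreducible, p not dividing c.
   If eps = 1 and p is selfconjugate, polarization gives v with F(v, (m/p) v) nonzero, and c v
   generates a nondegenerate cyclic submodule with annihilator p^k; its form is determined modulo p up
   to a Hensel square, which leaves a polynomial of degree less than deg p. Otherwise one pairs c v
   with a second vector, and both cyclic submodules are isotropic. Induct on the orthogonal complement.

   Uniqueness: express the generators of one decomposition by those of another and evaluate the form on
   multiples of p^(k-1). Modulo p only the generators with annihilator exactly p^k contribute, so the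
   coefficient matrix of these is a congruence over K[x]/(p); in particular their numbers agree.
   Conversely a congruence modulo p lifts to one modulo p^k by Hensel's lemma. *)
theory Submission
  imports Defs "HOL-Library.Function_Algebras"
begin


section \<open>Prime powers in K[x]\<close>

text \<open>The pivotal notion is the frame: generators with their annihilators, an involution
  pairing them up, and a polynomial recording each nonzero pairing. The form is recorded so rigidly
  that it forces the generators to be independent, and two modules having frames with equal data are
  isometric. Equivalence of two matrix pairs thus becomes the question whether one module has frames
  for both lists of summands. The link with the statement is that for \<open>eps = 1\<close> a
  matrix Phi_1 exists exactly when chi_Phi is selfconjugate, so validity of a summand is a condition
  on polynomials. The chosen Phi_1 enters only through a polynomial mu prime to p_Phi. All type (ii)
  summands with the same Phi share mu, so it cancels modulo p_Phi; this is why the Hermitian forms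
  over K[x]/(p_Phi) do not mention Phi_1. For \<open>eps = -1\<close> the involution is the
  identity, every cyclic submodule is isotropic, and both generators of a type (i) summand have the
  same annihilator, which has to be taken into account when counting.\<close>

lemma irreducible_degree_pos:
  fixes p :: "'a::field poly"
  assumes "irreducible p"
  shows "degree p > 0"
proof -
  have "p \<noteq> 0" "\<not> p dvd 1" using assms irreducible_not_unit by auto
  then show ?thesis by (simp add: is_unit_iff_degree)
qed

text \<open>Euclidean argument: a nonzero combination of f and p of least degree divides both. As p
  does not divide f, this common divisor is a unit.\<close>

lemma irreducible_bezout:
  fixes p f :: "'a::field poly"
  assumes p: "irreducible p" and f: "\<not> p dvd f"
  shows "\<exists>a. p dvd a * f - 1"
proof -
  define I where "I = {g. g \<noteq> 0 \<and> (\<exists>a b. g = a * f + b * p)}"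
  have p0: "p \<noteq> 0" using p by auto
  have "p = 0 * f + 1 * p" by simp
  then have "p \<in> I" unfolding I_def using p0 by blast
  then obtain d where d: "d \<in> I" and min: "\<And>g. g \<in> I \<Longrightarrow> degree d \<le> degree g"
    by (metis ex_has_least_nat[of "\<lambda>g. g \<in> I" p degree])
  from d obtain a b where dab: "d = a * f + b * p" and d0: "d \<noteq> 0" unfolding I_def by auto
  have dvd: "d dvd g" if "g = u * f + v * p" for g u v
  proof (rule ccontr)
    assume nd: "\<not> d dvd g"
    have "g mod d = (u - g div d * a) * f + (v - g div d * b) * p"
      using that dab by (simp add: algebra_simps minus_div_mult_eq_mod[symmetric])
    moreover have "g mod d \<noteq> 0" using nd by (simp add: dvd_eq_mod_eq_0)
    ultimately have "g mod d \<in> I" unfolding I_def by blast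
    from min[OF this] show False
      using degree_mod_less'[OF d0 \<open>g mod d \<noteq> 0\<close>] by simp
  qed
  have dp: "d dvd p" by (rule dvd[of p 0 1]) simp
  have df: "d dvd f" by (rule dvd[of f 1 0]) simp
  from dp obtain c where c: "p = d * c" by (elim dvdE)
  from irreducibleD[OF p c] have "is_unit d"
  proof
    assume "is_unit c"
    then have "p dvd d" using c by (metis dvd_mult_unit_iff dvd_refl)
    with df f show ?thesis using dvd_trans by blast
  qed
  then obtain e where e: "1 = d * e" by (elim dvdE)
  have "e * a * f - 1 = - (e * b) * p" unfolding e dab by (simp add: algebra_simps)
  then show ?thesis by (metis dvd_triv_right)
qed

text \<open>Geometric series: p divides 1 - a f, so p^k divides its k-th power, while f divides 1 -
  (1 - a f)^k. The quotient is the inverse of f modulo p^k.\<close>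

lemma unit_mod_power:
  fixes p f :: "'a::field poly"
  assumes "irreducible p" "\<not> p dvd f"
  shows "\<exists>a. p ^ k dvd a * f - 1"
proof -
  obtain a where "p dvd a * f - 1" using irreducible_bezout[OF assms] by blast
  then have "p ^ k dvd (1 - a * f) ^ k" by (metis dvd_power_same dvd_minus_iff minus_diff_eq)
  moreover have "f dvd 1 - (1 - a * f) ^ k"
  proof -
    have "1 - (1 - a * f) dvd 1 ^ k - (1 - a * f) ^ k"
      by (metis power_diff_sumr2 dvd_triv_left)
    then show ?thesis by (simp add: dvd_mult_right)
  qed
  then obtain b where "1 - (1 - a * f) ^ k = b * f" by (metis dvdE mult.commute)
  then have "b * f - 1 = - ((1 - a * f) ^ k)" by (simp add: algebra_simps)
  ultimately show ?thesis by (metis dvd_minus_iff)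
qed

lemma dvd_mult_unit_mod:
  fixes a :: "'a::comm_ring_1"
  assumes "q dvd a * f - 1" "q dvd f * u"
  shows "q dvd u"
proof -
  have "q dvd a * (f * u) - u * (a * f - 1)" using assms by (simp add: dvd_diff)
  then show ?thesis by (simp add: algebra_simps)
qed

lemma power_dvd_cancel:
  fixes p f :: "'a::field poly"
  assumes "irreducible p" "\<not> p dvd f" "p ^ k dvd f * u"
  shows "p ^ k dvd u"
  using unit_mod_power[OF assms(1,2)] dvd_mult_unit_mod assms(3) by blast

lemma monic_irreducible_dvd_eq:
  fixes p r :: "'a::field poly"
  assumes "irreducible p" "irreducible r" "monic p" "monic r" "r dvd p"
  shows "r = p"
proof -
  have "p dvd r"
    using assms irreducibleD' by blast
  then show ?thesis using assms by (metis poly_dvd_antisym)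
qed

lemma irreducible_dvd_power_eq:
  fixes p r :: "'a::field poly"
  assumes "irreducible p" "irreducible r" "monic p" "monic r" "r dvd p ^ k"
  shows "r = p"
  using assms monic_irreducible_dvd_eq prime_elem_dvd_power field_poly_irreducible_imp_prime by blast

lemma power_irreducible_inj:
  fixes p r :: "'a::field poly"
  assumes "irreducible p" "irreducible r" "monic p" "monic r" "r ^ m = p ^ k" "0 < m"
  shows "r = p" "m = k"
proof -
  have "r dvd p ^ k" using assms(5,6) by (metis dvd_power)
  then show rp: "r = p" using irreducible_dvd_power_eq assms by blast
  have "p \<noteq> 0" using assms(1) by auto
  then have "degree (p ^ n) = n * degree p" for n by (simp add: degree_power_eq)
  then have "m * degree p = k * degree p" using assms(5) rp by metis
  then show "m = k" using irreducible_degree_pos[OF assms(1)] by simp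
qed

text \<open>This makes foreign generators disappear in \<open>frame_compare\<close>: u and v are
  coefficients, at a generator with annihilator r^m, of elements killed by p^k. For r different from
  p, p^k is invertible modulo r^m. For r = p and m < k the factor p^(k-1) suffices. For m > k both u
  and v contain p^(m-k), and k - 1 + 2(m - k) >= m.\<close>

lemma prime_power_distinct:
  fixes p r :: "'a::field poly"
  assumes p: "irreducible p" "monic p" and r: "irreducible r" "monic r"
    and ne: "r ^ m \<noteq> p ^ k" and k: "0 < k"
    and u: "r ^ m dvd p ^ k * u" and v: "r ^ m dvd p ^ k * v"
  shows "r ^ m dvd p ^ (k - 1) * u * v"
proof (cases "r = p")
  case False
  have "\<not> r dvd p ^ k" using irreducible_dvd_power_eq p r False by blast
  then have "r ^ m dvd u" using power_dvd_cancel[OF r(1) _ u] by blast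
  then show ?thesis by (simp add: dvd_mult2 dvd_mult)
next
  case True
  have mk: "m \<noteq> k" using ne True by blast
  have p0: "p \<noteq> 0" using p by auto
  show ?thesis
  proof (cases "m < k")
    case True
    then have "r ^ m dvd p ^ (k - 1)" using \<open>r = p\<close> by (simp add: le_imp_power_dvd)
    then show ?thesis by (simp add: dvd_mult2)
  next
    case False
    then obtain n where m: "m = k + Suc n" using mk by (metis add_Suc_right less_imp_Suc_add linorder_neqE_nat)
    have "p ^ Suc n dvd u" "p ^ Suc n dvd v" using u v \<open>r = p\<close> m p0 by (simp_all add: power_add)
    then have "p ^ (k - 1) * (p ^ Suc n * p ^ Suc n) dvd p ^ (k - 1) * (u * v)"
      by (intro mult_dvd_mono dvd_refl)
    moreover have "p ^ m dvd p ^ (k - 1) * (p ^ Suc n * p ^ Suc n)"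
      unfolding power_add[symmetric] m using k by (intro le_imp_power_dvd) auto
    ultimately show ?thesis using \<open>r = p\<close> by (metis dvd_trans mult.assoc)
  qed
qed

text \<open>A divisor of least positive degree has no proper factorization; scaling by the inverse
  of its leading coefficient makes it monic.\<close>

lemma irreducible_factor_exists:
  fixes m :: "'a::field poly"
  assumes "degree m > 0"
  shows "\<exists>p. irreducible p \<and> monic p \<and> p dvd m"
proof -
  define I where "I = {g. g dvd m \<and> degree g > 0}"
  have "m \<in> I" using assms I_def by auto
  then obtain d where d: "d \<in> I" and min: "\<And>g. g \<in> I \<Longrightarrow> degree d \<le> degree g"
    by (metis ex_has_least_nat[of "\<lambda>g. g \<in> I" m degree])
  have d0: "d \<noteq> 0" using d I_def by auto
  have "irreducible d"
  proof (rule irreducibleI)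
    show "d \<noteq> 0" by fact
    show "\<not> is_unit d" using d d0 unfolding I_def by (auto simp: is_unit_iff_degree)
    fix a b assume ab: "d = a * b"
    then have ab0: "a \<noteq> 0" "b \<noteq> 0" using d0 by auto
    have deg: "degree d = degree a + degree b" using ab ab0 by (simp add: degree_mult_eq)
    show "is_unit a \<or> is_unit b"
    proof (rule ccontr)
      assume "\<not> ?thesis"
      then have pos: "degree a > 0" "degree b > 0" using ab0 by (auto simp: is_unit_iff_degree)
      have "a \<in> I" using d ab pos unfolding I_def by (auto intro: dvd_trans)
      from min[OF this] deg pos show False by simp
    qed
  qed
  moreover define c where "c = inverse (lead_coeff d)"
  have c0: "c \<noteq> 0" using d0 c_def by simp
  have u: "is_unit [:c:]" using c0 by (simp add: is_unit_pCons_iff)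
  have sm: "Polynomial.smult c d = [:c:] * d" by simp
  have "irreducible (Polynomial.smult c d)" unfolding sm using \<open>irreducible d\<close> u
    by (metis irreducible_mult_unit_left)
  moreover have "monic (Polynomial.smult c d)" using d0 c_def by simp
  moreover have "Polynomial.smult c d dvd m" using d c0 I_def by (simp add: smult_dvd_iff)
  ultimately show ?thesis by blast
qed

lemma split_power:
  fixes p m :: "'a::field poly"
  assumes "irreducible p" "m \<noteq> 0" "p dvd m"
  shows "\<exists>k c. m = p ^ k * c \<and> \<not> p dvd c \<and> 0 < k"
proof -
  have "m \<noteq> 0 \<Longrightarrow> \<exists>k c. m = p ^ k * c \<and> \<not> p dvd c" for m
  proof (induction "degree m" arbitrary: m rule: less_induct)
    case less
    show ?case
    proof (cases "p dvd m")
      case False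
      then show ?thesis by (metis mult_1 power_0)
    next
      case True
      then obtain n where n: "m = p * n" by (elim dvdE)
      then have "degree n < degree m"
        using less.prems irreducible_degree_pos[OF assms(1)] by (auto simp: degree_mult_eq)
      then obtain k c where "n = p ^ k * c" "\<not> p dvd c" using less.hyps[of n] less.prems n by auto
      then have "m = p ^ Suc k * c" "\<not> p dvd c" using n by (auto simp: mult.assoc)
      then show ?thesis by blast
    qed
  qed
  then obtain k c where "m = p ^ k * c" "\<not> p dvd c" using assms(2) by blast
  moreover from this have "k > 0" using assms(3) by (metis gr0I mult_1 power_0)
  ultimately show ?thesis by blast
qed

definition prime_power :: "'a::field poly \<Rightarrow> bool" where
  "prime_power q \<longleftrightarrow> (\<exists>p k. irreducible p \<and> monic p \<and> 0 < k \<and> q = p ^ k)"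

lemma prime_powerD:
  assumes "prime_power (q::'a::field poly)"
  shows "monic q" "degree q > 0" "q \<noteq> 0"
proof -
  from assms obtain p k where *: "irreducible p" "monic p" "0 < k" "q = p ^ k"
    unfolding prime_power_def by auto
  show "monic q" using * by (simp add: monic_power)
  show "degree q > 0" using * irreducible_degree_pos[of p] by (auto simp: degree_power_eq)
  then show "q \<noteq> 0" by auto
qed

text \<open>Has the body of \<open>p_of\<close> with a polynomial in place of the characteristic
  polynomial, so that \<open>p_of_eq\<close> holds by unfolding.\<close>

definition prime_base :: "'a::field poly \<Rightarrow> 'a poly" where
  "prime_base q = (THE r. monic r \<and> irreducible r \<and> (\<exists>k. q = r ^ k))"

lemma prime_base_power:
  assumes "irreducible p" "monic p" "0 < k"
  shows "prime_base (p ^ k) = p"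
  unfolding prime_base_def
proof (rule the_equality)
  fix r assume "monic r \<and> irreducible r \<and> (\<exists>m. p ^ k = r ^ m)"
  then show "r = p" using power_irreducible_inj(1)[of r p k] assms by metis
qed (use assms in blast)

section \<open>The top coefficient functional\<close>

text \<open>For monic q of positive degree this is the coefficient of 1/x in the expansion of u/q at
  infinity. It generates the dual of K[x]/(q) as a module: multiplying the argument by g gives every
  functional (\<open>top_coeff_represent\<close>), with g unique modulo q
  (\<open>top_coeff_nondegenerate\<close>).\<close>

definition top_coeff :: "'a::field poly \<Rightarrow> 'a poly \<Rightarrow> 'a" where
  "top_coeff q u = coeff (u mod q) (degree q - 1)"

lemma top_coeff_add: "top_coeff q (u + v) = top_coeff q u + top_coeff q v"
  by (simp add: top_coeff_def poly_mod_add_left)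
lemma top_coeff_diff: "top_coeff q (u - v) = top_coeff q u - top_coeff q v"
  by (simp add: top_coeff_def poly_mod_diff_left)
lemma top_coeff_smult: "top_coeff q (Polynomial.smult a u) = a * top_coeff q u"
  by (simp add: top_coeff_def mod_smult_left)
lemma top_coeff_0 [simp]: "top_coeff q 0 = 0"
  by (simp add: top_coeff_def)
lemma top_coeff_dvd: "q dvd u \<Longrightarrow> top_coeff q u = 0"
  by (simp add: top_coeff_def dvd_eq_mod_eq_0)
lemma top_coeff_cong: "q dvd u - v \<Longrightarrow> top_coeff q u = top_coeff q v"
  using top_coeff_dvd[of q "u - v"] by (simp add: top_coeff_diff)
lemma top_coeff_sum: "top_coeff q (sum f A) = (\<Sum>i\<in>A. top_coeff q (f i))"
  by (induction A rule: infinite_finite_induct) (auto simp: top_coeff_add)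

lemma top_coeff_small:
  assumes "degree u < degree q"
  shows "top_coeff q u = coeff u (degree q - 1)"
  using assms by (simp add: top_coeff_def mod_poly_less)

text \<open>Multiplying a nonzero remainder by the power of x that brings it to degree exactly n - 1
  exposes its leading coefficient without any reduction by q.\<close>

lemma top_coeff_nondegenerate:
  assumes q: "degree q > 0" and u: "\<And>g. top_coeff q (u * g) = 0"
  shows "q dvd u"
proof (rule ccontr)
  assume "\<not> q dvd u"
  define v where "v = u mod q"
  have q0: "q \<noteq> 0" using q by auto
  have v0: "v \<noteq> 0" using \<open>\<not> q dvd u\<close> v_def by (simp add: dvd_eq_mod_eq_0)
  have d: "degree v < degree q" using v0 v_def degree_mod_less'[OF q0] by auto
  define e where "e = degree q - 1 - degree v"
  have deg: "degree (v * monom 1 e) = degree q - 1"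
    using v0 d by (simp add: degree_mult_eq degree_monom_eq e_def)
  have "top_coeff q (u * monom 1 e) = top_coeff q (v * monom 1 e)"
    by (simp add: top_coeff_def v_def mod_mult_left_eq)
  also have "\<dots> = coeff (v * monom 1 e) (degree (v * monom 1 e))"
    using deg q by (simp add: top_coeff_small)
  also have "\<dots> \<noteq> 0" using v0 by (simp add: lead_coeff_mult degree_monom_eq)
  finally show False using u by simp
qed

text \<open>Greedy elimination: x^(n-1-j) pairs to 1 with x^j and to 0 with the lower powers.\<close>
lemma top_coeff_represent:
  fixes l :: "'a::field poly \<Rightarrow> 'a"
  assumes q: "degree q > 0"
    and add: "\<And>u v. l (u + v) = l u + l v" and sm: "\<And>a u. l (Polynomial.smult a u) = a * l u"
    and van: "\<And>u. l (q * u) = 0"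
  shows "\<exists>g. degree g < degree q \<and> (\<forall>u. l u = top_coeff q (g * u))"
proof -
  let ?n = "degree q"
  have q0: "q \<noteq> 0" using q by auto
  have "j \<le> ?n \<Longrightarrow> \<exists>g. degree g < ?n \<and> (\<forall>i<j. top_coeff q (g * monom 1 i) = l (monom 1 i))" for j
  proof (induction j)
    case 0
    show ?case using q by (intro exI[of _ 0]) auto
  next
    case (Suc j)
    then obtain g where g: "degree g < ?n" "\<And>i. i < j \<Longrightarrow> top_coeff q (g * monom 1 i) = l (monom 1 i)" by auto
    define c where "c = l (monom 1 j) - top_coeff q (g * monom 1 j)"
    define g' where "g' = g + Polynomial.smult c (monom 1 (?n - 1 - j))"
    have t: "top_coeff q (monom 1 (?n - 1 - j) * monom 1 i) = (if i = j then 1 else 0)" if "i \<le> j" for i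
    proof -
      have lt: "?n - 1 - j + i < ?n" using that Suc.prems by auto
      show ?thesis using that Suc.prems lt
        by (auto simp: mult_monom top_coeff_small degree_monom_eq) 
    qed
    have "degree g' < ?n" unfolding g'_def using g(1) q
      by (intro degree_add_less) (auto intro: le_less_trans[OF degree_smult_le] simp: degree_monom_eq)
    moreover have "top_coeff q (g' * monom 1 i) = l (monom 1 i)" if "i < Suc j" for i
      using that t[of i] g(2)[of i]
      by (auto simp: g'_def distrib_right top_coeff_add top_coeff_smult c_def less_Suc_eq)
    ultimately show ?case by blast
  qed
  then obtain g where g: "degree g < ?n" "\<And>i. i < ?n \<Longrightarrow> top_coeff q (g * monom 1 i) = l (monom 1 i)" by blast
  have l0: "l 0 = 0" using sm[of 0 0] by simp
  have lsum: "l (sum f B) = (\<Sum>i\<in>B. l (f i))" for f and B :: "nat set"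
    by (induction B rule: infinite_finite_induct) (auto simp: l0 add)
  have "l u = top_coeff q (g * u)" for u
  proof -
    let ?r = "u mod q"
    have dr: "degree ?r < ?n" using degree_mod_less[OF q0, of u] q by auto
    have u: "u = q * (u div q) + ?r" by simp
    have r: "?r = (\<Sum>i<?n. Polynomial.smult (coeff ?r i) (monom 1 i))"
    proof (rule poly_eqI)
      fix k
      have "coeff (\<Sum>i<?n. Polynomial.smult (coeff ?r i) (monom 1 i)) k = (\<Sum>i<?n. if i = k then coeff ?r i else 0)"
        unfolding coeff_sum by (rule sum.cong) auto
      also have "\<dots> = coeff ?r k" using dr by (auto simp: coeff_eq_0)
      finally show "coeff ?r k = coeff (\<Sum>i<?n. Polynomial.smult (coeff ?r i) (monom 1 i)) k" by simp
    qed
    have "l u = l ?r" by (subst u) (simp only: add van add_0)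
    also have "\<dots> = (\<Sum>i<?n. coeff ?r i * l (monom 1 i))" by (subst r) (simp add: lsum sm)
    also have "\<dots> = (\<Sum>i<?n. coeff ?r i * top_coeff q (g * monom 1 i))" using g(2) by simp
    also have "\<dots> = top_coeff q (g * ?r)"
      by (subst (2) r) (simp add: sum_distrib_left top_coeff_sum top_coeff_smult)
    also have "\<dots> = top_coeff q (g * u)" by (simp add: top_coeff_def mod_mult_right_eq)
    finally show ?thesis .
  qed
  with g(1) show ?thesis by blast
qed

section \<open>Involutions\<close>

locale involution =
  fixes cj :: "'a::field \<Rightarrow> 'a"
  assumes inv: "is_involution cj"
begin

abbreviation bar where "bar \<equiv> pbar cj"

lemma cj_add: "cj (a + b) = cj a + cj b" and cj_mult: "cj (a * b) = cj a * cj b"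
  and cj_cj [simp]: "cj (cj a) = a"
  using inv unfolding is_involution_def by blast+

lemma cj_0 [simp]: "cj 0 = 0" using cj_add[of 0 0] by (metis add_0 add_cancel_right_right)
lemma cj_eq_0 [simp]: "cj a = 0 \<longleftrightarrow> a = 0" by (metis cj_0 cj_cj)
text \<open>\<open>cj 1\<close> is idempotent, and it is nonzero because \<open>cj\<close> is
  injective with \<open>cj 0 = 0\<close>.\<close>

lemma cj_1 [simp]: "cj 1 = 1"
  using cj_mult[of 1 1] by (metis cj_eq_0 mult_cancel_right1 mult_1 zero_neq_one)
lemma cj_minus: "cj (- a) = - cj a" using cj_add[of a "- a"] by (simp add: eq_neg_iff_add_eq_0 add.commute)
lemma cj_diff: "cj (a - b) = cj a - cj b" using cj_add[of a "- b"] by (simp add: cj_minus)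
lemma cj_sum: "cj (sum f A) = (\<Sum>i\<in>A. cj (f i))"
  by (induction A rule: infinite_finite_induct) (auto simp: cj_add)

lemma coeff_bar: "coeff (bar f) i = cj (coeff f i)"
  by (simp add: pbar_def coeff_map_poly)
lemma degree_bar [simp]: "degree (bar f) = degree f"
  by (simp add: pbar_def degree_map_poly)
lemma bar_bar [simp]: "bar (bar f) = f" by (rule poly_eqI) (simp add: coeff_bar)
lemma bar_0 [simp]: "bar 0 = 0" by (rule poly_eqI) (simp add: coeff_bar)
lemma bar_add: "bar (f + g) = bar f + bar g" by (rule poly_eqI) (simp add: coeff_bar cj_add)
lemma bar_diff: "bar (f - g) = bar f - bar g" by (rule poly_eqI) (simp add: coeff_bar cj_diff)
lemma bar_mult: "bar (f * g) = bar f * bar g"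
  by (rule poly_eqI) (simp add: coeff_bar coeff_mult cj_sum cj_mult)
lemma bar_pCons: "bar (pCons a f) = pCons (cj a) (bar f)"
  by (rule poly_eqI) (simp add: coeff_bar coeff_pCons split: nat.split)
lemma bar_const: "bar [:a:] = [:cj a:]" by (simp add: bar_pCons)
lemma bar_1 [simp]: "bar 1 = 1" by (simp add: one_pCons bar_const)
lemma bar_power: "bar (f ^ k) = bar f ^ k" by (induction k) (auto simp: bar_mult)
lemma bar_sum: "bar (sum f A) = (\<Sum>i\<in>A. bar (f i))"
  by (induction A rule: infinite_finite_induct) (auto simp: bar_add)
lemma bar_eq_iff: "bar f = g \<longleftrightarrow> f = bar g" by (metis bar_bar)
lemma bar_inj: "bar f = bar g \<longleftrightarrow> f = g" by (metis bar_bar)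
lemma bar_dvd_bar [simp]: "bar f dvd bar g \<longleftrightarrow> f dvd g"
  by (metis bar_bar bar_mult dvd_def)
lemma bar_monic: "monic f \<Longrightarrow> monic (bar f)" by (simp add: coeff_bar)
lemma bar_mod: "bar (f mod g) = bar f mod bar g"
proof (cases "g = 0")
  case True then show ?thesis by simp
next
  case False
  have "bar f = bar g * bar (f div g) + bar (f mod g)"
    by (metis bar_add bar_mult mult_div_mod_eq)
  then have "bar f mod bar g = bar (f mod g) mod bar g" by simp
  moreover have "bar (f mod g) mod bar g = bar (f mod g)"
    using degree_mod_less[OF False, of f] by (auto intro: mod_poly_less)
  ultimately show ?thesis by simp
qed
lemma bar_irreducible: "irreducible f \<Longrightarrow> irreducible (bar f)"
proof (rule irreducibleI)
  assume f: "irreducible f"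
  show "bar f \<noteq> 0" using f by (metis bar_0 bar_inj not_irreducible_zero)
  show "\<not> bar f dvd 1" using f by (metis bar_1 bar_dvd_bar irreducible_def)
  fix a b assume "bar f = a * b"
  then have "f = bar a * bar b" by (metis bar_bar bar_mult)
  then have "bar a dvd 1 \<or> bar b dvd 1" using f irreducibleD by blast
  then show "a dvd 1 \<or> b dvd 1" by (metis bar_1 bar_bar bar_dvd_bar)
qed
lemma bar_prime_power: "prime_power q \<Longrightarrow> prime_power (bar q)"
  unfolding prime_power_def using bar_irreducible bar_monic bar_power by metis

lemma top_coeff_bar: "top_coeff (bar q) (bar u) = cj (top_coeff q u)"
  by (simp add: top_coeff_def bar_mod[symmetric] coeff_bar)

end


section \<open>Determinants modulo an ideal\<close>

lemma prod_diff_dvd: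
  fixes f g :: "'b \<Rightarrow> 'a::comm_ring_1"
  assumes "\<And>i. i \<in> A \<Longrightarrow> m dvd f i - g i"
  shows "m dvd prod f A - prod g A"
  using assms
proof (induction A rule: infinite_finite_induct)
  case (insert x A)
  have "m dvd (f x - g x) * prod f A + g x * (prod f A - prod g A)"
    using insert by simp
  then show ?case using insert by (simp add: algebra_simps)
qed auto

text \<open>The Leibniz formula respects congruences. Rings such as K[x]/(p) never appear as types
  here; matrices over them are polynomial matrices compared entrywise by divisibility.\<close>

lemma det_diff_dvd:
  fixes A B :: "'a::comm_ring_1 mat"
  assumes A: "A \<in> carrier_mat n n" and B: "B \<in> carrier_mat n n"
    and d: "\<And>i j. i < n \<Longrightarrow> j < n \<Longrightarrow> m dvd A $$ (i,j) - B $$ (i,j)"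
  shows "m dvd det A - det B"
proof -
  have "det A - det B = (\<Sum>p | p permutes {0..<n}.
      signof p * ((\<Prod>i = 0..<n. A $$ (i, p i)) - (\<Prod>i = 0..<n. B $$ (i, p i))))"
    unfolding det_def'[OF A] det_def'[OF B] by (simp add: sum_subtractf right_diff_distrib)
  also have "m dvd \<dots>"
  proof (intro dvd_sum dvd_mult prod_diff_dvd)
    fix p i assume "p \<in> {p. p permutes {0..<n}}" "i \<in> {0..<n}"
    then show "m dvd A $$ (i, p i) - B $$ (i, p i)" by (intro d) (auto simp: permutes_in_image)
  qed
  finally show ?thesis .
qed

text \<open>Padding the factors with zeros to square matrices makes their determinants vanish.\<close>
lemma left_inverse_mod_card_le:
  fixes R :: "'c \<Rightarrow> 'b \<Rightarrow> 'a::comm_ring_1"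
  assumes fin: "finite I" "finite I'" and m: "\<not> m dvd 1"
    and inv: "\<And>a b. a \<in> I' \<Longrightarrow> b \<in> I' \<Longrightarrow> m dvd (\<Sum>k\<in>I. R a k * S k b) - (if a = b then 1 else 0)"
  shows "card I' \<le> card I"
proof (rule ccontr)
  assume "\<not> ?thesis"
  then have lt: "card I < card I'" by simp
  let ?N = "card I'" and ?n = "card I"
  obtain f where f: "bij_betw f {0..<?n} I" using ex_bij_betw_nat_finite[OF fin(1)] by blast
  obtain g where g: "bij_betw g {0..<?N} I'" using ex_bij_betw_nat_finite[OF fin(2)] by blast
  define A where "A = mat ?N ?N (\<lambda>(i,k). if k < ?n then R (g i) (f k) else 0)"
  define B where "B = mat ?N ?N (\<lambda>(k,j). if k < ?n then S (f k) (g j) else 0)"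
  have AB: "A \<in> carrier_mat ?N ?N" "B \<in> carrier_mat ?N ?N" by (auto simp: A_def B_def)
  have gI: "i < ?N \<Longrightarrow> g i \<in> I'" for i using g by (auto simp: bij_betw_def)
  have ginj: "i < ?N \<Longrightarrow> j < ?N \<Longrightarrow> g i = g j \<longleftrightarrow> i = j" for i j
    using g by (auto simp: bij_betw_def inj_on_def)
  have entry: "(A * B) $$ (i,j) = (\<Sum>k\<in>I. R (g i) k * S k (g j))" if "i < ?N" "j < ?N" for i j
  proof -
    have "(A * B) $$ (i,j) = (\<Sum>k\<in>{0..<?N}. if k < ?n then R (g i) (f k) * S (f k) (g j) else 0)"
      using that AB by (simp add: A_def B_def scalar_prod_def) (rule sum.cong, auto)
    also have "\<dots> = (\<Sum>k\<in>{0..<?n}. R (g i) (f k) * S (f k) (g j))"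
      using lt by (intro sum.mono_neutral_cong_right) auto
    also have "\<dots> = (\<Sum>k\<in>I. R (g i) k * S k (g j))"
      by (rule sum.reindex_bij_betw[OF f])
    finally show ?thesis .
  qed
  have "m dvd det (A * B) - det (1\<^sub>m ?N)"
  proof (rule det_diff_dvd[of _ ?N])
    fix i j assume ij: "i < ?N" "j < ?N"
    show "m dvd (A * B) $$ (i, j) - 1\<^sub>m ?N $$ (i, j)"
      using inv[OF gI[OF ij(1)] gI[OF ij(2)]] ij ginj entry[OF ij] by simp
  qed (use AB in auto)
  moreover have "det B = 0"
  proof -
    have "(\<Prod>i = 0..<?N. B $$ (i, p i)) = 0" if "p permutes {0..<?N}" for p
    proof (rule prod_zero)
      have "p ?n < ?N" using permutes_in_image[OF that, of ?n] lt by simp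
      then show "\<exists>i\<in>{0..<?N}. B $$ (i, p i) = 0" using lt by (intro bexI[of _ ?n]) (auto simp: B_def)
    qed simp
    then show ?thesis unfolding det_def'[OF AB(2)] by (intro sum.neutral) auto
  qed
  ultimately have "m dvd 1" using det_mult[OF AB] by (metis det_one diff_0 dvd_minus_iff mult_zero_right)
  with m show False by simp
qed

section \<open>K[x]-modules with a Hermitian form\<close>

text \<open>Scalars act as constant polynomials, and \<open>h_adj\<close> expresses that x acts
  selfadjointly. Finite dimension and nondegeneracy are not part of the locale: they are imposed on
  submodules W of the type, since the existence proof passes repeatedly to orthogonal
  complements.\<close>

locale herm_module = involution cj for cj :: "'a::field \<Rightarrow> 'a" +
  fixes eps :: 'a and act :: "'a poly \<Rightarrow> 'v::ab_group_add \<Rightarrow> 'v" and h :: "'v \<Rightarrow> 'v \<Rightarrow> 'a"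
  assumes two: "(2::'a) \<noteq> 0" and eps: "eps = 1 \<or> eps = -1" and eps_inv: "cj \<noteq> id \<longrightarrow> eps = 1"
    and act_add: "act f (u + v) = act f u + act f v"
    and add_act: "act (f + g) v = act f v + act g v"
    and act_mult: "act (f * g) v = act f (act g v)"
    and act_1 [simp]: "act 1 v = v"
    and h_add: "h u (v + w) = h u v + h u w"
    and h_const: "h u (act [:a:] v) = a * h u v"
    and h_sym: "h v u = eps * cj (h u v)"
    and h_adj: "h (act f u) v = h u (act (pbar cj f) v)"
begin

lemma cj_eps [simp]: "cj eps = eps" using eps by (auto simp: cj_minus)
lemma eps_eps [simp]: "eps * eps = 1" "eps * (eps * y) = y" using eps by auto

lemma act_zero [simp]: "act f 0 = 0" using act_add[of f 0 0] by simp
lemma zero_act [simp]: "act 0 v = 0" using add_act[of 0 0 v] by simp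
lemma act_minus: "act f (- v) = - act f v"
  using act_add[of f v "- v"] by (simp add: eq_neg_iff_add_eq_0 add.commute)
lemma minus_act: "act (- f) v = - act f v"
  using add_act[of f "- f" v] by (simp add: eq_neg_iff_add_eq_0 add.commute)
lemma act_diff: "act f (u - v) = act f u - act f v"
  using act_add[of f u "- v"] by (simp add: act_minus)
lemma diff_act: "act (f - g) v = act f v - act g v"
  using add_act[of f "- g" v] by (simp add: minus_act)
lemma act_sum: "act f (sum x A) = (\<Sum>i\<in>A. act f (x i))"
  by (induction A rule: infinite_finite_induct) (auto simp: act_add)
lemma act_comm: "act f (act g v) = act g (act f v)"
  by (metis act_mult mult.commute)
lemma act_dvd: "f dvd g \<Longrightarrow> act f v = 0 \<Longrightarrow> act g v = 0"
  by (metis act_comm act_mult act_zero dvdE)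
lemma act_cong: "q dvd f - g \<Longrightarrow> act q v = 0 \<Longrightarrow> act f v = act g v"
  using act_dvd[of q "f - g" v] by (simp add: diff_act)

lemma h_zero [simp]: "h u 0 = 0" using h_add[of u 0 0] by (metis add_0 add_cancel_right_right)
lemma h_zero_left [simp]: "h 0 u = 0" using h_sym[of 0 u] by simp
lemma h_minus: "h u (- v) = - h u v"
  using h_add[of u v "- v"] by (simp add: eq_neg_iff_add_eq_0 add.commute)
lemma h_diff: "h u (v - w) = h u v - h u w"
  using h_add[of u v "- w"] by (simp add: h_minus)
lemma h_sum: "h u (sum x A) = (\<Sum>i\<in>A. h u (x i))"
  by (induction A rule: infinite_finite_induct) (auto simp: h_add)
lemma h_add_left: "h (u + v) w = h u w + h v w"
  using h_sym[of "u + v" w] h_sym[of u w] h_sym[of v w] by (simp add: h_add cj_add algebra_simps)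
lemma h_sum_left: "h (sum x A) u = (\<Sum>i\<in>A. h (x i) u)"
  by (induction A rule: infinite_finite_induct) (auto simp: h_add_left)
lemma h_diff_left: "h (u - v) w = h u w - h v w"
  using h_add_left[of "u - v" v w] by simp
lemma h_adj': "h u (act f v) = h (act (bar f) u) v"
  by (simp add: h_adj)
lemma h_sym_act: "h v (act f u) = eps * cj (h u (act (bar f) v))"
  by (metis h_adj' h_sym)

lemma h_represent:
  assumes q: "degree q > 0" and d: "act q d = 0"
  shows "\<exists>g. degree g < degree q \<and> (\<forall>u. h e (act u d) = top_coeff q (g * u))"
proof (rule top_coeff_represent[OF q])
  fix u v a
  show "h e (act (u + v) d) = h e (act u d) + h e (act v d)" by (simp add: add_act h_add)
  have "Polynomial.smult a u = [:a:] * u" by simp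
  then show "h e (act (Polynomial.smult a u) d) = a * h e (act u d)" by (simp only: act_mult h_const)
  show "h e (act (q * u) d) = 0" by (simp add: act_mult act_comm[of q] d)
qed

definition submodule :: "'v set \<Rightarrow> bool" where
  "submodule W \<longleftrightarrow> 0 \<in> W \<and> (\<forall>u\<in>W. \<forall>v\<in>W. u + v \<in> W) \<and> (\<forall>f. \<forall>u\<in>W. act f u \<in> W)"

lemma submodule_minus: "submodule W \<Longrightarrow> u \<in> W \<Longrightarrow> - u \<in> W"
  unfolding submodule_def by (metis act_1 minus_act)
lemma submodule_diff: "submodule W \<Longrightarrow> u \<in> W \<Longrightarrow> v \<in> W \<Longrightarrow> u - v \<in> W"
  using submodule_minus unfolding submodule_def by (metis diff_conv_add_uminus)
lemma submodule_sum: "submodule W \<Longrightarrow> (\<And>i. i \<in> A \<Longrightarrow> x i \<in> W) \<Longrightarrow> sum x A \<in> W"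
  by (induction A rule: infinite_finite_induct) (auto simp: submodule_def)
lemma submodule_act: "submodule W \<Longrightarrow> u \<in> W \<Longrightarrow> act f u \<in> W"
  by (simp add: submodule_def)

definition nondegenerate :: "'v set \<Rightarrow> bool" where
  "nondegenerate W \<longleftrightarrow> (\<forall>u\<in>W. (\<forall>w\<in>W. h w u = 0) \<longrightarrow> u = 0)"

text \<open>A frame is a family of cyclic generators x in which each generator pairs nontrivially with exactly
  one other, its twin under tau; c gives the annihilators, J the forms.\<close>

definition frame_data :: "'i set \<Rightarrow> ('i \<Rightarrow> 'a poly) \<Rightarrow> ('i \<Rightarrow> 'i) \<Rightarrow> ('i \<Rightarrow> 'a poly) \<Rightarrow> bool" where
  "frame_data Om c tau J \<longleftrightarrow> finite Om \<and> (\<forall>\<alpha>\<in>Om. tau \<alpha> \<in> Om \<and> tau (tau \<alpha>) = \<alpha>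
     \<and> c (tau \<alpha>) = bar (c \<alpha>) \<and> prime_power (c \<alpha>) \<and> (\<exists>a. c \<alpha> dvd a * J \<alpha> - 1))"

text \<open>Separated from \<open>frame\<close>, which adds the spanning condition, in order to
  describe one summand inside a larger W.\<close>

definition frame_gens :: "'v set \<Rightarrow> 'i set \<Rightarrow> ('i \<Rightarrow> 'a poly) \<Rightarrow> ('i \<Rightarrow> 'i) \<Rightarrow> ('i \<Rightarrow> 'a poly) \<Rightarrow> ('i \<Rightarrow> 'v) \<Rightarrow> bool" where
  "frame_gens W Om c tau J x \<longleftrightarrow> frame_data Om c tau J
     \<and> (\<forall>\<alpha>\<in>Om. x \<alpha> \<in> W \<and> act (c \<alpha>) (x \<alpha>) = 0)
     \<and> (\<forall>\<alpha>\<in>Om. \<forall>\<beta>\<in>Om. \<forall>g. h (x (tau \<alpha>)) (act g (x \<beta>)) = (if \<alpha> = \<beta> then top_coeff (c \<alpha>) (J \<alpha> * g) else 0))"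

definition comb :: "'i set \<Rightarrow> ('i \<Rightarrow> 'a poly) \<Rightarrow> ('i \<Rightarrow> 'v) \<Rightarrow> 'v" where
  "comb Om u x = (\<Sum>\<alpha>\<in>Om. act (u \<alpha>) (x \<alpha>))"

definition frame :: "'v set \<Rightarrow> 'i set \<Rightarrow> ('i \<Rightarrow> 'a poly) \<Rightarrow> ('i \<Rightarrow> 'i) \<Rightarrow> ('i \<Rightarrow> 'a poly) \<Rightarrow> ('i \<Rightarrow> 'v) \<Rightarrow> bool" where
  "frame W Om c tau J x \<longleftrightarrow> frame_gens W Om c tau J x \<and> (\<forall>w\<in>W. \<exists>u. w = comb Om u x)"

section \<open>Coordinates with respect to a frame\<close>

lemma act_comb: "act g (comb Om u x) = comb Om (\<lambda>\<alpha>. g * u \<alpha>) x"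
  by (simp add: comb_def act_sum act_mult)
lemma comb_add: "comb Om u x + comb Om v x = comb Om (\<lambda>\<alpha>. u \<alpha> + v \<alpha>) x"
  by (simp add: comb_def add_act sum.distrib)
lemma comb_diff: "comb Om u x - comb Om v x = comb Om (\<lambda>\<alpha>. u \<alpha> - v \<alpha>) x"
  by (simp add: comb_def diff_act sum_subtractf)
lemma comb_in: "submodule W \<Longrightarrow> (\<And>\<alpha>. \<alpha> \<in> Om \<Longrightarrow> x \<alpha> \<in> W) \<Longrightarrow> comb Om u x \<in> W"
  unfolding comb_def by (intro submodule_sum submodule_act)

lemma frame_dataD:
  assumes "frame_data Om c tau J" "\<alpha> \<in> Om"
  shows "finite Om" "tau \<alpha> \<in> Om" "tau (tau \<alpha>) = \<alpha>" "c (tau \<alpha>) = bar (c \<alpha>)" "prime_power (c \<alpha>)"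
    "\<exists>a. c \<alpha> dvd a * J \<alpha> - 1"
  using assms unfolding frame_data_def by auto

lemma frame_data_bij: "frame_data Om c tau J \<Longrightarrow> bij_betw tau Om Om"
  by (rule bij_betw_byWitness[where f' = tau]) (auto simp: frame_data_def)

lemma frame_gensD:
  assumes "frame_gens W Om c tau J x" 
  shows "frame_data Om c tau J" "\<And>\<alpha>. \<alpha> \<in> Om \<Longrightarrow> x \<alpha> \<in> W" "\<And>\<alpha>. \<alpha> \<in> Om \<Longrightarrow> act (c \<alpha>) (x \<alpha>) = 0"
    "\<And>\<alpha> \<beta> g. \<alpha> \<in> Om \<Longrightarrow> \<beta> \<in> Om \<Longrightarrow>
      h (x (tau \<alpha>)) (act g (x \<beta>)) = (if \<alpha> = \<beta> then top_coeff (c \<alpha>) (J \<alpha> * g) else 0)"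
  using assms unfolding frame_gens_def by blast+

lemma frame_pair_comb:
  assumes F: "frame_gens W Om c tau J x" and a: "\<alpha> \<in> Om"
  shows "h (x (tau \<alpha>)) (act g (comb Om u x)) = top_coeff (c \<alpha>) (J \<alpha> * (g * u \<alpha>))"
proof -
  note D = frame_gensD[OF F]
  have "h (x (tau \<alpha>)) (act g (comb Om u x)) = (\<Sum>\<beta>\<in>Om. h (x (tau \<alpha>)) (act (g * u \<beta>) (x \<beta>)))"
    by (simp add: act_comb) (simp add: comb_def h_sum)
  also have "\<dots> = (\<Sum>\<beta>\<in>Om. if \<alpha> = \<beta> then top_coeff (c \<alpha>) (J \<alpha> * (g * u \<alpha>)) else 0)"
    by (rule sum.cong) (auto simp: D(4) a)
  finally show ?thesis using a frame_dataD(1)[OF D(1) a] by simp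
qed

text \<open>Pairing with the twin isolates one coordinate; nondegeneracy of \<open>top_coeff\<close>
  and invertibility of J modulo c then give the divisibility. In particular the annihilator of
  \<open>x \<alpha>\<close> is generated by \<open>c \<alpha>\<close>.\<close>

lemma frame_indep:
  assumes F: "frame_gens W Om c tau J x" and a: "\<alpha> \<in> Om" and z: "act g (comb Om u x) = 0"
  shows "c \<alpha> dvd g * u \<alpha>"
proof -
  note D = frame_dataD[OF frame_gensD(1)[OF F] a]
  obtain b where b: "c \<alpha> dvd b * J \<alpha> - 1" using D(6) by blast
  have "c \<alpha> dvd J \<alpha> * (g * u \<alpha>)"
  proof (rule top_coeff_nondegenerate)
    fix g'
    have "h (x (tau \<alpha>)) (act (g' * g) (comb Om u x)) = 0" by (simp add: act_mult z)
    then show "top_coeff (c \<alpha>) (J \<alpha> * (g * u \<alpha>) * g') = 0"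
      by (simp add: frame_pair_comb[OF F a] ac_simps)
  qed (use prime_powerD D(5) in blast)
  then show ?thesis by (rule dvd_mult_unit_mod[OF b])
qed

text \<open>The generator of index \<alpha> pairs only with its twin, so the sum over the first
  argument is reindexed by \<open>tau\<close>; hence the coefficient
  \<open>v (tau \<alpha>)\<close>.\<close>

lemma frame_form:
  assumes F: "frame_gens W Om c tau J x"
  shows "h (comb Om v x) (act g (comb Om u x)) =
    (\<Sum>\<alpha>\<in>Om. top_coeff (c \<alpha>) (J \<alpha> * (g * (bar (v (tau \<alpha>)) * u \<alpha>))))"
proof -
  note D = frame_gensD(1)[OF F]
  let ?f = "\<lambda>\<beta>. h (act (v \<beta>) (x \<beta>)) (act g (comb Om u x))"
  have "h (comb Om v x) (act g (comb Om u x)) = (\<Sum>\<beta>\<in>Om. ?f \<beta>)"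
    by (subst comb_def) (simp add: h_sum_left)
  also have "\<dots> = (\<Sum>\<alpha>\<in>Om. ?f (tau \<alpha>))"
    by (rule sum.reindex_bij_betw[symmetric, OF frame_data_bij[OF D]])
  also have "\<dots> = (\<Sum>\<alpha>\<in>Om. top_coeff (c \<alpha>) (J \<alpha> * (g * (bar (v (tau \<alpha>)) * u \<alpha>))))"
  proof (rule sum.cong)
    fix \<alpha> assume a: "\<alpha> \<in> Om"
    have "?f (tau \<alpha>) = h (x (tau \<alpha>)) (act (bar (v (tau \<alpha>)) * g) (comb Om u x))"
      by (simp add: h_adj act_mult)
    also have "\<dots> = top_coeff (c \<alpha>) (J \<alpha> * (g * (bar (v (tau \<alpha>)) * u \<alpha>)))"
      by (simp add: frame_pair_comb[OF F a] ac_simps)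
    finally show "?f (tau \<alpha>) = \<dots>" .
  qed simp
  finally show ?thesis .
qed

text \<open>Orthogonal projection to the span of the generators. The functional g |-> h (x (tau
  \<alpha>)) (act g w) vanishes on multiples of \<open>c \<alpha>\<close>, since the conjugate of
  \<open>c \<alpha>\<close> annihilates the twin. It is therefore represented by a polynomial, and
  dividing that by J yields the coordinate of the projection.\<close>

lemma frame_proj:
  assumes F: "frame_gens W Om c tau J x"
  shows "\<exists>u. \<forall>\<alpha>\<in>Om. \<forall>g. h (x \<alpha>) (act g (w - comb Om u x)) = 0"
proof -
  note D = frame_gensD[OF F]
  have "\<exists>y. \<forall>g. h (x (tau \<alpha>)) (act g w) = top_coeff (c \<alpha>) (J \<alpha> * (g * y))" if a: "\<alpha> \<in> Om" for \<alpha>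
  proof -
    note E = frame_dataD[OF D(1) a]
    have "\<exists>y. degree y < degree (c \<alpha>) \<and> (\<forall>g. h (x (tau \<alpha>)) (act g w) = top_coeff (c \<alpha>) (y * g))"
    proof (rule top_coeff_represent)
      show "0 < degree (c \<alpha>)" using E(5) prime_powerD by blast
      fix u v b
      show "h (x (tau \<alpha>)) (act (u + v) w) = h (x (tau \<alpha>)) (act u w) + h (x (tau \<alpha>)) (act v w)"
        by (simp add: add_act h_add)
      have "Polynomial.smult b u = [:b:] * u" by simp
      then show "h (x (tau \<alpha>)) (act (Polynomial.smult b u) w) = b * h (x (tau \<alpha>)) (act u w)"
        by (simp only: act_mult h_const)
      have "h (x (tau \<alpha>)) (act (c \<alpha> * u) w) = h (act (c (tau \<alpha>)) (x (tau \<alpha>))) (act u w)"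
        by (simp add: act_mult h_adj E)
      then show "h (x (tau \<alpha>)) (act (c \<alpha> * u) w) = 0" using D(3) E(2) by simp
    qed
    then obtain y where y: "\<And>g. h (x (tau \<alpha>)) (act g w) = top_coeff (c \<alpha>) (y * g)" by blast
    obtain b where b: "c \<alpha> dvd b * J \<alpha> - 1" using E(6) by blast
    have "top_coeff (c \<alpha>) (y * g) = top_coeff (c \<alpha>) (J \<alpha> * (g * (b * y)))" for g
    proof (rule top_coeff_cong)
      have "y * g - J \<alpha> * (g * (b * y)) = - (y * g) * (b * J \<alpha> - 1)" by (simp add: algebra_simps)
      then show "c \<alpha> dvd y * g - J \<alpha> * (g * (b * y))" using b by (metis dvd_mult)
    qed
    with y show ?thesis by metis
  qed
  then obtain u where u: "\<And>\<alpha> g. \<alpha> \<in> Om \<Longrightarrow> h (x (tau \<alpha>)) (act g w) = top_coeff (c \<alpha>) (J \<alpha> * (g * u \<alpha>))"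
    by metis
  have "h (x \<alpha>) (act g (w - comb Om u x)) = 0" if a: "\<alpha> \<in> Om" for \<alpha> g
  proof -
    note E = frame_dataD[OF D(1) a]
    show ?thesis using u[OF E(2), of g] frame_pair_comb[OF F E(2), of g u] E(3)
      by (simp add: act_diff h_diff)
  qed
  then show ?thesis by blast
qed

text \<open>On multiples of \<open>p ^ (k - 1)\<close> the generators with annihilators other than \<open>p ^ k\<close>
  contribute nothing (\<open>prime_power_distinct\<close>).\<close>
lemma frame_compare:
  assumes F: "frame_gens W Om c tau J x" and F': "frame_gens W' Om' c' tau' J' x'"
    and s: "\<And>\<beta>. \<beta> \<in> Om' \<Longrightarrow> x' \<beta> = comb Om (s \<beta>) x"
    and p: "irreducible p" "monic p" and k: "0 < k"
    and b: "\<beta> \<in> Om'" "c' \<beta> = p ^ k" and b': "\<beta>' \<in> Om'" "c' \<beta>' = p ^ k"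
  shows "p dvd (\<Sum>\<alpha> | \<alpha> \<in> Om \<and> c \<alpha> = p ^ k. bar (s (tau' \<beta>') (tau \<alpha>)) * J \<alpha> * s \<beta> \<alpha>)
     - (if \<beta>' = \<beta> then J' \<beta> else 0)"
proof -
  note D = frame_gensD[OF F] and D' = frame_gensD[OF F']
  define q where "q = p ^ k"
  define pk where "pk = p ^ (k - 1)"
  have q: "q = p * pk" using k by (simp add: q_def pk_def power_eq_if)
  have p0: "p \<noteq> 0" using p by auto
  let ?I = "{\<alpha> \<in> Om. c \<alpha> = p ^ k}"
  let ?t = "\<lambda>\<alpha>. bar (s (tau' \<beta>') (tau \<alpha>)) * s \<beta> \<alpha>"
  let ?X = "(\<Sum>\<alpha>\<in>?I. J \<alpha> * ?t \<alpha>) - (if \<beta>' = \<beta> then J' \<beta> else 0)"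
  have fin: "finite Om" using D(1) by (simp add: frame_data_def)
  note E' = frame_dataD[OF D'(1) b'(1)]
  \<comment> \<open>Testing against all multiples of p^(k-1) gives a congruence modulo p^k for
    p^(k-1) times the wanted difference; cancelling p^(k-1) leaves the modulus p.\<close>
  have "q dvd pk * ?X"
  proof (rule top_coeff_nondegenerate)
    show "0 < degree q" using irreducible_degree_pos[OF p(1)] p0 k by (simp add: q_def degree_power_eq)
    fix g
    \<comment> \<open>q kills \<open>x' \<beta>\<close> and its conjugate kills
      \<open>x' (tau' \<beta>')\<close>. By independence this constrains both coefficients;
      conjugating the second constraint turns its modulus into \<open>c \<alpha>\<close> as
      well.\<close>
    have van: "c \<alpha> dvd pk * s \<beta> \<alpha> * bar (s (tau' \<beta>') (tau \<alpha>))" if a: "\<alpha> \<in> Om" "c \<alpha> \<noteq> q" for \<alpha>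
    proof -
      note E = frame_dataD[OF D(1) a(1)]
      obtain r m where r: "irreducible r" "monic r" "c \<alpha> = r ^ m"
        using E(5) unfolding prime_power_def by blast
      have 1: "c \<alpha> dvd q * s \<beta> \<alpha>"
        using D'(3)[OF b(1)] by (intro frame_indep[OF F a(1)]) (simp add: b(2) q_def s[OF b(1), symmetric])
      have "bar (c \<alpha>) dvd bar q * s (tau' \<beta>') (tau \<alpha>)"
        unfolding E(4)[symmetric]
        using D'(3)[OF E'(2)] by (intro frame_indep[OF F E(2)]) (simp add: E' b'(2) q_def s[OF E'(2), symmetric])
      then have "bar (c \<alpha>) dvd bar (q * bar (s (tau' \<beta>') (tau \<alpha>)))" by (simp add: bar_mult)
      then have 2: "c \<alpha> dvd q * bar (s (tau' \<beta>') (tau \<alpha>))" by simp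
      show ?thesis unfolding r(3) pk_def
        by (rule prime_power_distinct[OF p r(1,2) _ k]) (use 1 2 a(2) r(3) q_def in simp_all)
    qed
    have "(if \<beta>' = \<beta> then top_coeff q (J' \<beta> * (pk * g)) else 0)
        = h (x' (tau' \<beta>')) (act (pk * g) (x' \<beta>))"
      using D'(4)[OF b'(1) b(1)] b' q_def by (cases "\<beta>' = \<beta>") auto
    also have "\<dots> = (\<Sum>\<alpha>\<in>Om. top_coeff (c \<alpha>) (J \<alpha> * (pk * g * ?t \<alpha>)))"
      unfolding s[OF b(1)] s[OF E'(2)] by (rule frame_form[OF F])
    also have "\<dots> = (\<Sum>\<alpha>\<in>?I. top_coeff q (J \<alpha> * (pk * g * ?t \<alpha>)))"
    proof (rule sum.mono_neutral_cong_right)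
      show "\<forall>\<alpha>\<in>Om - ?I. top_coeff (c \<alpha>) (J \<alpha> * (pk * g * ?t \<alpha>)) = 0"
      proof
        fix \<alpha> assume "\<alpha> \<in> Om - ?I"
        then have "c \<alpha> dvd (pk * s \<beta> \<alpha> * bar (s (tau' \<beta>') (tau \<alpha>))) * (g * J \<alpha>)"
          using van q_def by (auto intro: dvd_mult2)
        then show "top_coeff (c \<alpha>) (J \<alpha> * (pk * g * ?t \<alpha>)) = 0"
          by (intro top_coeff_dvd) (simp only: mult_ac)
      qed
    qed (auto simp: fin q_def)
    also have "\<dots> = top_coeff q ((\<Sum>\<alpha>\<in>?I. J \<alpha> * ?t \<alpha>) * (pk * g))"
      unfolding top_coeff_sum[symmetric] sum_distrib_right by (simp only: mult_ac)
    finally have "top_coeff q ((\<Sum>\<alpha>\<in>?I. J \<alpha> * ?t \<alpha>) * (pk * g)) - top_coeff q ((if \<beta>' = \<beta> then J' \<beta> else 0) * (pk * g)) = 0"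
      by (cases "\<beta>' = \<beta>") simp_all
    then show "top_coeff q (pk * ?X * g) = 0"
      unfolding top_coeff_diff[symmetric] by (simp add: algebra_simps)
  qed
  then have "p dvd ?X" using p0 unfolding q pk_def by (simp add: mult.commute)
  then show ?thesis by (simp add: ac_simps)
qed

text \<open>Multiplying the congruence of \<open>frame_compare\<close> by inverses of the J' makes
  its right-hand side the identity. The coefficients of the new generators with annihilator q in the
  old ones thus have a left inverse modulo p, and there cannot be more columns than rows.\<close>

lemma frame_card_le:
  assumes F: "frame W Om c tau J x" and F': "frame W Om' c' tau' J' x'"
    and q: "prime_power q"
  shows "card {\<beta> \<in> Om'. c' \<beta> = q} \<le> card {\<alpha> \<in> Om. c \<alpha> = q}"
proof -
  obtain p k where p: "irreducible p" "monic p" "0 < k" "q = p ^ k" using q unfolding prime_power_def by blast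
  have G: "frame_gens W Om c tau J x" and G': "frame_gens W Om' c' tau' J' x'"
    using F F' unfolding frame_def by auto
  note D = frame_gensD[OF G] and D' = frame_gensD[OF G']
  have "\<forall>\<beta>\<in>Om'. \<exists>s. x' \<beta> = comb Om s x"
    using F D'(2) unfolding frame_def by blast
  from bchoice[OF this] obtain s where s: "\<And>\<beta>. \<beta> \<in> Om' \<Longrightarrow> x' \<beta> = comb Om (s \<beta>) x" by blast
  have "\<forall>\<beta>\<in>Om'. \<exists>a. c' \<beta> dvd a * J' \<beta> - 1"
    using frame_dataD(6)[OF D'(1)] by blast
  from bchoice[OF this] obtain a where a: "\<And>\<beta>. \<beta> \<in> Om' \<Longrightarrow> c' \<beta> dvd a \<beta> * J' \<beta> - 1" by blast
  show ?thesis
  proof (rule left_inverse_mod_card_le[where m = p and S = "\<lambda>\<alpha> \<beta>. s \<beta> \<alpha>"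
        and R = "\<lambda>\<beta>' \<alpha>. a \<beta>' * (bar (s (tau' \<beta>') (tau \<alpha>)) * J \<alpha>)"])
    show "\<not> p dvd 1" using p(1) by (rule irreducible_not_unit)
    show "finite {\<alpha> \<in> Om. c \<alpha> = q}" "finite {\<beta> \<in> Om'. c' \<beta> = q}"
      using D(1) D'(1) by (auto simp: frame_data_def)
    fix \<beta>' \<beta> assume "\<beta>' \<in> {\<beta> \<in> Om'. c' \<beta> = q}" "\<beta> \<in> {\<beta> \<in> Om'. c' \<beta> = q}"
    then have b: "\<beta> \<in> Om'" "c' \<beta> = p ^ k" and b': "\<beta>' \<in> Om'" "c' \<beta>' = p ^ k" using p by auto
    let ?Y = "\<Sum>\<alpha> | \<alpha> \<in> Om \<and> c \<alpha> = p ^ k. bar (s (tau' \<beta>') (tau \<alpha>)) * J \<alpha> * s \<beta> \<alpha>"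
    let ?d = "if \<beta>' = \<beta> then J' \<beta> else 0"
    have "p dvd ?Y - ?d" using frame_compare[OF G G' s p(1-3) b b'] by blast
    moreover have "p dvd c' \<beta>" unfolding b(2) using p(3) by (intro dvd_power) simp
    then have "p dvd a \<beta> * J' \<beta> - 1" using a[OF b(1)] dvd_trans by blast
    ultimately have "p dvd a \<beta>' * (?Y - ?d) + (if \<beta>' = \<beta> then a \<beta> * J' \<beta> - 1 else 0)"
      by (intro dvd_add dvd_mult) auto
    also have "\<dots> = a \<beta>' * ?Y - (if \<beta>' = \<beta> then 1 else 0)" by (auto simp: algebra_simps)
    finally show "p dvd (\<Sum>\<alpha> | \<alpha> \<in> Om \<and> c \<alpha> = q. a \<beta>' * (bar (s (tau' \<beta>') (tau \<alpha>)) * J \<alpha>) * s \<beta> \<alpha>)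
        - (if \<beta>' = \<beta> then 1 else 0)"
      by (simp add: sum_distrib_left mult.assoc p(4))
  qed
qed

lemma frame_card_eq:
  assumes "frame W Om c tau J x" "frame W Om' c' tau' J' x'" "prime_power q"
  shows "card {\<beta> \<in> Om'. c' \<beta> = q} = card {\<alpha> \<in> Om. c \<alpha> = q}"
  using frame_card_le[OF assms] frame_card_le[OF assms(2,1,3)] by simp

end


section \<open>Frobenius blocks\<close>

text \<open>Expansion along the first row, where only the first and the last column contribute.
  Deleting the first column leaves the same pattern with c shifted by one, which is why c is
  arbitrary in the induction. Deleting the last one leaves a triangular matrix with -1 on the
  diagonal, whose determinant cancels the cofactor sign. The recursion is Horner's scheme.\<close>

lemma det_companion_pattern:
  fixes c :: "nat \<Rightarrow> 'a::field"
  shows "det (mat (Suc n) (Suc n) (\<lambda>(i,j). (if i = j then [:0,1:] else 0)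
      + (if j = n then [:c i:] else if i = Suc j then - 1 else 0)))
    = monom 1 (Suc n) + (\<Sum>i<Suc n. monom (c i) i)"
proof (induction n arbitrary: c)
  case 0
  show ?case by (subst det_single) (auto simp: monom_Suc monom_0)
next
  case (Suc n)
  let ?D = "\<lambda>n c. mat (Suc n) (Suc n) (\<lambda>(i,j). (if i = j then [:0,1:] else (0::'a poly))
      + (if j = n then [:c i:] else if i = Suc j then - 1 else 0))"
  let ?N = "Suc (Suc n)"
  have D: "?D (Suc n) c \<in> carrier_mat ?N ?N" by simp
  have del0: "mat_delete (?D (Suc n) c) 0 0 = ?D n (\<lambda>i. c (Suc i))"
    by (rule eq_matI) (auto simp: mat_delete_def)
  have deln: "det (mat_delete (?D (Suc n) c) 0 (Suc n)) = (-1) ^ Suc n"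
  proof -
    let ?M = "mat_delete (?D (Suc n) c) 0 (Suc n)"
    have M: "?M \<in> carrier_mat (Suc n) (Suc n)" by (auto simp: mat_delete_def)
    have "upper_triangular ?M" by (auto simp: mat_delete_def)
    then have "det ?M = prod_list (diag_mat ?M)" using M by (rule det_upper_triangular)
    also have "\<dots> = (\<Prod>i = 0..<Suc n. ?M $$ (i,i))" using M by (simp add: prod_list_diag_prod mat_delete_def)
    also have "\<dots> = (\<Prod>i = 0..<Suc n. -1)" by (rule prod.cong) (auto simp: mat_delete_def)
    finally show ?thesis by simp
  qed
  have "det (?D (Suc n) c) = (\<Sum>j<?N. ?D (Suc n) c $$ (0,j) * cofactor (?D (Suc n) c) 0 j)"
    by (rule laplace_expansion_row[OF D]) simp
  also have "\<dots> = (\<Sum>j\<in>{0, Suc n}. ?D (Suc n) c $$ (0,j) * cofactor (?D (Suc n) c) 0 j)"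
    by (rule sum.mono_neutral_right) auto
  also have "\<dots> = [:0,1:] * det (?D n (\<lambda>i. c (Suc i))) + [:c 0:] * ((-1) ^ Suc n * (-1) ^ Suc n)"
    by (simp add: cofactor_def del0 deln)
  also have "(-1::'a poly) ^ Suc n * (-1) ^ Suc n = 1" by (simp flip: power_mult_distrib)
  also have "det (?D n (\<lambda>i. c (Suc i))) = monom 1 (Suc n) + (\<Sum>i<Suc n. monom (c (Suc i)) i)"
    by (rule Suc.IH)
  also have "[:0,1:] * \<dots> + [:c 0:] * 1 = monom 1 ?N + (\<Sum>i<?N. monom (c i) i)"
    by (subst (2) sum.lessThan_Suc_shift) (simp add: distrib_left sum_distrib_left monom_Suc monom_0)
  finally show ?case .
qed

lemma char_poly_companion:
  fixes q :: "'a::field poly"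
  assumes "monic q" "degree q > 0"
  shows "char_poly (companion q) = q"
proof -
  obtain n where n: "degree q = Suc n" using assms(2) gr0_implies_Suc by blast
  have "char_poly_matrix (companion q) = mat (Suc n) (Suc n) (\<lambda>(i,j). (if i = j then [:0,1:] else 0)
      + (if j = n then [:coeff q i:] else if i = Suc j then - 1 else 0))"
    by (rule eq_matI) (auto simp: char_poly_matrix_def companion_def n one_pCons)
  then have "char_poly (companion q) = monom 1 (Suc n) + (\<Sum>i<Suc n. monom (coeff q i) i)"
    unfolding char_poly_def by (simp only: det_companion_pattern)
  also have "\<dots> = (\<Sum>i\<le>degree q. monom (coeff q i) i)"
    using assms(1) n by (simp add: lessThan_Suc_atMost[symmetric])
  also have "\<dots> = q" by (rule poly_as_sum_of_monoms)
  finally show ?thesis .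
qed

text \<open>The irreducible r of \<open>frobenius_block\<close> may fail to be monic. Normalizing it
  costs a factor a^k, which equals 1 because q is monic.\<close>

lemma prime_power_of_monic_power:
  fixes q :: "'a::field poly"
  assumes "monic q" "degree q > 0" "irreducible r" "q = r ^ k"
  shows "prime_power q"
proof -
  have k: "k > 0" using assms(2,4) by (cases k) auto
  obtain p where p: "irreducible p" "monic p" "p dvd r"
    using irreducible_factor_exists irreducible_degree_pos assms(3) by blast
  then obtain u where u: "r = p * u" by (elim dvdE)
  have "is_unit u" using irreducibleD[OF assms(3) u] irreducible_not_unit[OF p(1)] by blast
  then obtain a where a: "u = [:a:]" "a \<noteq> 0" unfolding is_unit_poly_iff by (metis dvd_0_left_iff zero_neq_one)
  have qa: "q = Polynomial.smult (a ^ k) (p ^ k)" using assms(4) u a by (simp add: smult_power power_mult_distrib)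
  then have "lead_coeff q = a ^ k" using monic_power[OF p(2), of k] by (metis lead_coeff_smult mult_1_right)
  then have "a ^ k = 1" using assms(1) by simp
  then have "q = p ^ k" using qa by simp
  with p k show ?thesis unfolding prime_power_def by blast
qed

text \<open>A Frobenius block is recovered from its characteristic polynomial, so from here on
  blocks and prime powers are interchangeable.\<close>

lemma frobenius_block_iff:
  "frobenius_block Phi \<longleftrightarrow> prime_power (char_poly Phi) \<and> Phi = companion (char_poly Phi)"
proof
  assume "frobenius_block Phi"
  then obtain q r k where q: "monic q" "degree q > 0" "Phi = companion q" "irreducible r" "char_poly Phi = r ^ k"
    unfolding frobenius_block_def by auto
  then have "char_poly Phi = q" using char_poly_companion by blast
  with q prime_power_of_monic_power[OF q(1,2,4)] show "prime_power (char_poly Phi) \<and> Phi = companion (char_poly Phi)"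
    by auto
next
  assume *: "prime_power (char_poly Phi) \<and> Phi = companion (char_poly Phi)"
  then have "\<exists>r k. irreducible r \<and> char_poly Phi = r ^ k" unfolding prime_power_def by auto
  moreover have "monic (char_poly Phi)" "degree (char_poly Phi) > 0" using * prime_powerD by auto
  ultimately show "frobenius_block Phi" using * unfolding frobenius_block_def
    by (metis One_nat_def Suc_leI)
qed

lemma p_of_eq: "p_of Phi = prime_base (char_poly Phi)"
  by (simp add: p_of_def prime_base_def)


section \<open>Hensel lifting of Hermitian congruences\<close>

text \<open>Newton's method. If T^o f T = g + p^a E with E Hermitian, passing to T + p^a Y adds p^a
  (Q + Q^o) with Q = T^o f Y, and a quadratic term with factor p^(2a). It remains to choose Y such
  that Q is -E/2 modulo p. Two index sets are kept because the two Hermitian forms are labelled by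
  positions in different lists.\<close>

lemma (in involution) hermitian_hensel:
  fixes f :: "'l \<Rightarrow> 'a poly" and g :: "'i \<Rightarrow> 'a poly"
  assumes two: "(2::'a) \<noteq> 0" and p: "irreducible p" "bar p = p" and fin: "finite I" "finite I'"
    and f: "\<And>l. l \<in> I \<Longrightarrow> bar (f l) = f l" and g: "\<And>i. i \<in> I' \<Longrightarrow> bar (g i) = g i"
    and gu: "\<And>i. i \<in> I' \<Longrightarrow> \<not> p dvd g i"
    and init: "\<And>i j. i \<in> I' \<Longrightarrow> j \<in> I' \<Longrightarrow> p dvd (\<Sum>l\<in>I. bar (S l i) * f l * S l j) - (if i = j then g i else 0)"
  shows "\<exists>S'. (\<forall>l i. p dvd S' l i - S l i)
    \<and> (\<forall>i\<in>I'. \<forall>j\<in>I'. p ^ a dvd (\<Sum>l\<in>I. bar (S' l i) * f l * S' l j) - (if i = j then g i else 0))"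
proof (induction a)
  case 0
  show ?case by (intro exI[of _ S]) auto
next
  case (Suc a)
  let ?d = "\<lambda>i j. if i = j then g i else 0"
  have p0: "p \<noteq> 0" using p by auto
  show ?case
  \<comment> \<open>At a = 0 the increment p^a Y would not be divisible by p; the passage from p^0
    to p^1 is the hypothesis \<open>init\<close> itself.\<close>
  proof (cases "a = 0")
    case True
    then show ?thesis using init by (intro exI[of _ S]) auto
  next
    case False
    from Suc obtain T where T: "\<And>l i. p dvd T l i - S l i"
      and TP: "\<And>i j. i \<in> I' \<Longrightarrow> j \<in> I' \<Longrightarrow> p ^ a dvd (\<Sum>l\<in>I. bar (T l i) * f l * T l j) - ?d i j" by blast
    define P where "P i j = (\<Sum>l\<in>I. bar (T l i) * f l * T l j)" for i j
    define E where "E i j = (P i j - ?d i j) div p ^ a" for i j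
    have E: "P i j = ?d i j + p ^ a * E i j" if "i \<in> I'" "j \<in> I'" for i j
      using TP[OF that] by (simp add: E_def P_def)
    have barP: "bar (P i j) = P j i" for i j
      unfolding P_def bar_sum by (rule sum.cong) (auto simp: bar_mult f ac_simps)
    have barE: "bar (E i j) = E j i" if "i \<in> I'" "j \<in> I'" for i j
    proof -
      have "p ^ a * bar (E i j) = bar (P i j - ?d i j)" using that E by (simp add: bar_mult bar_power p)
      also have "\<dots> = p ^ a * E j i" using that E[of j i] g by (auto simp: bar_diff barP)
      finally show ?thesis using p0 by simp
    qed
    have "\<forall>i\<in>I'. \<exists>v. p dvd v * g i - 1" using irreducible_bezout[OF p(1)] gu by blast
    from bchoice[OF this] obtain v where v: "\<And>i. i \<in> I' \<Longrightarrow> p dvd v i * g i - 1" by blast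
    define hf where "hf = [:1/2::'a:]"
    have cj2: "cj 2 = 2" using cj_add[of 1 1] by simp
    have "cj (1/2) * 2 = 1" using cj_mult[of "1/2" 2] two by (simp add: cj2)
    then have "cj (1/2) = 1/2" using two by (simp add: field_simps)
    then have barhf: "bar hf = hf" by (simp add: hf_def bar_const)
    have hf2: "hf + hf = 1" using two by (simp add: hf_def one_pCons field_simps)
    \<comment> \<open>Y is -T g^(-1) E / 2 with v as the inverse of g modulo p. The factor one half
      is there because Q and its conjugate transpose each cancel one half of E.\<close>
    define Y where "Y l j = - (\<Sum>m\<in>I'. T l m * (hf * v m * E m j))" for l j
    define Q where "Q i j = (\<Sum>l\<in>I. bar (T l i) * f l * Y l j)" for i j
    define Z where "Z i j = (\<Sum>l\<in>I. bar (Y l i) * f l * Y l j)" for i j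
    have Qeq: "Q i j = - (\<Sum>m\<in>I'. P i m * (hf * v m * E m j))" for i j
    proof -
      have "Q i j = - (\<Sum>l\<in>I. \<Sum>m\<in>I'. bar (T l i) * f l * T l m * (hf * v m * E m j))"
        unfolding Q_def Y_def by (simp add: sum_distrib_left sum_negf mult.assoc)
      also have "\<dots> = - (\<Sum>m\<in>I'. P i m * (hf * v m * E m j))"
        unfolding P_def sum_distrib_right by (subst sum.swap) simp
      finally show ?thesis .
    qed
    have Qmod: "p dvd Q i j + hf * E i j" if ij: "i \<in> I'" "j \<in> I'" for i j
    proof -
      have "Q i j + hf * E i j = (\<Sum>m\<in>I'. if m = i then hf * E i j else 0) - (\<Sum>m\<in>I'. P i m * (hf * v m * E m j))"
        using ij fin by (simp add: Qeq)
      also have "\<dots> = (\<Sum>m\<in>I'. (if m = i then hf * E i j else 0) - P i m * (hf * v m * E m j))"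
        by (simp add: sum_subtractf)
      also have "p dvd \<dots>"
      proof (rule dvd_sum)
        fix m assume m: "m \<in> I'"
        have pa: "p dvd p ^ a" using False by (simp add: dvd_power)
        show "p dvd (if m = i then hf * E i j else 0) - P i m * (hf * v m * E m j)"
        proof (cases "m = i")
          case True
          have "hf * E i j - P i i * (hf * v i * E i j)
              = - (v i * g i - 1) * (hf * E i j) - p ^ a * (E i i * (hf * v i * E i j))"
            using E[OF ij(1) ij(1)] by (simp add: algebra_simps)
          also have "p dvd \<dots>" using v[OF ij(1)] pa by (intro dvd_diff dvd_mult2) (auto simp only: dvd_minus_iff)
          finally show ?thesis using True by simp
        next
          case m2: False
          have "P i m = p ^ a * E i m" using E[OF ij(1) m] m2 by simp
          then show ?thesis using m2 pa by (simp add: dvd_mult2)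
        qed
      qed
      finally show ?thesis .
    qed
    have barQ: "bar (Q j i) = (\<Sum>l\<in>I. bar (Y l i) * f l * T l j)" for i j
      unfolding Q_def bar_sum by (rule sum.cong) (auto simp: bar_mult f ac_simps)
    define S' where "S' l i = T l i + p ^ a * Y l i" for l i
    have "p dvd S' l i - S l i" for l i
    proof -
      have "p dvd p ^ a * Y l i" using False by (intro dvd_mult2) (simp add: dvd_power)
      with T[of l i] have "p dvd (T l i - S l i) + p ^ a * Y l i" by (rule dvd_add)
      then show ?thesis by (simp add: S'_def algebra_simps)
    qed
    moreover have "p ^ Suc a dvd (\<Sum>l\<in>I. bar (S' l i) * f l * S' l j) - ?d i j"
      if ij: "i \<in> I'" "j \<in> I'" for i j
    proof -
      have "(\<Sum>l\<in>I. bar (S' l i) * f l * S' l j)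
          = P i j + p ^ a * (Q i j + bar (Q j i)) + p ^ a * (p ^ a * Z i j)"
        unfolding barQ unfolding P_def Q_def Z_def sum_distrib_left sum.distrib[symmetric]
        by (rule sum.cong) (auto simp: S'_def bar_add bar_mult bar_power p algebra_simps)
      also have "\<dots> - ?d i j = p ^ a * (E i j + Q i j + bar (Q j i)) + p ^ a * (p ^ a * Z i j)"
        unfolding E[OF ij] by (simp add: algebra_simps)
      finally have eq: "(\<Sum>l\<in>I. bar (S' l i) * f l * S' l j) - ?d i j
        = p ^ a * (E i j + Q i j + bar (Q j i)) + p ^ a * (p ^ a * Z i j)" .
      have "bar p dvd bar (Q j i + hf * E j i)" unfolding bar_dvd_bar by (rule Qmod[OF ij(2,1)])
      then have "p dvd bar (Q j i) + hf * E i j" using ij by (simp add: p bar_add bar_mult barhf barE)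
      with Qmod[OF ij] have "p dvd (Q i j + hf * E i j) + (bar (Q j i) + hf * E i j)" by (rule dvd_add)
      also have "\<dots> = (hf + hf) * E i j + Q i j + bar (Q j i)" by (simp add: algebra_simps)
      finally have "p dvd E i j + Q i j + bar (Q j i)" by (simp add: hf2)
      then have 1: "p ^ Suc a dvd p ^ a * (E i j + Q i j + bar (Q j i))"
        by (simp add: mult.commute[of p] mult_dvd_mono)
      have "p dvd p ^ a" using False by (simp add: dvd_power)
      then have "p ^ Suc a dvd p ^ a * (p ^ a * Z i j)"
        by (simp add: mult.commute[of p] mult_dvd_mono dvd_mult2)
      with 1 show ?thesis unfolding eq by (rule dvd_add)
    qed
    ultimately show ?thesis by blast
  qed
qed

text \<open>The one-dimensional case, started from S = 1: selfconjugate units that agree modulo p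
  differ modulo p^a by a norm \<open>bar t * t\<close>.\<close>

lemma (in involution) hermitian_scaling:
  assumes two: "(2::'a) \<noteq> 0" and p: "irreducible p" "bar p = p"
    and J: "bar J = J" and G: "bar G = G" "\<not> p dvd G" and JG: "p dvd J - G"
  shows "\<exists>t. p ^ a dvd bar t * J * t - G"
  using hermitian_hensel[where I = "{()}" and I' = "{()}" and f = "\<lambda>_. J" and g = "\<lambda>_. G" and S = "\<lambda>_ _. 1" and a = a, OF two p]
    J G JG by auto

section \<open>Splitting off an indecomposable summand\<close>

context herm_module
begin

text \<open>Vanishing on the diagonal gives H + cj H = 0 for H = h u (act m w). If the involution is
  the identity, this reads 2 H = 0. Otherwise, replacing w by a w with \<open>cj a\<close> different
  from a yields a second relation that is independent of the first.\<close>

lemma polarization: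
  assumes W: "submodule W" and e1: "eps = 1" and m: "bar m = m"
    and van: "\<And>v. v \<in> W \<Longrightarrow> h v (act m v) = 0"
    and uw: "u \<in> W" "w \<in> W"
  shows "h u (act m w) = 0"
proof -
  have S: "h u (act m w) + cj (h u (act m w)) = 0" if "u \<in> W" "w \<in> W" for u w
  proof -
    have "h (u + w) (act m (u + w)) = 0" using van[of "u + w"] W that unfolding submodule_def by blast
    then have "h u (act m w) + h w (act m u) = 0"
      using van[OF that(1)] van[OF that(2)] by (simp add: act_add h_add h_add_left add.commute)
    moreover have "h w (act m u) = cj (h u (act m w))" using h_sym_act[of w m u] e1 m by simp
    ultimately show ?thesis by simp
  qed
  show ?thesis
  proof (cases "cj = id")
    case True
    then show ?thesis using S[OF uw] two by (simp add: mult_2[symmetric])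
  next
    case False
    then obtain a where a: "cj a \<noteq> a" by (auto simp: fun_eq_iff)
    let ?H = "h u (act m w)"
    have "act [:a:] w \<in> W" using W uw(2) by (rule submodule_act)
    from S[OF uw(1) this] have "a * ?H + cj a * cj ?H = 0"
      by (simp add: act_comm[of m] h_const cj_mult)
    moreover have "cj ?H = - ?H" using S[OF uw] by (simp add: eq_neg_iff_add_eq_0 add.commute)
    ultimately have "(a - cj a) * ?H = 0" by (simp add: algebra_simps)
    then show ?thesis using a by simp
  qed
qed

lemma annihilator_bar:
  assumes W: "submodule W" "nondegenerate W" and m: "\<And>w. w \<in> W \<Longrightarrow> act m w = 0" and w: "w \<in> W"
  shows "act (bar m) w = 0"
proof -
  have "h u (act (bar m) w) = 0" if "u \<in> W" for u
    using m[OF that] by (simp add: h_adj[symmetric])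
  then show ?thesis using W submodule_act[OF W(1) w] unfolding nondegenerate_def by blast
qed

text \<open>By nondegeneracy the conjugate of an annihilator annihilates W too. Were the minimal
  monic one not selfconjugate, its difference from its conjugate would be an annihilator of smaller
  degree.\<close>

lemma monic_minimal_annihilator:
  assumes W: "submodule W" "nondegenerate W" and m: "m \<noteq> 0" "\<And>w. w \<in> W \<Longrightarrow> act m w = 0"
  shows "\<exists>m'. monic m' \<and> bar m' = m' \<and> (\<forall>w\<in>W. act m' w = 0)
    \<and> (\<forall>g. g \<noteq> 0 \<longrightarrow> (\<forall>w\<in>W. act g w = 0) \<longrightarrow> degree m' \<le> degree g)"
proof -
  define I where "I = {g. g \<noteq> 0 \<and> (\<forall>w\<in>W. act g w = 0)}"
  have "m \<in> I" using m by (auto simp: I_def)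
  then obtain d where d: "d \<in> I" and min: "\<And>g. g \<in> I \<Longrightarrow> degree d \<le> degree g"
    by (metis ex_has_least_nat[of "\<lambda>g. g \<in> I" m degree])
  define m' where "m' = [:inverse (lead_coeff d):] * d"
  have d0: "d \<noteq> 0" using d I_def by auto
  have 1: "monic m'" and deg: "degree m' = degree d" using d0 by (auto simp: m'_def)
  have 3: "act m' w = 0" if "w \<in> W" for w using d that unfolding m'_def act_mult by (simp add: I_def)
  have 4: "degree m' \<le> degree g" if "g \<noteq> 0" "\<And>w. w \<in> W \<Longrightarrow> act g w = 0" for g
    using min[of g] that deg by (auto simp: I_def)
  have "bar m' = m'"
  proof (rule ccontr)
    assume ne: "bar m' \<noteq> m'"
    have z: "act (bar m' - m') w = 0" if "w \<in> W" for w
      using annihilator_bar[OF W 3 that] 3[OF that] by (simp add: diff_act)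
    have "degree m' > 0"
    proof (rule ccontr)
      assume "\<not> degree m' > 0"
      then have "m' = 1" using 1 by (metis monic_degree_0 neq0_conv)
      with ne show False by simp
    qed
    moreover have "degree m' \<le> degree (bar m' - m')" by (rule 4) (use ne z in auto)
    moreover have "degree (bar m' - m') < degree m'"
    proof (rule degree_less_if_less_eqI)
      show "degree (bar m' - m') \<le> degree m'" using degree_diff_le[of "bar m'" "degree m'" m'] by simp
      show "coeff (bar m' - m') (degree m') = 0" using 1 by (simp add: coeff_bar)
      show "bar m' - m' \<noteq> 0" using ne by simp
    qed
    ultimately show False by simp
  qed
  with 1 3 4 show ?thesis by blast
qed

lemma split_off:
  assumes W: "submodule W" "nondegenerate W" and w0: "w0 \<in> W" "w0 \<noteq> 0"
    and m0: "m0 \<noteq> 0" "\<And>w. w \<in> W \<Longrightarrow> act m0 w = 0"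
  shows "(\<exists>p k d e. irreducible p \<and> monic p \<and> 0 < k \<and> d \<in> W \<and> e \<in> W \<and> (eps = 1 \<longrightarrow> bar p \<noteq> p)
      \<and> act (p ^ k) d = 0 \<and> act (bar (p ^ k)) e = 0
      \<and> (\<forall>g. h e (act g d) = top_coeff (p ^ k) g \<and> h d (act g d) = 0 \<and> h e (act g e) = 0))
    \<or> (\<exists>p k d J. irreducible p \<and> monic p \<and> 0 < k \<and> d \<in> W \<and> eps = 1 \<and> bar p = p
      \<and> act (p ^ k) d = 0 \<and> bar J = J \<and> \<not> p dvd J \<and> (\<forall>g. h d (act g d) = top_coeff (p ^ k) (J * g)))"
    (is "?A \<or> ?B")
proof -
  obtain m where m: "monic m" "bar m = m" "\<And>w. w \<in> W \<Longrightarrow> act m w = 0"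
    "\<And>g. g \<noteq> 0 \<Longrightarrow> (\<And>w. w \<in> W \<Longrightarrow> act g w = 0) \<Longrightarrow> degree m \<le> degree g"
    using monic_minimal_annihilator[OF W m0] by blast
  have "degree m > 0"
  proof (rule ccontr)
    assume "\<not> degree m > 0"
    then have "m = 1" using m(1) by (metis monic_degree_0 neq0_conv)
    with m(3)[OF w0(1)] w0(2) show False by simp
  qed
  then obtain p where p: "irreducible p" "monic p" "p dvd m" using irreducible_factor_exists by blast
  have m00: "m \<noteq> 0" using m(1) by auto
  obtain k c where kc: "m = p ^ k * c" "\<not> p dvd c" "0 < k" using split_power[OF p(1) m00 p(3)] by blast
  define q where "q = p ^ k"
  \<comment> \<open>This is m / p; by minimality of m it does not annihilate W.\<close>
  define m1 where "m1 = p ^ (k - 1) * c"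
  have q: "q = p * p ^ (k - 1)" using kc(3) by (simp add: q_def power_eq_if)
  have mm1: "m = p * m1" unfolding m1_def kc(1) using q q_def by simp
  have m10: "m1 \<noteq> 0" using m00 mm1 by auto
  have "degree m1 < degree m" using m00 m10 irreducible_degree_pos[OF p(1)] mm1 by (auto simp: degree_mult_eq)
  then obtain v1 where v1: "v1 \<in> W" "act m1 v1 \<noteq> 0" using m(4)[OF m10] by fastforce
  obtain y where y: "q dvd y * c - 1" using unit_mod_power[OF p(1) kc(2)] q_def by blast
  have degq: "degree q > 0" using prime_powerD(2) p kc(3) unfolding prime_power_def q_def by blast
  have qc: "act q (act c v) = 0" if "v \<in> W" for v
    using m(3)[OF that] by (simp add: kc(1) q_def act_mult)
  \<comment> \<open>If p divided J, multiples of p^(k-1) would pair to zero. With y as the inverse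
    of c modulo p^k, the multiple y p^(k-1) undoes one of the two factors c and turns the pairing
    into h w (act m1 v), which is nonzero by choice.\<close>
  have key: "\<not> p dvd J" if v: "v \<in> W" and ne: "h w (act m1 v) \<noteq> 0"
    and J: "\<And>g. h (act (bar c) w) (act g (act c v)) = top_coeff q (J * g)" for v w J
  proof
    assume "p dvd J"
    then have "q dvd J * (y * p ^ (k - 1))" unfolding q by (auto intro: mult_dvd_mono dvd_mult)
    then have "h (act (bar c) w) (act (y * p ^ (k - 1)) (act c v)) = 0"
      using J top_coeff_dvd by metis
    then have "h w (act (c * (y * p ^ (k - 1)) * c) v) = 0" by (simp add: h_adj act_mult)
    moreover have "act (c * (y * p ^ (k - 1)) * c) v = act m1 v"
    proof (rule act_cong)
      have "c * (y * p ^ (k - 1)) * c - m1 = (y * c - 1) * m1" by (simp add: m1_def algebra_simps)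
      moreover have "m dvd q * m1" unfolding m1_def kc(1) q_def by (simp add: mult.left_commute)
      ultimately show "m dvd c * (y * p ^ (k - 1)) * c - m1"
        using y by (metis dvd_trans mult_dvd_mono dvd_refl)
    qed (rule m(3)[OF v])
    ultimately show False using ne by simp
  qed
  show ?thesis
  proof (cases "eps = 1 \<and> bar p = p")
    case True
    have barc: "bar c = c"
    proof -
      have "p ^ k * bar c = p ^ k * c" using m(2) unfolding kc(1) by (simp add: bar_mult bar_power True)
      then show ?thesis using p(1) by auto
    qed
    have barm1: "bar m1 = m1" by (simp add: m1_def bar_mult bar_power True barc)
    obtain v where v: "v \<in> W" "h v (act m1 v) \<noteq> 0"
    proof -
      have "\<not> (\<forall>v\<in>W. h v (act m1 v) = 0)"
      proof
        assume "\<forall>v\<in>W. h v (act m1 v) = 0"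
        then have "h u (act m1 v1) = 0" if "u \<in> W" for u
          using polarization[OF W(1) _ barm1 _ that v1(1)] True by blast
        then have "act m1 v1 = 0" using W submodule_act[OF W(1) v1(1)] unfolding nondegenerate_def by blast
        with v1 show False by simp
      qed
      then show ?thesis using that by blast
    qed
    define d where "d = act c v"
    have qd: "act q d = 0" using qc[OF v(1)] d_def by simp
    obtain J where J: "degree J < degree q" "\<And>g. h d (act g d) = top_coeff q (J * g)"
      using h_represent[OF degq qd] by blast
    have barq: "bar q = q" by (simp add: q_def bar_power True)
    have "q dvd J - bar J"
    proof (rule top_coeff_nondegenerate[OF degq])
      fix g
      have "top_coeff q (J * g) = cj (h d (act (bar g) d))" using h_sym_act[of d g d] True J(2) by simp
      also have "\<dots> = top_coeff q (bar (J * bar g))" using top_coeff_bar[of q "J * bar g"] barq J(2) by simp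
      finally show "top_coeff q ((J - bar J) * g) = 0" by (simp add: left_diff_distrib top_coeff_diff bar_mult)
    qed
    moreover have "degree (J - bar J) \<le> degree J" by (rule degree_diff_le) auto
    \<comment> \<open>The bound on the degree of J turns the congruence modulo q into an
      equality.\<close>
    ultimately have "bar J = J" using J(1) dvd_imp_degree_le[of q "J - bar J"] by fastforce
    moreover have "\<not> p dvd J" using key[OF v, of J] J(2) barc d_def by simp
    moreover have "d \<in> W" using submodule_act[OF W(1) v(1)] d_def by simp
    ultimately have ?B using p kc(3) True qd J(2) q_def by blast
    then show ?thesis ..
  next
    case False
    obtain w where w: "w \<in> W" "h w (act m1 v1) \<noteq> 0"
      using v1 W submodule_act[OF W(1) v1(1)] unfolding nondegenerate_def by blast
    define d where "d = act c v1"
    define e0 where "e0 = act (bar c) w"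
    have qd: "act q d = 0" using qc[OF v1(1)] d_def by simp
    have "act (bar q) e0 = act m w"
      using m(2) by (simp add: e0_def act_mult[symmetric] q_def kc(1) bar_mult[symmetric])
    then have qe0: "act (bar q) e0 = 0" using m(3)[OF w(1)] by simp
    obtain J where J: "degree J < degree q" "\<And>g. h e0 (act g d) = top_coeff q (J * g)"
      using h_represent[OF degq qd] by blast
    have "\<not> p dvd J" using key[OF v1(1) w(2), of J] J(2) d_def e0_def by simp
    then obtain a where a: "q dvd a * J - 1" using unit_mod_power[OF p(1)] q_def by blast
    \<comment> \<open>Absorbing the inverse of J into the second generator normalizes the pairing to
      \<open>top_coeff\<close> itself. This is why a type (i) summand carries no polynomial besides
      its block.\<close>
    define e where "e = act (bar a) e0"
    have dW: "d \<in> W" "e \<in> W" using v1 w W(1) by (auto simp: d_def e_def e0_def intro: submodule_act)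
    have qe: "act (bar q) e = 0" by (simp add: e_def act_comm[of "bar q"] qe0)
    have ed: "h e (act g d) = top_coeff q g" for g
    proof -
      have "h e (act g d) = top_coeff q (J * (a * g))" by (simp add: e_def h_adj act_mult[symmetric] J(2))
      also have "\<dots> = top_coeff q g"
      proof (rule top_coeff_cong)
        have "J * (a * g) - g = (a * J - 1) * g" by (simp add: algebra_simps)
        then show "q dvd J * (a * g) - g" using a by (simp add: dvd_mult2)
      qed
      finally show ?thesis .
    qed
    \<comment> \<open>Isotropy has two different reasons. For \<open>eps = -1\<close> the involution
      is the identity and h z (act g z) equals its own negative. For \<open>eps = 1\<close> the
      polynomials q and \<open>bar q\<close> are coprime: the one that does not kill z acts
      invertibly on z, and its adjoint is the one that does.\<close>
    have iso: "h z (act g z) = 0" if z: "act q z = 0 \<or> act (bar q) z = 0" for g z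
    proof (cases "eps = 1")
      case False
      then have em: "eps = -1" "cj = id" using eps eps_inv by auto
      then have "bar g = g" by (simp add: pbar_def)
      then have "h z (act g z) = - h z (act g z)" using h_sym_act[of z g z] em by simp
      then have "2 * h z (act g z) = 0" by (simp add: eq_neg_iff_add_eq_0)
      then show ?thesis using two by simp
    next
      case True
      then have np: "bar p \<noteq> p" using False by simp
      then have "\<not> p dvd bar q"
        using irreducible_dvd_power_eq[OF bar_irreducible[OF p(1)] p(1) bar_monic[OF p(2)] p(2)]
        by (auto simp: q_def bar_power)
      then obtain b where b: "q dvd b * bar q - 1" using unit_mod_power[OF p(1)] q_def by blast
      then have "bar q dvd bar (b * bar q - 1)" unfolding bar_dvd_bar .
      then have b': "bar q dvd bar b * q - 1" by (simp add: bar_mult bar_diff)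
      from z show ?thesis
      proof
        assume z: "act q z = 0"
        have "act g z = act (g * (b * bar q)) z"
          using b z by (intro act_cong[of q]) (auto simp: algebra_simps dest: dvd_mult[of q _ "- g"])
        then have "h z (act g z) = h z (act (bar q) (act (g * b) z))" by (simp add: act_mult[symmetric] ac_simps)
        then show ?thesis using z by (simp add: h_adj')
      next
        assume z: "act (bar q) z = 0"
        have "act g z = act (g * (bar b * q)) z"
          using b' z by (intro act_cong[of "bar q"]) (auto simp: algebra_simps dest: dvd_mult[of "bar q" _ "- g"])
        then have "h z (act g z) = h z (act q (act (g * bar b) z))" by (simp add: act_mult[symmetric] ac_simps)
        then show ?thesis using z by (simp add: h_adj')
      qed
    qed
    have "?A"
      using p kc(3) dW False qd qe ed iso[of d] iso[of e] q_def by metis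
    then show ?thesis ..
  qed
qed

text \<open>f is the remainder of J / mu modulo p; it is selfconjugate because J and the inverse of
  mu modulo p are. Then J and mu f agree modulo p, \<open>hermitian_scaling\<close> supplies t, and
  replacing d by t d multiplies the form by \<open>bar t * t\<close>.\<close>

lemma normalize_cyclic:
  assumes W: "submodule W" and p: "irreducible p" "monic p" "bar p = p" and k: "0 < k"
    and d: "d \<in> W" "act (p ^ k) d = 0" and J: "bar J = J" "\<not> p dvd J"
    and dd: "\<And>g. h d (act g d) = top_coeff (p ^ k) (J * g)"
    and mu: "bar mu = mu" "\<not> p dvd mu"
  shows "\<exists>f d'. f \<noteq> 0 \<and> bar f = f \<and> degree f < degree p \<and> d' \<in> W \<and> act (p ^ k) d' = 0
    \<and> (\<forall>g. h d' (act g d') = top_coeff (p ^ k) (mu * f * g))"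
proof -
  have p0: "p \<noteq> 0" using p by auto
  obtain a where a: "p dvd a * mu - 1" using irreducible_bezout[OF p(1) mu(2)] by blast
  define f where "f = (J * a) mod p"
  have "p dvd a - bar a"
  proof (rule dvd_mult_unit_mod[OF a])
    have "bar p dvd bar (a * mu - 1)" using a unfolding bar_dvd_bar .
    then have "p dvd bar a * mu - 1" by (simp add: p bar_mult bar_diff mu)
    from dvd_diff[OF a this] show "p dvd mu * (a - bar a)" by (simp add: algebra_simps)
  qed
  then have "J * a mod p = J * bar a mod p"
    using poly_mod_diff_left[of "J * a" "J * bar a" p]
    by (metis dvd_imp_mod_0 dvd_mult eq_iff_diff_eq_0 right_diff_distrib)
  then have barf: "bar f = f" by (simp add: f_def bar_mod bar_mult p J)
  have fJ: "p dvd f - J * a" unfolding f_def by (metis dvd_minus_iff dvd_triv_left minus_diff_eq minus_mod_eq_mult_div)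
  have muf: "p dvd J - mu * f"
  proof -
    have "J - mu * f = - (mu * (f - J * a)) - J * (a * mu - 1)" by (simp add: algebra_simps)
    also have "p dvd \<dots>" using fJ a by (intro dvd_diff) (auto simp only: dvd_minus_iff dvd_mult)
    finally show ?thesis .
  qed
  have nmuf: "\<not> p dvd mu * f"
  proof
    assume "p dvd mu * f"
    with muf have "p dvd J" using dvd_add[of p "J - mu * f" "mu * f"] by simp
    with J show False by simp
  qed
  have f0: "f \<noteq> 0" using nmuf by auto
  have degf: "degree f < degree p" using f0 degree_mod_less[OF p0, of "J * a"] by (auto simp: f_def)
  have "bar (mu * f) = mu * f" by (simp add: bar_mult mu barf)
  from hermitian_scaling[OF two p(1,3) J(1) this nmuf muf] obtain t where
    t: "p ^ k dvd bar t * J * t - mu * f" by blast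
  define d' where "d' = act t d"
  have "h d' (act g d') = top_coeff (p ^ k) (mu * f * g)" for g
  proof -
    have "h d' (act g d') = top_coeff (p ^ k) (J * (bar t * (g * t)))"
      by (simp add: d'_def h_adj act_mult[symmetric] dd)
    also have "\<dots> = top_coeff (p ^ k) (mu * f * g)"
    proof (rule top_coeff_cong)
      have "J * (bar t * (g * t)) - mu * f * g = (bar t * J * t - mu * f) * g" by (simp add: algebra_simps)
      then show "p ^ k dvd J * (bar t * (g * t)) - mu * f * g" using t by (simp add: dvd_mult2)
    qed
    finally show ?thesis .
  qed
  moreover have "d' \<in> W" "act (p ^ k) d' = 0"
    using d submodule_act[OF W] by (auto simp: d'_def act_comm[of "p ^ k"])
  ultimately show ?thesis using f0 barf degf by blast
qed

end


section \<open>Frames of canonical form\<close>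

text \<open>A summand of type (i) has two cyclic generators (False for the block, True for its adjoint),
  exchanged by the pairing; a summand of type (ii) has one, paired with itself.
  The parameter mu records the form of the fixed matrix \<open>phi1 Phi\<close>, see \<open>phi1_form\<close>.\<close>

fun sgens :: "'a::zero summand \<Rightarrow> bool set" where
  "sgens (TypeI Phi) = UNIV" | "sgens (TypeII Phi f) = {False}"

fun stwin :: "'a::zero summand \<Rightarrow> bool \<Rightarrow> bool" where
  "stwin (TypeI Phi) t = (\<not> t)" | "stwin (TypeII Phi f) t = t"

fun sann :: "('a::field \<Rightarrow> 'a) \<Rightarrow> 'a summand \<Rightarrow> bool \<Rightarrow> 'a poly" where
  "sann cj (TypeI Phi) t = (if t then pbar cj (char_poly Phi) else char_poly Phi)"
| "sann cj (TypeII Phi f) t = char_poly Phi"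

text \<open>In type (i) the pairing of the second generator with multiples of the first is
  normalized to 1; exchanging the two arguments brings in the sign eps.\<close>

fun sform :: "'a::field \<Rightarrow> ('a mat \<Rightarrow> 'a poly) \<Rightarrow> 'a summand \<Rightarrow> bool \<Rightarrow> 'a poly" where
  "sform eps mu (TypeI Phi) t = (if t then [:eps:] else 1)"
| "sform eps mu (TypeII Phi f) t = mu Phi * f"

text \<open>\<open>valid_summand\<close> with existence of Phi_1 replaced by selfconjugacy of the
  characteristic polynomial, which makes sense in an abstract module. The two agree by
  \<open>valid_summand_iff\<close>.\<close>

fun good_summand :: "('a::field \<Rightarrow> 'a) \<Rightarrow> 'a \<Rightarrow> 'a summand \<Rightarrow> bool" where
  "good_summand cj eps (TypeI Phi) \<longleftrightarrow> frobenius_block Phi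
     \<and> (eps = 1 \<longrightarrow> pbar cj (char_poly Phi) \<noteq> char_poly Phi)"
| "good_summand cj eps (TypeII Phi f) \<longleftrightarrow> eps = 1 \<and> frobenius_block Phi
     \<and> pbar cj (char_poly Phi) = char_poly Phi \<and> f \<noteq> 0 \<and> pbar cj f = f \<and> degree f < degree (p_of Phi)"

text \<open>All that the module arguments ask of the polynomials mu standing for the chosen matrices
  Phi_1; \<open>phi1_form\<close> provides it.\<close>

definition form_units :: "('a::field \<Rightarrow> 'a) \<Rightarrow> 'a \<Rightarrow> ('a mat \<Rightarrow> 'a poly) \<Rightarrow> bool" where
  "form_units cj eps mu \<longleftrightarrow> (\<forall>Phi. eps = 1 \<and> frobenius_block Phi \<and> pbar cj (char_poly Phi) = char_poly Phi
     \<longrightarrow> pbar cj (mu Phi) = mu Phi \<and> \<not> p_of Phi dvd mu Phi)"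

text \<open>Generators are labelled by positions in the list, so that repeated summands give
  distinct generators.\<close>

definition gens :: "'a::zero summand list \<Rightarrow> (nat \<times> bool) set" where
  "gens bs = {(i,t). i < length bs \<and> t \<in> sgens (bs ! i)}"

definition twin :: "'a::zero summand list \<Rightarrow> nat \<times> bool \<Rightarrow> nat \<times> bool" where
  "twin bs = (\<lambda>(i,t). (i, stwin (bs ! i) t))"

definition ann :: "('a::field \<Rightarrow> 'a) \<Rightarrow> 'a summand list \<Rightarrow> nat \<times> bool \<Rightarrow> 'a poly" where
  "ann cj bs = (\<lambda>(i,t). sann cj (bs ! i) t)"

definition form :: "'a::field \<Rightarrow> ('a mat \<Rightarrow> 'a poly) \<Rightarrow> 'a summand list \<Rightarrow> nat \<times> bool \<Rightarrow> 'a poly" where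
  "form eps mu bs = (\<lambda>(i,t). sform eps mu (bs ! i) t)"

lemma finite_sgens [simp]: "finite (sgens b)" by (cases b) auto

lemma gens_Nil [simp]: "gens [] = {}" by (auto simp: gens_def)

lemma gens_Cons: "gens (b # bs) = Pair 0 ` sgens b \<union> (\<lambda>(i,t). (Suc i, t)) ` gens bs"
proof (intro subset_antisym subsetI)
  fix z assume "z \<in> gens (b # bs)"
  then obtain i t where z: "z = (i,t)" "i < Suc (length bs)" "t \<in> sgens ((b # bs) ! i)" by (auto simp: gens_def)
  then show "z \<in> Pair 0 ` sgens b \<union> (\<lambda>(i,t). (Suc i, t)) ` gens bs"
    by (cases i) (force simp: gens_def)+
qed (auto simp: gens_def)

lemma finite_gens [simp]: "finite (gens bs)"
  by (induction bs) (auto simp: gens_Cons)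

lemma sum_gens_Cons:
  "sum F (gens (b # bs)) = (\<Sum>t\<in>sgens b. F (0,t)) + (\<Sum>(i,t)\<in>gens bs. F (Suc i, t))"
proof -
  have "sum F (gens (b # bs)) = sum F (Pair 0 ` sgens b) + sum F ((\<lambda>(i,t). (Suc i, t)) ` gens bs)"
    unfolding gens_Cons by (rule sum.union_disjoint) auto
  also have "sum F (Pair 0 ` sgens b) = (\<Sum>t\<in>sgens b. F (0,t))"
    by (subst sum.reindex) (auto simp: inj_on_def)
  also have "sum F ((\<lambda>(i,t). (Suc i, t)) ` gens bs) = (\<Sum>(i,t)\<in>gens bs. F (Suc i, t))"
    by (subst sum.reindex) (auto simp: inj_on_def case_prod_unfold)
  finally show ?thesis .
qed

lemma prime_base_frobenius:
  assumes "frobenius_block Phi"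
  obtains k where "irreducible (p_of Phi)" "monic (p_of Phi)" "0 < k" "char_poly Phi = p_of Phi ^ k"
proof -
  have "prime_power (char_poly Phi)" using assms frobenius_block_iff by blast
  then obtain p k where "irreducible p" "monic p" "0 < k" "char_poly Phi = p ^ k" unfolding prime_power_def by blast
  moreover from this have "p_of Phi = p" by (simp add: p_of_eq prime_base_power)
  ultimately show ?thesis using that by blast
qed

context herm_module
begin

lemma sum_act: "act (sum f A) v = (\<Sum>i\<in>A. act (f i) v)"
  by (induction A rule: infinite_finite_induct) (auto simp: add_act)

lemma p_of_bar:
  assumes "frobenius_block Phi" "bar (char_poly Phi) = char_poly Phi"
  shows "bar (p_of Phi) = p_of Phi"
proof -
  obtain k where k: "irreducible (p_of Phi)" "monic (p_of Phi)" "0 < k" "char_poly Phi = p_of Phi ^ k"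
    using prime_base_frobenius[OF assms(1)] by blast
  have "bar (p_of Phi) ^ k = p_of Phi ^ k" using assms(2) unfolding k(4) by (simp add: bar_power)
  then show ?thesis using power_irreducible_inj(1)[OF k(1) bar_irreducible[OF k(1)] k(2) bar_monic[OF k(2)] _ k(3)] by blast
qed

lemma good_form_unit:
  assumes "good_summand cj eps (TypeII Phi f)" "form_units cj eps mu"
  shows "\<not> p_of Phi dvd f" "\<not> p_of Phi dvd mu Phi * f"
proof -
  obtain k where k: "irreducible (p_of Phi)" "monic (p_of Phi)" "0 < k" "char_poly Phi = p_of Phi ^ k"
    using prime_base_frobenius[of Phi] assms(1) by (metis good_summand.simps(2))
  show 1: "\<not> p_of Phi dvd f" using assms(1) dvd_imp_degree_le[of "p_of Phi" f] by auto
  have "\<not> p_of Phi dvd mu Phi" using assms unfolding form_units_def by auto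
  with 1 show "\<not> p_of Phi dvd mu Phi * f"
    using prime_elem_dvd_mult_iff[OF field_poly_irreducible_imp_prime[OF k(1)]] by blast
qed

lemma good_frame_data:
  assumes "good_summand cj eps b" and mu: "form_units cj eps mu"
  shows "frame_data (sgens b) (sann cj b) (stwin b) (sform eps mu b)"
proof (cases b)
  case (TypeI Phi)
  then have p: "prime_power (char_poly Phi)" using assms frobenius_block_iff by auto
  have "\<exists>a. q dvd a * [:eps:] - 1" for q
    by (rule exI[of _ "[:eps:]"]) (simp add: one_pCons)
  moreover have "\<exists>a. q dvd a * 1 - 1" for q :: "'a poly" by (rule exI[of _ 1]) simp
  ultimately show ?thesis using TypeI p bar_prime_power[OF p] unfolding frame_data_def by auto
next
  case (TypeII Phi f)
  then have p: "prime_power (char_poly Phi)" "frobenius_block Phi" using assms frobenius_block_iff by auto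
  obtain k where k: "irreducible (p_of Phi)" "monic (p_of Phi)" "0 < k" "char_poly Phi = p_of Phi ^ k"
    using prime_base_frobenius[OF p(2)] by blast
  have "\<not> p_of Phi dvd mu Phi * f" using good_form_unit(2) assms TypeII by blast
  then have "\<exists>a. char_poly Phi dvd a * (mu Phi * f) - 1" unfolding k(4) by (rule unit_mod_power[OF k(1)])
  then show ?thesis using TypeII p assms(1) unfolding frame_data_def by auto
qed

lemma good_frame_data_list:
  assumes "\<forall>b\<in>set bs. good_summand cj eps b" and mu: "form_units cj eps mu"
  shows "frame_data (gens bs) (ann cj bs) (twin bs) (form eps mu bs)"
proof -
  have "frame_data (sgens (bs ! i)) (sann cj (bs ! i)) (stwin (bs ! i)) (sform eps mu (bs ! i))" if "i < length bs" for i
    using that assms good_frame_data by simp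
  then show ?thesis unfolding frame_data_def
    by (intro conjI finite_gens) (auto simp: gens_def ann_def twin_def form_def)
qed

abbreviation sgenerators :: "'v set \<Rightarrow> ('a mat \<Rightarrow> 'a poly) \<Rightarrow> 'a summand \<Rightarrow> (bool \<Rightarrow> 'v) \<Rightarrow> bool" where
  "sgenerators W mu b y \<equiv> frame_gens W (sgens b) (sann cj b) (stwin b) (sform eps mu b) y"

abbreviation sframe :: "'v set \<Rightarrow> ('a mat \<Rightarrow> 'a poly) \<Rightarrow> 'a summand list \<Rightarrow> (nat \<times> bool \<Rightarrow> 'v) \<Rightarrow> bool" where
  "sframe W mu bs x \<equiv> frame W (gens bs) (ann cj bs) (twin bs) (form eps mu bs) x"

lemma sgenerators_TypeI:
  assumes b: "good_summand cj eps (TypeI Phi)" and mu: "form_units cj eps mu"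
    and W: "d \<in> W" "e \<in> W" and q: "act (char_poly Phi) d = 0" "act (bar (char_poly Phi)) e = 0"
    and h: "\<And>g. h e (act g d) = top_coeff (char_poly Phi) g" "\<And>g. h d (act g d) = 0" "\<And>g. h e (act g e) = 0"
  shows "sgenerators W mu (TypeI Phi) (\<lambda>t. if t then e else d)"
proof -
  have de: "h d (act g e) = top_coeff (bar (char_poly Phi)) ([:eps:] * g)" for g
  proof -
    have "h d (act g e) = eps * cj (top_coeff (char_poly Phi) (bar g))" using h_sym_act[of d g e] h(1) by simp
    also have "\<dots> = eps * top_coeff (bar (char_poly Phi)) g" by (simp add: top_coeff_bar[symmetric])
    also have "\<dots> = top_coeff (bar (char_poly Phi)) ([:eps:] * g)" by (simp add: top_coeff_smult)
    finally show ?thesis .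
  qed
  show ?thesis unfolding frame_gens_def
    using good_frame_data[OF b mu] W q h de by (auto simp: all_bool_eq)
qed

lemma sgenerators_TypeII:
  assumes b: "good_summand cj eps (TypeII Phi f)" and mu: "form_units cj eps mu"
    and W: "d \<in> W" and q: "act (char_poly Phi) d = 0"
    and h: "\<And>g. h d (act g d) = top_coeff (char_poly Phi) (mu Phi * f * g)"
  shows "sgenerators W mu (TypeII Phi f) (\<lambda>t. d)"
  unfolding frame_gens_def using good_frame_data[OF b mu] W q h by auto

lemma comb_Cons:
  "comb (gens (b # bs)) u (\<lambda>(i,t). case i of 0 \<Rightarrow> y t | Suc j \<Rightarrow> x (j,t))
    = comb (sgens b) (\<lambda>t. u (0,t)) y + comb (gens bs) (\<lambda>(i,t). u (Suc i,t)) x"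
  unfolding comb_def sum_gens_Cons by (simp add: case_prod_unfold)

lemma sframe_Nil: "sframe {0} mu [] x"
  by (simp add: frame_def frame_gens_def frame_data_def comb_def)

text \<open>The induction step for both ways of building a frame: W' is the orthogonal complement of
  a summand that is split off in \<open>sframe_exists_span\<close>, and the second block of a direct
  sum in \<open>pframe_dsum\<close>.\<close>

lemma sframe_Cons:
  assumes y: "sgenerators W mu b y" and x: "sframe W' mu bs x" and W': "W' \<subseteq> W" "submodule W'"
    and orth: "\<And>t w. t \<in> sgens b \<Longrightarrow> w \<in> W' \<Longrightarrow> h (y t) w = 0"
    and split: "\<And>w. w \<in> W \<Longrightarrow> \<exists>u. w - comb (sgens b) u y \<in> W'"
  shows "sframe W mu (b # bs) (\<lambda>(i,t). case i of 0 \<Rightarrow> y t | Suc j \<Rightarrow> x (j,t))"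
proof -
  let ?x = "\<lambda>(i,t). case i of 0 \<Rightarrow> y t | Suc j \<Rightarrow> x (j,t)"
  have x': "frame_gens W' (gens bs) (ann cj bs) (twin bs) (form eps mu bs) x"
    and sp: "\<forall>w\<in>W'. \<exists>u. w = comb (gens bs) u x" using x unfolding frame_def by auto
  note Y = frame_gensD[OF y] and X = frame_gensD[OF x']
  have xW: "(j,t) \<in> gens bs \<Longrightarrow> x (j,t) \<in> W'" for j t using X(2) by blast
  have orth': "h w (act g (y t)) = 0" if "t \<in> sgens b" "w \<in> W'" for w g t
    using orth[OF that(1) submodule_act[OF W'(2) that(2), of "bar g"]] by (simp add: h_sym_act[of w])
  have data: "frame_data (gens (b # bs)) (ann cj (b # bs)) (twin (b # bs)) (form eps mu (b # bs))"
  proof -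
    have 1: "\<forall>\<alpha>\<in>gens bs. twin bs \<alpha> \<in> gens bs \<and> twin bs (twin bs \<alpha>) = \<alpha> \<and> ann cj bs (twin bs \<alpha>) = bar (ann cj bs \<alpha>)
        \<and> prime_power (ann cj bs \<alpha>) \<and> (\<exists>a. ann cj bs \<alpha> dvd a * form eps mu bs \<alpha> - 1)"
      using X(1) unfolding frame_data_def by blast
    have 2: "\<forall>t\<in>sgens b. stwin b t \<in> sgens b \<and> stwin b (stwin b t) = t \<and> sann cj b (stwin b t) = bar (sann cj b t)
        \<and> prime_power (sann cj b t) \<and> (\<exists>a. sann cj b t dvd a * sform eps mu b t - 1)"
      using Y(1) unfolding frame_data_def by blast
    show ?thesis unfolding frame_data_def
    proof (intro conjI ballI)
      fix \<alpha> assume "\<alpha> \<in> gens (b # bs)"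
      then consider t where "\<alpha> = (0,t)" "t \<in> sgens b" | i t where "\<alpha> = (Suc i,t)" "(i,t) \<in> gens bs"
        unfolding gens_Cons by auto
      note cs = this
      show "twin (b # bs) \<alpha> \<in> gens (b # bs)" "twin (b # bs) (twin (b # bs) \<alpha>) = \<alpha>"
        "ann cj (b # bs) (twin (b # bs) \<alpha>) = bar (ann cj (b # bs) \<alpha>)"
        "prime_power (ann cj (b # bs) \<alpha>)" "\<exists>a. ann cj (b # bs) \<alpha> dvd a * form eps mu (b # bs) \<alpha> - 1"
        by (rule cs; use 1 2 in \<open>force simp: gens_def twin_def ann_def form_def\<close>)+
    qed simp
  qed
  have gens: "frame_gens W (gens (b # bs)) (ann cj (b # bs)) (twin (b # bs)) (form eps mu (b # bs)) ?x"
    unfolding frame_gens_def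
  proof (intro conjI ballI allI)
    show "frame_data (gens (b # bs)) (ann cj (b # bs)) (twin (b # bs)) (form eps mu (b # bs))" by (rule data)
    fix \<alpha> assume "\<alpha> \<in> gens (b # bs)"
    then consider (A) t where "\<alpha> = (0,t)" "t \<in> sgens b" | (B) i t where "\<alpha> = (Suc i,t)" "(i,t) \<in> gens bs"
      unfolding gens_Cons by auto
    note a = this
    show "?x \<alpha> \<in> W" using a by cases (use Y(2) X(2) W'(1) in auto)
    show "act (ann cj (b # bs) \<alpha>) (?x \<alpha>) = 0"
      using a by cases (use Y(3) X(3) in \<open>force simp: ann_def\<close>)+
    fix \<beta> g assume "\<beta> \<in> gens (b # bs)"
    then consider (A) t where "\<beta> = (0,t)" "t \<in> sgens b" | (B) i t where "\<beta> = (Suc i,t)" "(i,t) \<in> gens bs"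
      unfolding gens_Cons by auto
    note b = this
    show "h (?x (twin (b # bs) \<alpha>)) (act g (?x \<beta>))
      = (if \<alpha> = \<beta> then top_coeff (ann cj (b # bs) \<alpha>) (form eps mu (b # bs) \<alpha> * g) else 0)"
    proof (rule a)
      fix t assume 1: "\<alpha> = (0,t)" "t \<in> sgens b"
      show ?thesis
      proof (rule b)
        fix s assume 2: "\<beta> = (0,s)" "s \<in> sgens b"
        show ?thesis using 1 2 Y(4)[OF 1(2) 2(2), of g] by (auto simp: twin_def ann_def form_def)
      next
        fix j s assume 2: "\<beta> = (Suc j,s)" "(j,s) \<in> gens bs"
        have "stwin b t \<in> sgens b" using frame_dataD(2)[OF Y(1) 1(2)] .
        then show ?thesis using 1 2 orth[OF _ submodule_act[OF W'(2) xW[OF 2(2)]]] by (simp add: twin_def)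
      qed
    next
      fix i t assume 1: "\<alpha> = (Suc i,t)" "(i,t) \<in> gens bs"
      have "twin bs (i,t) \<in> gens bs" using frame_dataD(2)[OF X(1) 1(2)] .
      then have tw: "(i, stwin (bs ! i) t) \<in> gens bs" by (simp add: twin_def)
      show ?thesis
      proof (rule b)
        fix s assume 2: "\<beta> = (0,s)" "s \<in> sgens b"
        show ?thesis using 1 2 orth'[OF 2(2) xW[OF tw]] by (simp add: twin_def)
      next
        fix j s assume 2: "\<beta> = (Suc j,s)" "(j,s) \<in> gens bs"
        show ?thesis using 1 2 X(4)[OF 1(2) 2(2), of g] by (auto simp: twin_def ann_def form_def)
      qed
    qed
  qed
  have "\<exists>u. w = comb (gens (b # bs)) u ?x" if w: "w \<in> W" for w
  proof -
    obtain u0 where "w - comb (sgens b) u0 y \<in> W'" using split[OF w] by blast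
    then obtain u1 where "w - comb (sgens b) u0 y = comb (gens bs) u1 x" using sp by blast
    then have "w = comb (sgens b) u0 y + comb (gens bs) u1 x" by (simp add: algebra_simps)
    also have "\<dots> = comb (gens (b # bs)) (\<lambda>(i,t). case i of 0 \<Rightarrow> u0 t | Suc j \<Rightarrow> u1 (j,t)) ?x"
      unfolding comb_Cons by (simp add: case_prod_unfold)
    finally show ?thesis by blast
  qed
  with gens show ?thesis unfolding frame_def by blast
qed

lemma summand_exists:
  assumes W: "submodule W" "nondegenerate W" and w0: "w0 \<in> W" "w0 \<noteq> 0"
    and m0: "m0 \<noteq> 0" "\<And>w. w \<in> W \<Longrightarrow> act m0 w = 0" and mu: "form_units cj eps mu"
  shows "\<exists>b y. good_summand cj eps b \<and> sgenerators W mu b y"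
proof -
  from split_off[OF W w0 m0] consider
    (I) p k d e where "irreducible p" "monic p" "0 < k" "d \<in> W" "e \<in> W" "eps = 1 \<longrightarrow> bar p \<noteq> p"
      "act (p ^ k) d = 0" "act (bar (p ^ k)) e = 0"
      "\<forall>g. h e (act g d) = top_coeff (p ^ k) g \<and> h d (act g d) = 0 \<and> h e (act g e) = 0"
  | (II) p k d J where "irreducible p" "monic p" "0 < k" "d \<in> W" "eps = 1" "bar p = p"
    "act (p ^ k) d = 0" "bar J = J" "\<not> p dvd J" "\<forall>g. h d (act g d) = top_coeff (p ^ k) (J * g)"
    by auto
  then show ?thesis
  proof cases
    case I
    note * = this
    let ?Phi = "companion (p ^ k)"
    have pp: "prime_power (p ^ k)" using * unfolding prime_power_def by blast
    have chi: "char_poly ?Phi = p ^ k" using char_poly_companion prime_powerD[OF pp] by blast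
    have "bar p = p" if "bar p ^ k = p ^ k"
      using power_irreducible_inj(1)[OF *(1) bar_irreducible[OF *(1)] *(2) bar_monic[OF *(2)] that *(3)] .
    then have g: "good_summand cj eps (TypeI ?Phi)" using *(6) pp by (auto simp: frobenius_block_iff chi bar_power)
    have "sgenerators W mu (TypeI ?Phi) (\<lambda>t. if t then e else d)"
      by (rule sgenerators_TypeI[OF g mu]) (use * in \<open>simp_all add: chi\<close>)
    with g show ?thesis by blast
  next
    case II
    note * = this
    let ?Phi = "companion (p ^ k)"
    have pp: "prime_power (p ^ k)" using * unfolding prime_power_def by blast
    have chi: "char_poly ?Phi = p ^ k" using char_poly_companion prime_powerD[OF pp] by blast
    have fb: "frobenius_block ?Phi" using pp by (simp add: frobenius_block_iff chi)
    have pof: "p_of ?Phi = p" using * by (simp add: p_of_eq chi prime_base_power)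
    have "bar (mu ?Phi) = mu ?Phi" "\<not> p dvd mu ?Phi"
      using mu * fb pof unfolding form_units_def by (auto simp: chi bar_power)
    with normalize_cyclic[OF W(1) *(1,2,6,3,4,7,8,9)] *(10) obtain f d' where
      f: "f \<noteq> 0" "bar f = f" "degree f < degree p" "d' \<in> W" "act (p ^ k) d' = 0"
      "\<And>g. h d' (act g d') = top_coeff (p ^ k) (mu ?Phi * f * g)" by blast
    have g: "good_summand cj eps (TypeII ?Phi f)" using f * fb by (auto simp: chi bar_power pof)
    have "sgenerators W mu (TypeII ?Phi f) (\<lambda>t. d')"
      by (rule sgenerators_TypeII[OF g mu]) (use f in \<open>simp_all add: chi\<close>)
    with g show ?thesis by blast
  qed
qed

section \<open>Dimension over K and the induction producing a frame\<close>

interpretation kvs: vector_space "\<lambda>a v. act [:a:] v"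
proof
  fix a b x y
  show "act [:a:] (x + y) = act [:a:] x + act [:a:] y" by (rule act_add)
  show "act [:a + b:] x = act [:a:] x + act [:b:] x" using add_act[of "[:a:]" "[:b:]" x] by simp
  show "act [:a:] (act [:b:] x) = act [:a * b:] x" using act_mult[of "[:a:]" "[:b:]" x] by (simp add: mult.commute)
  show "act [:1:] x = x" using act_1 by (simp add: one_pCons)
qed

lemma submodule_subspace: "submodule W \<Longrightarrow> kvs.subspace W"
  unfolding kvs.subspace_def submodule_def by blast

text \<open>The vectors x^i v with i <= card T are either not all distinct, and then some x^i - x^j
  kills v, or they are more than a spanning set allows, and then the coefficients of a linear
  dependence are the coefficients of m.\<close>

lemma vector_annihilator:
  assumes W: "submodule W" and T: "finite T" "W \<subseteq> kvs.span T" and v: "v \<in> W"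
  shows "\<exists>m. m \<noteq> 0 \<and> act m v = 0"
proof -
  let ?x = "\<lambda>i. act (monom 1 i) v" and ?n = "card T"
  show ?thesis
  proof (cases "inj_on ?x {..?n}")
    case False
    then obtain i j where ij: "i \<noteq> j" "?x i = ?x j" by (auto simp: inj_on_def)
    then have "act (monom 1 i - monom 1 j) v = 0" by (simp add: diff_act)
    moreover have "monom 1 i - monom 1 j \<noteq> (0::'a poly)" using ij by (auto simp: monom_eq_iff')
    ultimately show ?thesis by blast
  next
    case True
    let ?S = "?x ` {..?n}"
    have "?S \<subseteq> kvs.span T" using T submodule_act[OF W v] by auto
    moreover have "card ?S = Suc ?n" using True by (simp add: card_image)
    ultimately have "kvs.dependent ?S" using kvs.independent_span_bound[OF T(1), of ?S] by auto
    then obtain u y where u: "y \<in> ?S" "u y \<noteq> 0" "(\<Sum>v\<in>?S. act [:u v:] v) = 0"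
      using kvs.dependent_finite[of ?S] by auto
    define m where "m = (\<Sum>i\<le>?n. monom (u (?x i)) i)"
    have coeff: "coeff m i = u (?x i)" if "i \<le> ?n" for i
      using that by (simp add: m_def coeff_sum)
    have "act m v = (\<Sum>i\<le>?n. act [:u (?x i):] (?x i))"
    proof -
      have "act m v = (\<Sum>i\<le>?n. act (monom (u (?x i)) i) v)"
        unfolding m_def by (rule sum_act)
      also have "\<dots> = (\<Sum>i\<le>?n. act [:u (?x i):] (?x i))"
        unfolding act_mult[symmetric] by (simp add: smult_monom)
      finally show ?thesis .
    qed
    also have "\<dots> = (\<Sum>v\<in>?S. act [:u v:] v)" by (subst sum.reindex[OF True]) simp
    finally have "act m v = 0" using u(3) by simp
    moreover have "m \<noteq> 0" using u(1,2) coeff by auto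
    ultimately show ?thesis by blast
  qed
qed

lemma submodule_annihilator:
  assumes W: "submodule W" and T: "finite T" "W \<subseteq> kvs.span T"
  shows "\<exists>m. m \<noteq> 0 \<and> (\<forall>w\<in>W. act m w = 0)"
proof -
  obtain B where B: "B \<subseteq> W" "kvs.independent B" "W \<subseteq> kvs.span B" using kvs.maximal_independent_subset by blast
  have "finite B" using kvs.independent_span_bound[OF T(1) B(2)] B(1) T(2) by auto
  have "\<forall>b\<in>B. \<exists>m. m \<noteq> 0 \<and> act m b = 0" using vector_annihilator[OF W T] B(1) by blast
  from bchoice[OF this] obtain m where m: "\<And>b. b \<in> B \<Longrightarrow> m b \<noteq> 0 \<and> act (m b) b = 0" by blast
  let ?M = "prod m B"
  have "?M \<noteq> 0" using m \<open>finite B\<close> by simp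
  moreover have "act ?M w = 0" if "w \<in> W" for w
  proof -
    have "kvs.subspace {w. act ?M w = 0}"
      unfolding kvs.subspace_def by (auto simp: act_add act_comm[of ?M])
    moreover have "B \<subseteq> {w. act ?M w = 0}"
    proof
      fix b assume b: "b \<in> B"
      have "m b dvd ?M" using dvd_prodI[OF \<open>finite B\<close> b] .
      then show "b \<in> {w. act ?M w = 0}" using m[OF b] act_dvd by blast
    qed
    ultimately have "kvs.span B \<subseteq> {w. act ?M w = 0}" by (rule kvs.span_minimal[rotated])
    then show ?thesis using B(3) that by blast
  qed
  ultimately show ?thesis by blast
qed

text \<open>\<open>frame_proj\<close> splits W into the span of the generators and W', so a vector
  of W' orthogonal to W' is orthogonal to W. That no generator lies in W' is what makes the
  dimension drop.\<close>

lemma complement: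
  assumes W: "submodule W" "nondegenerate W" and y: "frame_gens W Om c tau J y"
  defines "W' \<equiv> {w \<in> W. \<forall>\<alpha>\<in>Om. \<forall>g. h (y \<alpha>) (act g w) = 0}"
  shows "submodule W'" "nondegenerate W'" "\<And>w. w \<in> W \<Longrightarrow> \<exists>u. w - comb Om u y \<in> W'"
    "\<And>\<alpha>. \<alpha> \<in> Om \<Longrightarrow> y \<alpha> \<notin> W'"
proof -
  note Y = frame_gensD[OF y]
  have "h z (act g (act f w)) = 0" if "\<forall>g. h z (act g w) = 0" for z f g w
    using that[rule_format, of "g * f"] by (simp add: act_mult)
  then show "submodule W'" using W(1) unfolding submodule_def W'_def by (auto simp: act_add h_add)
  show sp: "\<exists>u. w - comb Om u y \<in> W'" if w: "w \<in> W" for w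
  proof -
    obtain u where u: "\<forall>\<alpha>\<in>Om. \<forall>g. h (y \<alpha>) (act g (w - comb Om u y)) = 0" using frame_proj[OF y] by blast
    have "w - comb Om u y \<in> W" by (intro submodule_diff[OF W(1) w] comb_in[OF W(1)] Y(2))
    then show ?thesis using u unfolding W'_def by blast
  qed
  show "nondegenerate W'" unfolding nondegenerate_def
  proof (intro ballI impI)
    fix u assume u: "u \<in> W'" "\<forall>w\<in>W'. h w u = 0"
    have "h w u = 0" if w: "w \<in> W" for w
    proof -
      obtain v where v: "w - comb Om v y \<in> W'" using sp[OF w] by blast
      have "h (comb Om v y) u = 0"
        using u(1) unfolding comb_def h_sum_left W'_def by (intro sum.neutral) (simp add: h_adj)
      then show ?thesis using u(2) v h_diff_left[of w "comb Om v y" u] by auto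
    qed
    then show "u = 0" using W(2) u(1) unfolding nondegenerate_def W'_def by blast
  qed
  fix \<alpha> assume a: "\<alpha> \<in> Om"
  note E = frame_dataD[OF Y(1) a]
  show "y \<alpha> \<notin> W'"
  proof
    assume "y \<alpha> \<in> W'"
    then have "h (y (tau \<alpha>)) (act g (y \<alpha>)) = 0" for g using E(2) unfolding W'_def by blast
    then have "c \<alpha> dvd J \<alpha>"
      using Y(4)[OF a a] prime_powerD(2)[OF E(5)] by (intro top_coeff_nondegenerate) auto
    then have 1: "c \<alpha> dvd b * J \<alpha>" for b by (rule dvd_mult)
    obtain b where "c \<alpha> dvd b * J \<alpha> - 1" using E(6) by blast
    from dvd_diff[OF 1[of b] this] have "c \<alpha> dvd 1" by simp
    then show False using prime_powerD(2,3)[OF E(5)] by (simp add: is_unit_iff_degree)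
  qed
qed

text \<open>The size of a spanning set T serves as the measure. A basis B of W' stays independent
  when \<open>y False\<close> is added (the index False belongs to both types of summand), so B has
  fewer elements than T and takes its place for W'.\<close>

lemma sframe_exists_span:
  assumes mu: "form_units cj eps mu"
  shows "submodule W \<Longrightarrow> nondegenerate W \<Longrightarrow> finite T \<Longrightarrow> W \<subseteq> kvs.span T \<Longrightarrow>
    \<exists>bs x. (\<forall>b\<in>set bs. good_summand cj eps b) \<and> sframe W mu bs x"
proof (induction "card T" arbitrary: W T rule: less_induct)
  case less
  show ?case
  proof (cases "\<exists>w0\<in>W. w0 \<noteq> 0")
    case False
    then have "W = {0}" using less.prems(1) unfolding submodule_def by blast
    then show ?thesis using sframe_Nil by (intro exI[of _ "[]"]) auto
  next
    case True
    then obtain w0 where w0: "w0 \<in> W" "w0 \<noteq> 0" by blast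
    obtain m where m: "m \<noteq> 0" "\<And>w. w \<in> W \<Longrightarrow> act m w = 0"
      using submodule_annihilator[OF less.prems(1,3,4)] by blast
    obtain b y where b: "good_summand cj eps b" and y: "sgenerators W mu b y"
      using summand_exists[OF less.prems(1,2) w0 m mu] by blast
    define W' where "W' = {w \<in> W. \<forall>\<alpha>\<in>sgens b. \<forall>g. h (y \<alpha>) (act g w) = 0}"
    note C = complement[OF less.prems(1,2) y, folded W'_def]
    have W'W: "W' \<subseteq> W" unfolding W'_def by blast
    have F: "False \<in> sgens b" by (cases b) auto
    obtain B where B: "B \<subseteq> W'" "kvs.independent B" "W' \<subseteq> kvs.span B" using kvs.maximal_independent_subset by blast
    have "kvs.span B \<subseteq> W'" using B(1) submodule_subspace[OF C(1)] by (rule kvs.span_minimal)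
    then have "y False \<notin> kvs.span B" using C(4)[OF F] by blast
    then have ind: "kvs.independent (insert (y False) B)" "y False \<notin> B"
      using B(2) kvs.independent_insertI kvs.span_base by blast+
    have "insert (y False) B \<subseteq> kvs.span T"
      using B(1) W'W less.prems(4) frame_gensD(2)[OF y F] by blast
    then have "finite (insert (y False) B) \<and> card (insert (y False) B) \<le> card T"
      by (rule kvs.independent_span_bound[OF less.prems(3) ind(1)])
    then have "finite B" "card B < card T" using ind(2) by auto
    from less.hyps[OF this(2) C(1,2) this(1) B(3)] obtain bs x where
      bs: "\<forall>b\<in>set bs. good_summand cj eps b" and x: "sframe W' mu bs x" by blast
    have "h (y t) w = 0" if "t \<in> sgens b" "w \<in> W'" for t w
    proof -
      have "h (y t) (act 1 w) = 0" using that unfolding W'_def by blast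
      then show ?thesis by simp
    qed
    from sframe_Cons[OF y x W'W C(1) this C(3)] b bs show ?thesis by (intro exI[of _ "b # bs"]) auto
  qed
qed

lemma sframe_exists:
  assumes "form_units cj eps mu" "submodule W" "nondegenerate W"
    and T: "finite T" "\<And>w. w \<in> W \<Longrightarrow> \<exists>u. w = (\<Sum>t\<in>T. act [:u t:] t)"
  shows "\<exists>bs x. (\<forall>b\<in>set bs. good_summand cj eps b) \<and> sframe W mu bs x"
proof (rule sframe_exists_span[OF assms(1-3) T(1)])
  show "W \<subseteq> kvs.span T" unfolding kvs.span_finite[OF T(1)] using T(2) by blast
qed

end

text \<open>Two coordinate families of the same vector differ by multiples of the annihilators,
  which vanish on the other side; so copying coordinates is well defined. Additivity, compatibility
  with the action and isometry then follow from \<open>comb_add\<close>, \<open>act_comb\<close> and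
  \<open>frame_form\<close>.\<close>

lemma frame_isometry:
  assumes "herm_module cj eps act1 h1" "herm_module cj eps act2 h2"
    and F1: "herm_module.frame cj act1 h1 W1 Om c tau J x1" and F2: "herm_module.frame cj act2 h2 W2 Om c tau J x2"
  shows "\<exists>\<phi>. \<forall>u. \<phi> (herm_module.comb act1 Om u x1) = herm_module.comb act2 Om u x2"
proof -
  interpret A: herm_module cj eps act1 h1 by fact
  interpret B: herm_module cj eps act2 h2 by fact
  have G1: "A.frame_gens W1 Om c tau J x1" and G2: "B.frame_gens W2 Om c tau J x2"
    using F1 F2 unfolding A.frame_def B.frame_def by auto
  define \<phi> where "\<phi> w = B.comb Om (SOME u. w = A.comb Om u x1) x2" for w
  have "\<phi> (A.comb Om u x1) = B.comb Om u x2" for u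
  proof -
    define v where "v = (SOME v. A.comb Om u x1 = A.comb Om v x1)"
    have "\<exists>v. A.comb Om u x1 = A.comb Om v x1" by blast
    then have v: "A.comb Om u x1 = A.comb Om v x1" unfolding v_def by (rule someI_ex)
    have "act2 (v \<alpha>) (x2 \<alpha>) = act2 (u \<alpha>) (x2 \<alpha>)" if a: "\<alpha> \<in> Om" for \<alpha>
    proof (rule B.act_cong)
      have "act1 1 (A.comb Om (\<lambda>\<alpha>. v \<alpha> - u \<alpha>) x1) = 0" using v by (simp add: A.comb_diff[symmetric])
      from A.frame_indep[OF G1 a this] show "c \<alpha> dvd v \<alpha> - u \<alpha>" by simp
      show "act2 (c \<alpha>) (x2 \<alpha>) = 0" by (rule B.frame_gensD(3)[OF G2 a])
    qed
    then show ?thesis unfolding \<phi>_def v_def[symmetric] B.comb_def by (intro sum.cong) auto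
  qed
  then show ?thesis by blast
qed


section \<open>Comparing frames with the same underlying module\<close>

text \<open>With E = A B - 1, which vanishes modulo m, one has B E adj(B) = det B (B A - 1). Since
  det A det B is 1 modulo m, the factor det B can be cancelled.\<close>

lemma left_inverse_mod_imp_right_inverse:
  fixes R :: "'c \<Rightarrow> 'b \<Rightarrow> 'a::comm_ring_1"
  assumes fin: "finite I" "finite I'" and cd: "card I = card I'"
    and inv: "\<And>a b. a \<in> I' \<Longrightarrow> b \<in> I' \<Longrightarrow> m dvd (\<Sum>k\<in>I. R a k * S k b) - (if a = b then 1 else 0)"
    and kl: "k \<in> I" "l \<in> I"
  shows "m dvd (\<Sum>a\<in>I'. S k a * R a l) - (if k = l then 1 else 0)"
proof -
  let ?N = "card I"
  obtain f where f: "bij_betw f {0..<?N} I" using ex_bij_betw_nat_finite[OF fin(1)] by blast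
  obtain g where g: "bij_betw g {0..<?N} I'" using ex_bij_betw_nat_finite[OF fin(2)] cd by auto
  define A where "A = mat ?N ?N (\<lambda>(i,k). R (g i) (f k))"
  define B where "B = mat ?N ?N (\<lambda>(k,j). S (f k) (g j))"
  have AB: "A \<in> carrier_mat ?N ?N" "B \<in> carrier_mat ?N ?N" by (auto simp: A_def B_def)
  have gI: "i < ?N \<Longrightarrow> g i \<in> I'" for i using g by (auto simp: bij_betw_def)
  have ginj: "i < ?N \<Longrightarrow> j < ?N \<Longrightarrow> g i = g j \<longleftrightarrow> i = j" for i j
    using g by (auto simp: bij_betw_def inj_on_def)
  have eAB: "(A * B) $$ (i,j) = (\<Sum>k\<in>I. R (g i) k * S k (g j))" if "i < ?N" "j < ?N" for i j
    unfolding sum.reindex_bij_betw[OF f, symmetric] using that AB by (simp add: A_def B_def scalar_prod_def)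
  have eBA: "(B * A) $$ (i,j) = (\<Sum>a\<in>I'. S (f i) a * R a (f j))" if "i < ?N" "j < ?N" for i j
    unfolding sum.reindex_bij_betw[OF g, symmetric] using that AB by (simp add: A_def B_def scalar_prod_def)
  define E where "E = A * B - 1\<^sub>m ?N"
  have E: "E \<in> carrier_mat ?N ?N" unfolding E_def by (rule minus_carrier_mat) simp
  have dE: "m dvd E $$ (i,j)" if "i < ?N" "j < ?N" for i j
    using inv[OF gI[OF that(1)] gI[OF that(2)]] that ginj eAB[OF that] AB by (simp add: E_def)
  have "m dvd det (A * B) - det (1\<^sub>m ?N)"
    by (rule det_diff_dvd[of _ ?N]) (use AB dE in \<open>auto simp: E_def\<close>)
  then have dd: "m dvd det A * det B - 1" using det_mult[OF AB] by simp
  note adj = adj_mat[OF AB(2)]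
  have prod_dvd: "m dvd (X * Y) $$ (i,j)" if "X \<in> carrier_mat ?N ?N" "Y \<in> carrier_mat ?N ?N" "i < ?N" "j < ?N"
    "(\<forall>i<?N. \<forall>j<?N. m dvd X $$ (i,j)) \<or> (\<forall>i<?N. \<forall>j<?N. m dvd Y $$ (i,j))" for X Y i j
  proof -
    have "(X * Y) $$ (i,j) = (\<Sum>k\<in>{0..<?N}. X $$ (i,k) * Y $$ (k,j))" using that by (simp add: scalar_prod_def)
    also have "m dvd \<dots>" using that by (intro dvd_sum) (auto intro: dvd_mult dvd_mult2)
    finally show ?thesis .
  qed
  have BA: "m dvd (B * A - 1\<^sub>m ?N) $$ (i,j)" if ij: "i < ?N" "j < ?N" for i j
  proof -
    have 1: "B * (E * adj_mat B) = B * A * (B * adj_mat B) - B * adj_mat B"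
    proof -
      have "E * adj_mat B = A * B * adj_mat B - adj_mat B"
        unfolding E_def using AB adj(1) by (subst minus_mult_distrib_mat[of _ ?N ?N]) auto
      then have "B * (E * adj_mat B) = B * (A * B * adj_mat B - adj_mat B)" by (simp only:)
      also have "\<dots> = B * (A * B * adj_mat B) - B * adj_mat B"
        by (rule mult_minus_distrib_mat[OF AB(2) _ adj(1)]) (use AB adj(1) in auto)
      also have "B * (A * B * adj_mat B) = B * A * (B * adj_mat B)"
        using AB adj(1) by (simp add: assoc_mult_mat[of _ ?N ?N _ ?N _ ?N])
      finally show ?thesis .
    qed
    have "B * (E * adj_mat B) = det B \<cdot>\<^sub>m (B * A - 1\<^sub>m ?N)"
    proof -
      have BAc: "B * A \<in> carrier_mat ?N ?N" using AB by auto
      have "B * A * (det B \<cdot>\<^sub>m 1\<^sub>m ?N) = det B \<cdot>\<^sub>m (B * A)"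
        using mult_smult_distrib[OF BAc one_carrier_mat, of "det B"] right_mult_one_mat[OF BAc] by (simp only:)
      then show ?thesis unfolding 1 adj(2) using BAc AB by (intro eq_matI) (auto simp: right_diff_distrib)
    qed
    moreover have "m dvd (B * (E * adj_mat B)) $$ (i,j)"
      by (rule prod_dvd) (use AB E adj(1) ij dE prod_dvd[OF E adj(1)] in auto)
    ultimately have "m dvd det B * (B * A - 1\<^sub>m ?N) $$ (i,j)" using ij AB by simp
    with dd show ?thesis by (rule dvd_mult_unit_mod)
  qed
  have "k \<in> f ` {0..<?N}" "l \<in> f ` {0..<?N}" using bij_betw_imp_surj_on[OF f] kl by auto
  then obtain i j where i: "i < ?N" "f i = k" and j: "j < ?N" "f j = l" by (auto elim!: imageE)
  have "f i = f j \<longleftrightarrow> i = j" using f i j by (auto simp: bij_betw_def inj_on_def)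
  then show ?thesis using BA[OF i(1) j(1)] eBA[OF i(1) j(1)] i j AB by simp
qed

context herm_module
begin

text \<open>Converse to \<open>frame_compare\<close>, with congruences modulo the full annihilators.
  The coefficients s link only generators with equal annihilator, so each q is treated separately.
  Equal counts make the left inverse of s a right inverse, which expresses the old generators by the
  new ones.\<close>

lemma frame_change:
  assumes W: "submodule W" and F: "frame W Om c tau J x" and D': "frame_data Om' c' tau' J'"
    and supp: "\<And>\<alpha> \<beta>. \<beta> \<in> Om' \<Longrightarrow> \<alpha> \<in> Om \<Longrightarrow> s \<beta> \<alpha> \<noteq> 0 \<Longrightarrow> c \<alpha> = c' \<beta>"
    and cong: "\<And>\<beta> \<beta>'. \<beta> \<in> Om' \<Longrightarrow> \<beta>' \<in> Om' \<Longrightarrow> c' \<beta> = c' \<beta>' \<Longrightarrow>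
      c' \<beta> dvd (\<Sum>\<alpha> | \<alpha> \<in> Om \<and> c \<alpha> = c' \<beta>. bar (s (tau' \<beta>') (tau \<alpha>)) * J \<alpha> * s \<beta> \<alpha>) - (if \<beta>' = \<beta> then J' \<beta> else 0)"
    and cards: "\<And>q. prime_power q \<Longrightarrow> card {\<alpha> \<in> Om. c \<alpha> = q} = card {\<beta> \<in> Om'. c' \<beta> = q}"
  shows "frame W Om' c' tau' J' (\<lambda>\<beta>. comb Om (s \<beta>) x)"
proof -
  let ?x = "\<lambda>\<beta>. comb Om (s \<beta>) x"
  have G: "frame_gens W Om c tau J x" and sp: "\<forall>w\<in>W. \<exists>u. w = comb Om u x" using F unfolding frame_def by auto
  note D = frame_gensD[OF G]
  have fin: "finite Om" "finite Om'" using D(1) D' by (auto simp: frame_data_def)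
  have sum_supp: "(\<Sum>\<alpha>\<in>Om. f \<alpha>) = (\<Sum>\<alpha> | \<alpha> \<in> Om \<and> c \<alpha> = c' \<beta>. f \<alpha>)"
    if "\<beta> \<in> Om'" "\<And>\<alpha>. \<alpha> \<in> Om \<Longrightarrow> s \<beta> \<alpha> = 0 \<Longrightarrow> f \<alpha> = 0" for \<beta> and f :: "_ \<Rightarrow> 'z::comm_monoid_add"
    using that supp by (intro sum.mono_neutral_right) (auto simp: fin)
  have gens: "frame_gens W Om' c' tau' J' ?x"
    unfolding frame_gens_def
  proof (intro conjI ballI allI)
    fix \<beta> assume b: "\<beta> \<in> Om'"
    show "?x \<beta> \<in> W" by (rule comb_in[OF W D(2)])
    have "act (c' \<beta> * s \<beta> \<alpha>) (x \<alpha>) = 0" if a: "\<alpha> \<in> Om" for \<alpha>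
      using supp[OF b a] D(3)[OF a] act_dvd[of "c \<alpha>" "c' \<beta> * s \<beta> \<alpha>"] by (cases "s \<beta> \<alpha> = 0") auto
    then show "act (c' \<beta>) (?x \<beta>) = 0" unfolding act_comb by (simp add: comb_def)
    fix \<gamma> g assume c: "\<gamma> \<in> Om'"
    note E = frame_dataD[OF D' b] and E2 = frame_dataD[OF D' c]
    have "h (?x (tau' \<beta>)) (act g (?x \<gamma>))
       = (\<Sum>\<alpha>\<in>Om. top_coeff (c \<alpha>) (J \<alpha> * (g * (bar (s (tau' \<beta>) (tau \<alpha>)) * s \<gamma> \<alpha>))))"
      by (rule frame_form[OF G])
    also have "\<dots> = (if \<beta> = \<gamma> then top_coeff (c' \<beta>) (J' \<beta> * g) else 0)"
    proof (cases "c' \<gamma> = c' \<beta>")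
      case False
      have "bar (s (tau' \<beta>) (tau \<alpha>)) * s \<gamma> \<alpha> = 0" if a: "\<alpha> \<in> Om" for \<alpha>
      proof (rule ccontr)
        assume "\<not> ?thesis"
        then have nz: "s (tau' \<beta>) (tau \<alpha>) \<noteq> 0" "s \<gamma> \<alpha> \<noteq> 0" by auto
        from supp[OF E(2) frame_dataD(2)[OF D(1) a] nz(1)] have "c \<alpha> = c' \<beta>"
          by (simp add: E(4) frame_dataD(4)[OF D(1) a] bar_inj)
        with supp[OF c a nz(2)] False show False by simp
      qed
      then have "(\<Sum>\<alpha>\<in>Om. top_coeff (c \<alpha>) (J \<alpha> * (g * (bar (s (tau' \<beta>) (tau \<alpha>)) * s \<gamma> \<alpha>)))) = 0"
        by (intro sum.neutral ballI) (simp only: mult_zero_right top_coeff_0)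
      then show ?thesis using False by auto
    next
      case True
      have "(\<Sum>\<alpha>\<in>Om. top_coeff (c \<alpha>) (J \<alpha> * (g * (bar (s (tau' \<beta>) (tau \<alpha>)) * s \<gamma> \<alpha>))))
        = (\<Sum>\<alpha> | \<alpha> \<in> Om \<and> c \<alpha> = c' \<gamma>. top_coeff (c \<alpha>) (J \<alpha> * (g * (bar (s (tau' \<beta>) (tau \<alpha>)) * s \<gamma> \<alpha>))))"
        by (rule sum_supp[OF c]) simp
      also have "\<dots> = top_coeff (c' \<gamma>) ((\<Sum>\<alpha> | \<alpha> \<in> Om \<and> c \<alpha> = c' \<gamma>. bar (s (tau' \<beta>) (tau \<alpha>)) * J \<alpha> * s \<gamma> \<alpha>) * g)"
        unfolding sum_distrib_right top_coeff_sum by (rule sum.cong) (auto simp: mult_ac)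
      also have "\<dots> = top_coeff (c' \<gamma>) ((if \<beta> = \<gamma> then J' \<gamma> else 0) * g)"
        using cong[OF c b True] by (intro top_coeff_cong) (simp only: left_diff_distrib[symmetric] dvd_mult2)
      also have "\<dots> = (if \<beta> = \<gamma> then top_coeff (c' \<beta>) (J' \<beta> * g) else 0)"
        by (cases "\<beta> = \<gamma>") simp_all
      finally show ?thesis .
    qed
    finally show "h (?x (tau' \<beta>)) (act g (?x \<gamma>)) = (if \<beta> = \<gamma> then top_coeff (c' \<beta>) (J' \<beta> * g) else 0)" .
  qed (rule D')
  have "\<forall>\<beta>\<in>Om'. \<exists>a. c' \<beta> dvd a * J' \<beta> - 1" using frame_dataD(6)[OF D'] by blast
  from bchoice[OF this] obtain a where a: "\<And>\<beta>. \<beta> \<in> Om' \<Longrightarrow> c' \<beta> dvd a \<beta> * J' \<beta> - 1" by blast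
  \<comment> \<open>The left inverse of s, obtained from \<open>cong\<close> by multiplying with the
    inverse of \<open>J' \<beta>\<close>.\<close>
  define R where "R \<beta> \<alpha> = a \<beta> * (bar (s (tau' \<beta>) (tau \<alpha>)) * J \<alpha>)" for \<beta> \<alpha>
  have gen: "\<exists>u. x \<alpha> = comb Om' u ?x" if al: "\<alpha> \<in> Om" for \<alpha>
  proof -
    define q where "q = c \<alpha>"
    let ?I = "{\<alpha> \<in> Om. c \<alpha> = q}" and ?I' = "{\<beta> \<in> Om'. c' \<beta> = q}"
    have pq: "prime_power q" using frame_dataD(5)[OF D(1) al] q_def by simp
    have inv: "q dvd (\<Sum>k\<in>?I. R \<beta>' k * s \<beta> k) - (if \<beta>' = \<beta> then 1 else 0)" if "\<beta>' \<in> ?I'" "\<beta> \<in> ?I'" for \<beta>' \<beta>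
    proof -
      let ?Y = "\<Sum>\<alpha> | \<alpha> \<in> Om \<and> c \<alpha> = q. bar (s (tau' \<beta>') (tau \<alpha>)) * J \<alpha> * s \<beta> \<alpha>"
      let ?d = "if \<beta>' = \<beta> then J' \<beta> else 0"
      have "q dvd ?Y - ?d" using cong[of \<beta> \<beta>'] that by auto
      moreover have "q dvd a \<beta> * J' \<beta> - 1" using a[of \<beta>] that by auto
      ultimately have "q dvd a \<beta>' * (?Y - ?d) + (if \<beta>' = \<beta> then a \<beta> * J' \<beta> - 1 else 0)"
        by (intro dvd_add dvd_mult) auto
      also have "\<dots> = a \<beta>' * ?Y - (if \<beta>' = \<beta> then 1 else 0)" by (auto simp: algebra_simps)
      also have "a \<beta>' * ?Y = (\<Sum>k\<in>?I. R \<beta>' k * s \<beta> k)" by (simp add: sum_distrib_left mult.assoc R_def)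
      finally show ?thesis .
    qed
    have right: "q dvd (\<Sum>\<beta>\<in>?I'. s \<beta> k * R \<beta> \<alpha>) - (if k = \<alpha> then 1 else 0)" if "k \<in> ?I" for k
      by (rule left_inverse_mod_imp_right_inverse[where R = R and S = "\<lambda>k \<beta>. s \<beta> k" and I = ?I])
        (use fin cards[OF pq] inv that al q_def in auto)
    define u where "u \<beta> = (if c' \<beta> = q then R \<beta> \<alpha> else 0)" for \<beta>
    have "comb Om' u ?x = (\<Sum>\<beta>\<in>?I'. act (R \<beta> \<alpha>) (?x \<beta>))"
      unfolding comb_def[of Om'] u_def by (intro sum.mono_neutral_cong_right) (auto simp: fin)
    also have "\<dots> = (\<Sum>\<beta>\<in>?I'. \<Sum>k\<in>?I. act (R \<beta> \<alpha> * s \<beta> k) (x k))"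
    proof (rule sum.cong)
      fix \<beta> assume "\<beta> \<in> ?I'"
      then have b: "\<beta> \<in> Om'" "c' \<beta> = q" by auto
      have "act (R \<beta> \<alpha>) (?x \<beta>) = (\<Sum>k\<in>Om. act (R \<beta> \<alpha> * s \<beta> k) (x k))"
        unfolding act_comb by (simp add: comb_def)
      also have "\<dots> = (\<Sum>k\<in>?I. act (R \<beta> \<alpha> * s \<beta> k) (x k))"
        using sum_supp[OF b(1), of "\<lambda>k. act (R \<beta> \<alpha> * s \<beta> k) (x k)"] b(2) by simp
      finally show "act (R \<beta> \<alpha>) (?x \<beta>) = \<dots>" .
    qed simp
    also have "\<dots> = (\<Sum>k\<in>?I. act (\<Sum>\<beta>\<in>?I'. s \<beta> k * R \<beta> \<alpha>) (x k))"
      by (subst sum.swap) (simp add: sum_act mult.commute)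
    also have "\<dots> = (\<Sum>k\<in>?I. act (if k = \<alpha> then 1 else 0) (x k))"
    proof (rule sum.cong)
      fix k assume k: "k \<in> ?I"
      then have "act q (x k) = 0" using D(3) by auto
      then show "act (\<Sum>\<beta>\<in>?I'. s \<beta> k * R \<beta> \<alpha>) (x k) = act (if k = \<alpha> then 1 else 0) (x k)"
        by (rule act_cong[OF right[OF k]])
    qed simp
    also have "\<dots> = (\<Sum>k\<in>?I. if k = \<alpha> then x k else 0)" by (rule sum.cong) auto
    also have "\<dots> = x \<alpha>" using al fin by (simp add: q_def)
    finally show ?thesis by metis
  qed
  have zero_in: "\<exists>u. 0 = comb Om' u ?x" by (rule exI[of _ "\<lambda>_. 0"]) (simp add: comb_def[of Om'])
  have "\<exists>u. comb A v x = comb Om' u ?x" if "A \<subseteq> Om" for A v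
    using finite_subset[OF that fin(1)] that
  proof (induction A rule: finite_induct)
    case empty
    then show ?case using zero_in by (simp add: comb_def[of "{}"])
  next
    case (insert \<alpha> A)
    obtain u1 where "comb A v x = comb Om' u1 ?x" using insert by auto
    moreover obtain u2 where "x \<alpha> = comb Om' u2 ?x" using gen insert by auto
    moreover have "comb (insert \<alpha> A) v x = act (v \<alpha>) (x \<alpha>) + comb A v x"
      using insert by (simp add: comb_def)
    ultimately have "comb (insert \<alpha> A) v x = comb Om' (\<lambda>\<beta>. v \<alpha> * u2 \<beta> + u1 \<beta>) ?x"
      by (simp only: act_comb comb_add)
    then show ?case by blast
  qed
  then have "\<forall>w\<in>W. \<exists>u. w = comb Om' u ?x" using sp by (metis subset_refl)
  with gens show ?thesis unfolding frame_def by blast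
qed

end

section \<open>Bookkeeping of summands\<close>

definition grp :: "'a::zero mat \<Rightarrow> 'a summand list \<Rightarrow> nat set" where
  "grp Phi bs = {i. i < length bs \<and> (\<exists>f. bs ! i = TypeII Phi f)}"

fun spoly :: "'a::zero summand \<Rightarrow> 'a poly" where
  "spoly (TypeI Phi) = 0" | "spoly (TypeII Phi f) = f"

text \<open>X is the unordered pair of conjugate characteristic polynomials under which
  \<open>summands_related\<close> identifies type (i) blocks.\<close>

definition blk :: "('a::field \<Rightarrow> 'a) \<Rightarrow> 'a poly set \<Rightarrow> 'a summand list \<Rightarrow> nat set" where
  "blk cj X bs = {i. i < length bs \<and> (\<exists>Phi. bs ! i = TypeI Phi \<and> {char_poly Phi, pbar cj (char_poly Phi)} = X)}"

lemma finite_grp [simp]: "finite (grp Phi bs)" by (simp add: grp_def)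
lemma finite_blk [simp]: "finite (blk cj X bs)" by (simp add: blk_def)

lemma blk_Cons: "blk cj X (b # bs) = (case b of TypeI Phi \<Rightarrow> if {char_poly Phi, pbar cj (char_poly Phi)} = X then {0} else {} | _ \<Rightarrow> {})
    \<union> Suc ` blk cj X bs"
proof -
  have "i \<in> blk cj X (b # bs) \<longleftrightarrow> i \<in> (case b of TypeI Phi \<Rightarrow> if {char_poly Phi, pbar cj (char_poly Phi)} = X then {0} else {} | _ \<Rightarrow> {})
    \<union> Suc ` blk cj X bs" for i
    by (cases i; cases b) (auto simp: blk_def)
  then show ?thesis by blast
qed

lemma count_typeI_blocks:
  "count (image_mset (\<lambda>Phi. {char_poly Phi, pbar cj (char_poly Phi)}) (mset (typeI_blocks bs))) X = card (blk cj X bs)"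
proof (induction bs)
  case Nil
  then show ?case by (simp add: blk_def)
next
  case (Cons b bs)
  then show ?case by (cases b) (auto simp: blk_Cons card_image)
qed

text \<open>Turns equality of multisets into equality of cardinalities, which
  \<open>card_gens_of_block\<close> relates to numbers of generators.\<close>

lemma typeI_blocks_eq_iff:
  "image_mset (\<lambda>Phi. {char_poly Phi, pbar cj (char_poly Phi)}) (mset (typeI_blocks bs))
     = image_mset (\<lambda>Phi. {char_poly Phi, pbar cj (char_poly Phi)}) (mset (typeI_blocks cs))
   \<longleftrightarrow> (\<forall>X. card (blk cj X bs) = card (blk cj X cs))"
  by (simp add: multiset_eq_iff count_typeI_blocks)

text \<open>\<open>herm_equiv\<close> indexes by position inside the group of one Phi, frames by
  position in the whole list; e translates between the two.\<close>

lemma typeII_group_enum: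
  "\<exists>e. bij_betw e {0..<length (typeII_group Phi bs)} (grp Phi bs)
    \<and> (\<forall>a<length (typeII_group Phi bs). spoly (bs ! e a) = typeII_group Phi bs ! a)"
proof (induction bs)
  case Nil
  then show ?case by (auto simp: grp_def)
next
  case (Cons b bs)
  then obtain e where e: "bij_betw e {0..<length (typeII_group Phi bs)} (grp Phi bs)"
    "\<forall>a<length (typeII_group Phi bs). spoly (bs ! e a) = typeII_group Phi bs ! a" by blast
  let ?L = "length (typeII_group Phi bs)"
  have bS: "bij_betw Suc (grp Phi bs) (Suc ` grp Phi bs)" by (simp add: bij_betw_def)
  have mem: "i \<in> grp Phi (b # bs) \<longleftrightarrow> (i = 0 \<and> (\<exists>f. b = TypeII Phi f)) \<or> i \<in> Suc ` grp Phi bs" for i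
    by (cases i) (auto simp: grp_def)
  show ?case
  proof (cases "\<exists>f. b = TypeII Phi f")
    case False
    then have "typeII_group Phi (b # bs) = typeII_group Phi bs" by (cases b) auto
    moreover have "grp Phi (b # bs) = Suc ` grp Phi bs" using mem False by blast
    ultimately show ?thesis using bij_betw_trans[OF e(1) bS] e(2) by (intro exI[of _ "Suc \<circ> e"]) (simp add: comp_def)
  next
    case True
    then obtain f where f: "b = TypeII Phi f" by blast
    have G: "grp Phi (b # bs) = insert 0 (Suc ` grp Phi bs)" using mem f by blast
    let ?e = "\<lambda>a. case a of 0 \<Rightarrow> 0 | Suc a' \<Rightarrow> Suc (e a')"
    have "bij_betw ?e {0..<Suc ?L} (insert 0 (Suc ` grp Phi bs))"
    proof (rule bij_betw_imageI)
      show "inj_on ?e {0..<Suc ?L}" using e(1)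
        by (auto simp: inj_on_def bij_betw_def split: nat.splits)
      have "?e ` {0..<Suc ?L} = insert 0 (Suc ` e ` {0..<?L})"
        unfolding atLeast0_lessThan_Suc_eq_insert_0 image_insert image_image by simp
      then show "?e ` {0..<Suc ?L} = insert 0 (Suc ` grp Phi bs)" using e(1) by (simp add: bij_betw_def)
    qed
    moreover have "\<forall>a<Suc ?L. spoly ((b # bs) ! ?e a) = (f # typeII_group Phi bs) ! a"
      using e(2) f by (auto split: nat.splits)
    ultimately show ?thesis unfolding G using f by (intro exI[of _ ?e]) simp
  qed
qed

lemma length_typeII_group: "length (typeII_group Phi bs) = card (grp Phi bs)"
  using typeII_group_enum[of Phi bs] bij_betw_same_card by fastforce

lemma herm_equiv_index:
  assumes "herm_equiv cj p (typeII_group Phi bs) (typeII_group Phi cs)"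
  shows "card (grp Phi bs) = card (grp Phi cs)"
    "\<exists>S. \<forall>i\<in>grp Phi cs. \<forall>j\<in>grp Phi cs. p dvd (\<Sum>l\<in>grp Phi bs. pbar cj (S l i) * spoly (bs ! l) * S l j)
       - (if i = j then spoly (cs ! i) else 0)"
proof -
  let ?fs = "typeII_group Phi bs" and ?gs = "typeII_group Phi cs"
  let ?n = "length ?fs"
  have len: "?n = length ?gs" using assms by (simp add: herm_equiv_def)
  then show "card (grp Phi bs) = card (grp Phi cs)" by (simp add: length_typeII_group)
  obtain S where S: "\<And>i j. i < ?n \<Longrightarrow> j < ?n \<Longrightarrow>
      p dvd (\<Sum>k<?n. pbar cj (S $$ (k,i)) * ?fs ! k * S $$ (k,j)) - (if i = j then ?gs ! i else 0)"
    using assms unfolding herm_equiv_def Let_def by blast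
  obtain e where e: "bij_betw e {0..<?n} (grp Phi bs)" "\<forall>a<?n. spoly (bs ! e a) = ?fs ! a"
    using typeII_group_enum[of Phi bs] by blast
  obtain e' where e': "bij_betw e' {0..<?n} (grp Phi cs)" "\<forall>a<?n. spoly (cs ! e' a) = ?gs ! a"
    using typeII_group_enum[of Phi cs] len by auto
  define d where "d = the_inv_into {0..<?n} e"
  define d' where "d' = the_inv_into {0..<?n} e'"
  have d: "a < ?n \<Longrightarrow> d (e a) = a" for a using e(1) by (simp add: d_def bij_betw_def the_inv_into_f_f)
  have d': "a < ?n \<Longrightarrow> d' (e' a) = a" for a using e'(1) by (simp add: d'_def bij_betw_def the_inv_into_f_f)
  show "\<exists>S. \<forall>i\<in>grp Phi cs. \<forall>j\<in>grp Phi cs. p dvd (\<Sum>l\<in>grp Phi bs. pbar cj (S l i) * spoly (bs ! l) * S l j)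
       - (if i = j then spoly (cs ! i) else 0)"
  proof (intro exI ballI)
    fix i j assume "i \<in> grp Phi cs" "j \<in> grp Phi cs"
    then have "i \<in> e' ` {0..<?n}" "j \<in> e' ` {0..<?n}" using bij_betw_imp_surj_on[OF e'(1)] by auto
    then obtain i' j' where ij: "i = e' i'" "i' < ?n" "j = e' j'" "j' < ?n" by (auto elim!: imageE)
    have eq: "i = j \<longleftrightarrow> i' = j'" using ij d' by metis
    have 1: "(\<Sum>l\<in>grp Phi bs. pbar cj (S $$ (d l, d' i)) * spoly (bs ! l) * S $$ (d l, d' j))
      = (\<Sum>k\<in>{0..<?n}. pbar cj (S $$ (k, i')) * ?fs ! k * S $$ (k, j'))"
      unfolding sum.reindex_bij_betw[OF e(1), symmetric] using d d' e(2) ij by (intro sum.cong) auto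
    have 2: "(if i = j then spoly (cs ! i) else 0) = (if i' = j' then ?gs ! i' else 0)"
      using e'(2) ij eq by auto
    have "p dvd (\<Sum>k\<in>{0..<?n}. pbar cj (S $$ (k, i')) * ?fs ! k * S $$ (k, j')) - (if i' = j' then ?gs ! i' else 0)"
      using S[OF ij(2,4)] by (simp only: atLeast0LessThan)
    then show "p dvd (\<Sum>l\<in>grp Phi bs. pbar cj (S $$ (d l, d' i)) * spoly (bs ! l) * S $$ (d l, d' j))
       - (if i = j then spoly (cs ! i) else 0)" unfolding 1 2 .
  qed
qed

text \<open>The inverse matrix demanded by \<open>herm_equiv\<close> is R = diag(g)^(-1) S^o
  diag(f), which exists because the entries of g are units modulo p.\<close>

lemma herm_equivI:
  assumes card: "card (grp Phi bs) = card (grp Phi cs)"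
    and S: "\<And>i j. i \<in> grp Phi cs \<Longrightarrow> j \<in> grp Phi cs \<Longrightarrow>
      p dvd (\<Sum>l\<in>grp Phi bs. pbar cj (S l i) * spoly (bs ! l) * S l j) - (if i = j then spoly (cs ! i) else 0)"
    and unit: "\<And>i. i \<in> grp Phi cs \<Longrightarrow> \<exists>a. p dvd a * spoly (cs ! i) - 1"
  shows "herm_equiv cj p (typeII_group Phi bs) (typeII_group Phi cs)"
proof -
  let ?fs = "typeII_group Phi bs" and ?gs = "typeII_group Phi cs"
  let ?n = "length ?fs"
  have len: "?n = length ?gs" using card by (simp add: length_typeII_group)
  obtain e where e: "bij_betw e {0..<?n} (grp Phi bs)" "\<forall>a<?n. spoly (bs ! e a) = ?fs ! a"
    using typeII_group_enum[of Phi bs] by blast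
  obtain e' where e': "bij_betw e' {0..<?n} (grp Phi cs)" "\<forall>a<?n. spoly (cs ! e' a) = ?gs ! a"
    using typeII_group_enum[of Phi cs] len by auto
  have e'G: "i < ?n \<Longrightarrow> e' i \<in> grp Phi cs" for i using e'(1) by (auto simp: bij_betw_def)
  have e'inj: "i < ?n \<Longrightarrow> j < ?n \<Longrightarrow> e' i = e' j \<longleftrightarrow> i = j" for i j
    using e'(1) by (auto simp: bij_betw_def inj_on_def)
  have "\<forall>i\<in>grp Phi cs. \<exists>a. p dvd a * spoly (cs ! i) - 1" using unit by blast
  from bchoice[OF this] obtain a where a: "\<And>i. i \<in> grp Phi cs \<Longrightarrow> p dvd a i * spoly (cs ! i) - 1" by blast
  define M where "M = mat ?n ?n (\<lambda>(k,i). S (e k) (e' i))"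
  define R where "R = mat ?n ?n (\<lambda>(i,k). a (e' i) * (pbar cj (S (e k) (e' i)) * ?fs ! k))"
  have cong: "p dvd (\<Sum>k<?n. pbar cj (M $$ (k,i)) * ?fs ! k * M $$ (k,j)) - (if i = j then ?gs ! i else 0)"
    if ij: "i < ?n" "j < ?n" for i j
  proof -
    have "(\<Sum>k<?n. pbar cj (M $$ (k,i)) * ?fs ! k * M $$ (k,j))
        = (\<Sum>k\<in>{0..<?n}. pbar cj (S (e k) (e' i)) * spoly (bs ! e k) * S (e k) (e' j))"
      unfolding atLeast0LessThan using e(2) ij by (intro sum.cong) (auto simp: M_def)
    also have "\<dots> = (\<Sum>l\<in>grp Phi bs. pbar cj (S l (e' i)) * spoly (bs ! l) * S l (e' j))"
      by (rule sum.reindex_bij_betw[OF e(1)])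
    finally have 1: "(\<Sum>k<?n. pbar cj (M $$ (k,i)) * ?fs ! k * M $$ (k,j))
      = (\<Sum>l\<in>grp Phi bs. pbar cj (S l (e' i)) * spoly (bs ! l) * S l (e' j))" .
    have 2: "(if i = j then ?gs ! i else 0) = (if e' i = e' j then spoly (cs ! e' i) else 0)"
      using e'(2) ij e'inj by auto
    show ?thesis unfolding 1 2 by (rule S[OF e'G[OF ij(1)] e'G[OF ij(2)]])
  qed
  have "p dvd ((R * M) $$ (i,j) - (1\<^sub>m ?n) $$ (i,j))" if ij: "i < ?n" "j < ?n" for i j
  proof -
    let ?Y = "\<Sum>k<?n. pbar cj (M $$ (k,i)) * ?fs ! k * M $$ (k,j)"
    have RM: "(R * M) $$ (i,j) = a (e' i) * ?Y"
      using ij by (simp add: R_def M_def scalar_prod_def sum_distrib_left atLeast0LessThan mult.assoc)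
    have "p dvd a (e' i) * (?Y - (if i = j then ?gs ! i else 0)) + (if i = j then a (e' i) * spoly (cs ! e' i) - 1 else 0)"
      using cong[OF ij] a[OF e'G[OF ij(1)]] by (intro dvd_add dvd_mult) auto
    also have "\<dots> = (R * M) $$ (i,j) - (1\<^sub>m ?n) $$ (i,j)"
      unfolding RM using ij e'(2) by (auto simp: algebra_simps)
    finally show ?thesis .
  qed
  moreover have "M \<in> carrier_mat ?n ?n" "R \<in> carrier_mat ?n ?n" by (auto simp: M_def R_def)
  ultimately show ?thesis unfolding herm_equiv_def Let_def using len cong by blast
qed


section \<open>Related summand lists are the frames of one module\<close>

context herm_module
begin

text \<open>For \<open>eps = 1\<close> the polynomial of a type (i) block is not selfconjugate, so
  neither it nor its conjugate can equal chi_Phi; and a type (ii) block with polynomial chi_Phi is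
  Phi.\<close>

lemma gens_of_selfdual_block:
  assumes good: "\<forall>b\<in>set bs. good_summand cj eps b" and Phi: "frobenius_block Phi" "bar (char_poly Phi) = char_poly Phi"
    and e1: "eps = 1"
  shows "{\<alpha> \<in> gens bs. ann cj bs \<alpha> = char_poly Phi} = (\<lambda>i. (i, False)) ` grp Phi bs"
proof (intro subset_antisym subsetI)
  fix \<alpha> assume "\<alpha> \<in> {\<alpha> \<in> gens bs. ann cj bs \<alpha> = char_poly Phi}"
  then obtain i t where a: "\<alpha> = (i,t)" "i < length bs" "t \<in> sgens (bs ! i)" "sann cj (bs ! i) t = char_poly Phi"
    by (auto simp: gens_def ann_def)
  have g: "good_summand cj eps (bs ! i)" using good a(2) by simp
  show "\<alpha> \<in> (\<lambda>i. (i, False)) ` grp Phi bs"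
  proof (cases "bs ! i")
    case (TypeI Psi)
    then have "bar (char_poly Psi) \<noteq> char_poly Psi" using g e1 by simp
    moreover have "char_poly Psi = char_poly Phi"
      using a(4) TypeI Phi(2) by (cases t) (auto simp: bar_eq_iff)
    ultimately show ?thesis using Phi(2) by simp
  next
    case (TypeII Psi f)
    then have "char_poly Psi = char_poly Phi" "frobenius_block Psi" using a(4) g by auto
    then have "Psi = Phi" using Phi(1) unfolding frobenius_block_iff by metis
    then show ?thesis using a TypeII by (auto simp: grp_def)
  qed
qed (auto simp: grp_def gens_def ann_def)

text \<open>For \<open>eps = 1\<close> exactly one of the two generators of a matching type (i)
  summand has annihilator q, and type (ii) has none. For \<open>eps = -1\<close> the involution is
  the identity, so both generators have annihilator q, and there are no type (ii) summands.\<close>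

lemma card_gens_of_block:
  assumes good: "\<forall>b\<in>set bs. good_summand cj eps b" and q: "eps = 1 \<longrightarrow> bar q \<noteq> q"
  shows "card {\<alpha> \<in> gens bs. ann cj bs \<alpha> = q} = (if eps = 1 then 1 else 2) * card (blk cj {q, bar q} bs)"
proof (cases "eps = 1")
  case True
  have nII: "bs ! i = TypeII Psi f \<Longrightarrow> i < length bs \<Longrightarrow> bar (char_poly Psi) = char_poly Psi" for i Psi f
    using good by (metis good_summand.simps(2) nth_mem)
  have nI: "bs ! i = TypeI Psi \<Longrightarrow> i < length bs \<Longrightarrow> bar (char_poly Psi) \<noteq> char_poly Psi" for i Psi
    using good True by (metis good_summand.simps(1) nth_mem)
  have q': "bar q \<noteq> q" using q True by simp
  have "bij_betw fst {\<alpha> \<in> gens bs. ann cj bs \<alpha> = q} (blk cj {q, bar q} bs)"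
  proof (rule bij_betw_imageI)
    show "inj_on fst {\<alpha> \<in> gens bs. ann cj bs \<alpha> = q}"
    proof (rule inj_onI)
      fix \<alpha> \<beta> assume A: "\<alpha> \<in> {\<alpha> \<in> gens bs. ann cj bs \<alpha> = q}" "\<beta> \<in> {\<alpha> \<in> gens bs. ann cj bs \<alpha> = q}" "fst \<alpha> = fst \<beta>"
      obtain i t s where ab: "\<alpha> = (i,t)" "\<beta> = (i,s)" using A(3) by (cases \<alpha>; cases \<beta>) auto
      have i: "i < length bs" "t \<in> sgens (bs ! i)" "s \<in> sgens (bs ! i)" "sann cj (bs ! i) t = q" "sann cj (bs ! i) s = q"
        using A ab by (auto simp: gens_def ann_def)
      show "\<alpha> = \<beta>"
      proof (cases "bs ! i")
        case (TypeI Psi)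
        then show ?thesis using ab i nI[OF TypeI i(1)] by (cases t; cases s) auto
      next
        case (TypeII Psi f)
        then show ?thesis using ab i by simp
      qed
    qed
    show "fst ` {\<alpha> \<in> gens bs. ann cj bs \<alpha> = q} = blk cj {q, bar q} bs"
    proof (intro subset_antisym subsetI)
      fix i assume "i \<in> fst ` {\<alpha> \<in> gens bs. ann cj bs \<alpha> = q}"
      then obtain t where i: "i < length bs" "t \<in> sgens (bs ! i)" "sann cj (bs ! i) t = q"
        by (auto simp: gens_def ann_def)
      show "i \<in> blk cj {q, bar q} bs"
      proof (cases "bs ! i")
        case (TypeI Psi)
        then show ?thesis using i by (cases t) (auto simp: blk_def)
      next
        case (TypeII Psi f)
        then show ?thesis using i nII[OF TypeII i(1)] q' by auto
      qed
    next
      fix i assume "i \<in> blk cj {q, bar q} bs"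
      then obtain Psi where i: "i < length bs" "bs ! i = TypeI Psi" "{char_poly Psi, bar (char_poly Psi)} = {q, bar q}"
        by (auto simp: blk_def)
      then have "char_poly Psi = q \<or> bar (char_poly Psi) = q" by (auto simp: doubleton_eq_iff)
      then have "\<exists>t. (i,t) \<in> {\<alpha> \<in> gens bs. ann cj bs \<alpha> = q}"
      proof
        assume "char_poly Psi = q"
        then show ?thesis using i by (intro exI[of _ False]) (simp add: gens_def ann_def)
      next
        assume "bar (char_poly Psi) = q"
        then show ?thesis using i by (intro exI[of _ True]) (simp add: gens_def ann_def)
      qed
      then show "i \<in> fst ` {\<alpha> \<in> gens bs. ann cj bs \<alpha> = q}" by force
    qed
  qed
  then show ?thesis using True bij_betw_same_card by force
next
  case False
  then have "cj = id" using eps_inv by blast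
  then have bq: "bar f = f" for f by (simp add: pbar_def)
  have "{\<alpha> \<in> gens bs. ann cj bs \<alpha> = q} = blk cj {q, bar q} bs \<times> UNIV"
  proof (intro subset_antisym subsetI)
    fix \<alpha> assume "\<alpha> \<in> {\<alpha> \<in> gens bs. ann cj bs \<alpha> = q}"
    then obtain i t where a: "\<alpha> = (i,t)" "i < length bs" "t \<in> sgens (bs ! i)" "sann cj (bs ! i) t = q"
      by (auto simp: gens_def ann_def)
    have g: "good_summand cj eps (bs ! i)" using good a(2) by simp
    show "\<alpha> \<in> blk cj {q, bar q} bs \<times> UNIV"
    proof (cases "bs ! i")
      case (TypeI Psi)
      then show ?thesis using a bq by (auto simp: blk_def)
    next
      case (TypeII Psi f)
      then show ?thesis using g False by simp
    qed
  qed (auto simp: blk_def gens_def ann_def bq)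
  then show ?thesis using False by (simp add: card_cartesian_product)
qed

text \<open>Counting generators settles type (i). For type (ii) \<open>frame_compare\<close> yields
  mu S^o diag(f) S = mu diag(g) modulo p_Phi, with the same mu on both sides, and mu is prime to
  p_Phi.\<close>

lemma related_of_frames:
  assumes gbs: "\<forall>b\<in>set bs. good_summand cj eps b" and gcs: "\<forall>b\<in>set cs. good_summand cj eps b"
    and mu: "form_units cj eps mu" and x: "sframe W mu bs x" and y: "sframe W mu cs y"
  shows "summands_related cj bs cs"
  unfolding summands_related_def typeI_blocks_eq_iff
proof (intro conjI allI)
  fix X
  have key: "card (blk cj {char_poly Phi, bar (char_poly Phi)} bs) = card (blk cj {char_poly Phi, bar (char_poly Phi)} cs)"
    if "good_summand cj eps (TypeI Phi)" for Phi
  proof -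
    have q: "eps = 1 \<longrightarrow> bar (char_poly Phi) \<noteq> char_poly Phi" "prime_power (char_poly Phi)"
      using that frobenius_block_iff by auto
    have two': "(if eps = 1 then 1 else 2::nat) \<noteq> 0" by simp
    show ?thesis using frame_card_eq[OF x y q(2)]
      unfolding card_gens_of_block[OF gbs q(1)] card_gens_of_block[OF gcs q(1)] by (auto split: if_splits)
  qed
  show "card (blk cj X bs) = card (blk cj X cs)"
  proof (cases "blk cj X bs = {} \<and> blk cj X cs = {}")
    case False
    then obtain Phi where "X = {char_poly Phi, bar (char_poly Phi)}" "TypeI Phi \<in> set bs \<union> set cs"
      unfolding blk_def by (force simp: in_set_conv_nth)
    then show ?thesis using key gbs gcs by blast
  qed simp
next
  fix Phi
  show "herm_equiv cj (p_of Phi) (typeII_group Phi bs) (typeII_group Phi cs)"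
  proof (cases "grp Phi bs = {} \<and> grp Phi cs = {}")
    case True
    then show ?thesis by (intro herm_equivI) auto
  next
    case False
    then obtain f where "TypeII Phi f \<in> set bs \<union> set cs"
      unfolding grp_def by (force simp: in_set_conv_nth)
    then have g: "good_summand cj eps (TypeII Phi f)" using gbs gcs by blast
    then have e1: "eps = 1" and fb: "frobenius_block Phi" and bq: "bar (char_poly Phi) = char_poly Phi" by auto
    obtain k where k: "irreducible (p_of Phi)" "monic (p_of Phi)" "0 < k" "char_poly Phi = p_of Phi ^ k"
      using prime_base_frobenius[OF fb] by blast
    have prime: "prime_elem (p_of Phi)" using field_poly_irreducible_imp_prime k(1) by blast
    have pp: "prime_power (char_poly Phi)" using fb frobenius_block_iff by blast
    note Ib = gens_of_selfdual_block[OF gbs fb bq e1] and Ic = gens_of_selfdual_block[OF gcs fb bq e1]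
    have inj: "inj_on (\<lambda>i::nat. (i, False)) A" for A by (simp add: inj_on_def)
    have card: "card (grp Phi bs) = card (grp Phi cs)"
      using frame_card_eq[OF x y pp] unfolding Ib Ic by (simp add: card_image[OF inj])
    have G: "frame_gens W (gens bs) (ann cj bs) (twin bs) (form eps mu bs) x"
      and G': "frame_gens W (gens cs) (ann cj cs) (twin cs) (form eps mu cs) y"
      using x y unfolding frame_def by auto
    have "\<forall>\<beta>\<in>gens cs. \<exists>s. y \<beta> = comb (gens bs) s x"
      using x frame_gensD(2)[OF G'] unfolding frame_def by blast
    from bchoice[OF this] obtain s where s: "\<And>\<beta>. \<beta> \<in> gens cs \<Longrightarrow> y \<beta> = comb (gens bs) (s \<beta>) x" by blast
    show ?thesis
    proof (rule herm_equivI[OF card])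
      fix i assume i: "i \<in> grp Phi cs"
      then obtain f where f: "cs ! i = TypeII Phi f" "TypeII Phi f \<in> set cs" unfolding grp_def by (force simp: in_set_conv_nth)
      then have "\<not> p_of Phi dvd f" using good_form_unit(1) gcs mu by blast
      then show "\<exists>a. p_of Phi dvd a * spoly (cs ! i) - 1" using irreducible_bezout[OF k(1)] f by simp
      fix j assume j: "j \<in> grp Phi cs"
      have mem: "(l, False) \<in> gens cs" "ann cj cs (l, False) = p_of Phi ^ k" "twin cs (l, False) = (l, False)"
        "form eps mu cs (l, False) = mu Phi * spoly (cs ! l)" if "l \<in> grp Phi cs" for l
        using that by (auto simp: grp_def gens_def ann_def twin_def form_def k(4))
      have mem': "twin bs (l, False) = (l, False)" "form eps mu bs (l, False) = mu Phi * spoly (bs ! l)" if "l \<in> grp Phi bs" for l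
        using that by (auto simp: grp_def twin_def form_def)
      let ?S = "\<lambda>l j. s (j, False) (l, False)"
      let ?Y = "\<Sum>l\<in>grp Phi bs. bar (?S l i) * spoly (bs ! l) * ?S l j"
      have "p_of Phi dvd (\<Sum>\<alpha> | \<alpha> \<in> gens bs \<and> ann cj bs \<alpha> = p_of Phi ^ k.
          bar (s (twin cs (i, False)) (twin bs \<alpha>)) * form eps mu bs \<alpha> * s (j, False) \<alpha>)
        - (if (i, False) = (j, False) then form eps mu cs (j, False) else 0)"
        by (rule frame_compare[OF G G' s k(1-3) mem(1,2)[OF j] mem(1,2)[OF i]])
      also have "(\<Sum>\<alpha> | \<alpha> \<in> gens bs \<and> ann cj bs \<alpha> = p_of Phi ^ k.
          bar (s (twin cs (i, False)) (twin bs \<alpha>)) * form eps mu bs \<alpha> * s (j, False) \<alpha>) = mu Phi * ?Y"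
        unfolding k(4)[symmetric] Ib sum.reindex[OF inj] sum_distrib_left
        by (rule sum.cong) (simp_all add: mem[OF i] mem' mult_ac)
      also have "mu Phi * ?Y - (if (i, False) = (j, False) then form eps mu cs (j, False) else 0)
        = mu Phi * (?Y - (if i = j then spoly (cs ! i) else 0))"
        using mem(4)[OF j] by (auto simp: right_diff_distrib)
      finally have "p_of Phi dvd mu Phi * (?Y - (if i = j then spoly (cs ! i) else 0))" .
      moreover have "\<not> p_of Phi dvd mu Phi" using mu e1 fb bq unfolding form_units_def by blast
      ultimately show "p_of Phi dvd ?Y - (if i = j then spoly (cs ! i) else 0)"
        using prime_elem_dvd_mult_iff[OF prime] by blast
    qed
  qed
qed

text \<open>The new generators are written down and checked by \<open>frame_change\<close>: for type
  (i) they are old generators of a matched block, for type (ii) combinations whose coefficients are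
  the Hensel lifts T of the given Hermitian equivalence.\<close>

lemma frame_of_related:
  assumes gbs: "\<forall>b\<in>set bs. good_summand cj eps b" and gcs: "\<forall>b\<in>set cs. good_summand cj eps b"
    and mu: "form_units cj eps mu" and W: "submodule W" and x: "sframe W mu bs x" and rel: "summands_related cj bs cs"
  shows "\<exists>y. sframe W mu cs y"
proof -
  have cb: "card (blk cj X cs) = card (blk cj X bs)" for X
    using rel unfolding summands_related_def typeI_blocks_eq_iff by simp
  have "\<forall>X. \<exists>f. bij_betw f (blk cj X cs) (blk cj X bs)"
    using cb by (auto intro: finite_same_card_bij)
  \<comment> \<open>One matching of positions for every pair of conjugate polynomials.\<close>
  from choice[OF this] obtain pi where pi: "\<And>X. bij_betw (pi X) (blk cj X cs) (blk cj X bs)" by blast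
  have he: "herm_equiv cj (p_of Phi) (typeII_group Phi bs) (typeII_group Phi cs)" for Phi
    using rel unfolding summands_related_def by blast
  note hi = herm_equiv_index[OF he]
  have "\<forall>Phi. \<exists>T. \<forall>i\<in>grp Phi cs. \<forall>j\<in>grp Phi cs. char_poly Phi dvd
      (\<Sum>l\<in>grp Phi bs. bar (T l i) * spoly (bs ! l) * T l j) - (if i = j then spoly (cs ! i) else 0)"
  proof
    fix Phi
    show "\<exists>T. \<forall>i\<in>grp Phi cs. \<forall>j\<in>grp Phi cs. char_poly Phi dvd
      (\<Sum>l\<in>grp Phi bs. bar (T l i) * spoly (bs ! l) * T l j) - (if i = j then spoly (cs ! i) else 0)"
    proof (cases "grp Phi cs = {}")
      case False
      have gII: "i \<in> grp Phi ds \<Longrightarrow> \<exists>f. ds ! i = TypeII Phi f \<and> TypeII Phi f \<in> set ds" for i ds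
        unfolding grp_def by (force simp: in_set_conv_nth)
      obtain f where g: "good_summand cj eps (TypeII Phi f)" using False gII gcs by blast
      then have fb: "frobenius_block Phi" and bq: "bar (char_poly Phi) = char_poly Phi" by auto
      obtain k where k: "irreducible (p_of Phi)" "monic (p_of Phi)" "0 < k" "char_poly Phi = p_of Phi ^ k"
        using prime_base_frobenius[OF fb] by blast
      obtain S where S: "\<And>i j. i \<in> grp Phi cs \<Longrightarrow> j \<in> grp Phi cs \<Longrightarrow> p_of Phi dvd
        (\<Sum>l\<in>grp Phi bs. bar (S l i) * spoly (bs ! l) * S l j) - (if i = j then spoly (cs ! i) else 0)"
        using hi(2)[of Phi] by blast
      have b1: "bar (spoly (bs ! l)) = spoly (bs ! l)" if l: "l \<in> grp Phi bs" for l
        using gII[OF l] gbs by auto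
      have b2: "bar (spoly (cs ! i)) = spoly (cs ! i)" "\<not> p_of Phi dvd spoly (cs ! i)" if i: "i \<in> grp Phi cs" for i
      proof -
        obtain f where f: "cs ! i = TypeII Phi f" "good_summand cj eps (TypeII Phi f)" using gII[OF i] gcs by blast
        then show "bar (spoly (cs ! i)) = spoly (cs ! i)" "\<not> p_of Phi dvd spoly (cs ! i)"
          using good_form_unit(1)[OF f(2) mu] by auto
      qed
      show ?thesis unfolding k(4)
        using hermitian_hensel[OF two k(1) p_of_bar[OF fb bq] finite_grp finite_grp b1 b2(1) b2(2) S, where a = k] by blast
    qed simp
  qed
  from choice[OF this] obtain T where T: "\<And>Phi i j. i \<in> grp Phi cs \<Longrightarrow> j \<in> grp Phi cs \<Longrightarrow> char_poly Phi dvd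
      (\<Sum>l\<in>grp Phi bs. bar (T Phi l i) * spoly (bs ! l) * T Phi l j) - (if i = j then spoly (cs ! i) else 0)" by blast
  let ?X = "\<lambda>Psi. {char_poly Psi, bar (char_poly Psi)}"
  \<comment> \<open>A block and its match have equal or conjugate polynomials. In the second case
    the roles of the two generators are exchanged, so that annihilators correspond.\<close>
  define flip where "flip i Psi u = (if sann cj (bs ! i) False = char_poly Psi then u else \<not> u)" for i Psi u
  define s where "s = (\<lambda>(j,u) (i,t). case cs ! j of
      TypeI Psi \<Rightarrow> if i = pi (?X Psi) j \<and> t = flip i Psi u then 1 else 0
    | TypeII Psi g \<Rightarrow> if i \<in> grp Psi bs then T Psi i j else 0)"
  have typeI: "\<exists>Phi. bs ! (pi (?X Psi) j) = TypeI Phi \<and> pi (?X Psi) j < length bs \<and> ?X Phi = ?X Psi"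
    if "j < length cs" "cs ! j = TypeI Psi" for j Psi
  proof -
    have "j \<in> blk cj (?X Psi) cs" using that by (auto simp: blk_def)
    then have "pi (?X Psi) j \<in> blk cj (?X Psi) bs" using bij_betwE[OF pi] by blast
    then show ?thesis by (auto simp: blk_def)
  qed
  have supp: "ann cj bs \<alpha> = ann cj cs \<beta>" if \<beta>: "\<beta> \<in> gens cs" and \<alpha>: "\<alpha> \<in> gens bs" and nz: "s \<beta> \<alpha> \<noteq> 0" for \<alpha> \<beta>
  proof -
    obtain j u i t where ji: "\<beta> = (j,u)" "\<alpha> = (i,t)" "j < length cs" "u \<in> sgens (cs ! j)" "i < length bs" "t \<in> sgens (bs ! i)"
      using \<beta> \<alpha> by (auto simp: gens_def)
    show ?thesis
    proof (cases "cs ! j")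
      case (TypeI Psi)
      then have i: "i = pi (?X Psi) j" "t = flip i Psi u" using nz ji by (auto simp: s_def split: if_splits)
      obtain Phi where Phi: "bs ! i = TypeI Phi" "?X Phi = ?X Psi" using typeI[OF ji(3) TypeI] i by blast
      show ?thesis using Phi TypeI ji i(2) by (auto simp: ann_def flip_def doubleton_eq_iff)
    next
      case (TypeII Psi g)
      then have "i \<in> grp Psi bs" using nz ji by (auto simp: s_def split: if_splits)
      then show ?thesis using TypeII ji by (auto simp: grp_def ann_def)
    qed
  qed
  have "frame W (gens cs) (ann cj cs) (twin cs) (form eps mu cs) (\<lambda>\<beta>. comb (gens bs) (s \<beta>) x)"
  proof (rule frame_change[OF W x good_frame_data_list[OF gcs mu]])
    show "ann cj bs \<alpha> = ann cj cs \<beta>" if "\<beta> \<in> gens cs" "\<alpha> \<in> gens bs" "s \<beta> \<alpha> \<noteq> 0" for \<alpha> \<beta>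
      by (rule supp[OF that])
    show "card {\<alpha> \<in> gens bs. ann cj bs \<alpha> = q} = card {\<beta> \<in> gens cs. ann cj cs \<beta> = q}" if q: "prime_power q" for q
    proof (cases "eps = 1 \<and> bar q = q")
      case True
      \<comment> \<open>A selfconjugate q belongs to one Frobenius block only, its companion matrix,
        and equality of the group sizes for that block is part of \<open>herm_equiv\<close>.\<close>
      have chi: "char_poly (companion q) = q" using char_poly_companion prime_powerD[OF q] by blast
      have fb: "frobenius_block (companion q)" using q by (simp add: frobenius_block_iff chi)
      have bq: "bar (char_poly (companion q)) = char_poly (companion q)" using True chi by simp
      have inj: "inj_on (\<lambda>i::nat. (i, False)) A" for A by (simp add: inj_on_def)
      have e1: "eps = 1" using True by simp
      show ?thesis
        using gens_of_selfdual_block[OF gbs fb bq e1] gens_of_selfdual_block[OF gcs fb bq e1] hi(1)[of "companion q"]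
        unfolding chi by (simp add: card_image[OF inj])
    next
      case False
      then have q': "eps = 1 \<longrightarrow> bar q \<noteq> q" by simp
      show ?thesis unfolding card_gens_of_block[OF gbs q'] card_gens_of_block[OF gcs q'] by (simp add: cb)
    qed
    fix \<beta> \<beta>' assume \<beta>: "\<beta> \<in> gens cs" "\<beta>' \<in> gens cs" "ann cj cs \<beta> = ann cj cs \<beta>'"
    let ?I = "{\<alpha> \<in> gens bs. ann cj bs \<alpha> = ann cj cs \<beta>}"
    let ?Y = "\<Sum>\<alpha>\<in>?I. bar (s (twin cs \<beta>') (twin bs \<alpha>)) * form eps mu bs \<alpha> * s \<beta> \<alpha>"
    obtain j u j' u' where ju: "\<beta> = (j,u)" "\<beta>' = (j',u')" "j < length cs" "u \<in> sgens (cs ! j)" "j' < length cs" "u' \<in> sgens (cs ! j')"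
      using \<beta> by (auto simp: gens_def)
    show "ann cj cs \<beta> dvd ?Y - (if \<beta>' = \<beta> then form eps mu cs \<beta> else 0)"
    proof (cases "cs ! j")
      case (TypeI Psi)
      define i0 where "i0 = pi (?X Psi) j"
      define t0 where "t0 = flip i0 Psi u"
      obtain Phi where Phi: "bs ! i0 = TypeI Phi" "i0 < length bs" "?X Phi = ?X Psi" using typeI[OF ju(3) TypeI] i0_def by blast
      have a0: "(i0,t0) \<in> gens bs" using Phi by (simp add: gens_def)
      have s1: "s \<beta> \<alpha> = (if \<alpha> = (i0,t0) then 1 else 0)" for \<alpha>
        using TypeI by (cases \<alpha>) (auto simp: s_def ju i0_def t0_def)
      have I0: "(i0,t0) \<in> ?I" using a0 supp[OF \<beta>(1) a0] s1 by simp
      have "?Y = (\<Sum>\<alpha>\<in>?I. if \<alpha> = (i0,t0) then bar (s (twin cs \<beta>') (twin bs (i0,t0))) * form eps mu bs (i0,t0) else 0)"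
        by (rule sum.cong) (auto simp: s1)
      also have "\<dots> = bar (s (twin cs \<beta>') (twin bs (i0,t0))) * form eps mu bs (i0,t0)" using I0 by simp
      finally have Y: "?Y = bar (s (twin cs \<beta>') (i0, \<not> t0)) * form eps mu bs (i0,t0)" using Phi by (simp add: twin_def)
      have "s (twin cs \<beta>') (i0, \<not> t0) = (if \<beta>' = \<beta> then 1 else 0)"
      proof (cases "cs ! j'")
        case (TypeII Psi' g)
        then have "\<beta>' \<noteq> \<beta>" using ju TypeI by auto
        moreover have "i0 \<notin> grp Psi' bs" using Phi by (simp add: grp_def)
        ultimately show ?thesis using TypeII ju by (simp add: s_def twin_def)
      next
        case TypeI': (TypeI Psi')
        have sv: "s (twin cs \<beta>') (i0, \<not> t0) = (if i0 = pi (?X Psi') j' \<and> (\<not> t0) = flip i0 Psi' (\<not> u') then 1 else 0)"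
          using TypeI' ju by (simp add: s_def twin_def)
        have "i0 = pi (?X Psi') j' \<and> (\<not> t0) = flip i0 Psi' (\<not> u') \<longleftrightarrow> \<beta>' = \<beta>"
        proof
          assume *: "i0 = pi (?X Psi') j' \<and> (\<not> t0) = flip i0 Psi' (\<not> u')"
          then have XX: "?X Psi' = ?X Psi" using typeI[OF ju(5) TypeI'] Phi by auto
          have jb: "j \<in> blk cj (?X Psi) cs" "j' \<in> blk cj (?X Psi) cs"
            using ju TypeI TypeI' XX by (auto simp: blk_def)
          have "pi (?X Psi) j = pi (?X Psi) j'" using * XX i0_def by metis
          then have jj: "j = j'" using jb bij_betw_imp_inj_on[OF pi] by (metis inj_onD)
          then have "Psi' = Psi" using TypeI TypeI' by simp
          then have "u' = u" using * by (auto simp: t0_def flip_def split: if_splits)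
          then show "\<beta>' = \<beta>" using jj ju by simp
        next
          assume "\<beta>' = \<beta>"
          then have "Psi' = Psi" "j' = j" "u' = u" using ju TypeI TypeI' by auto
          then show "i0 = pi (?X Psi') j' \<and> (\<not> t0) = flip i0 Psi' (\<not> u')"
            by (auto simp: i0_def t0_def flip_def)
        qed
        then show ?thesis unfolding sv by simp
      qed
      \<comment> \<open>Exchanging generators interchanges the forms 1 and eps. It happens only if
        the polynomial differs from its conjugate; then the involution is not the identity, and eps
        is 1.\<close>
      moreover have "form eps mu bs (i0,t0) = form eps mu cs \<beta>"
      proof (cases "t0 = u")
        case True
        then show ?thesis using Phi TypeI ju by (simp add: form_def)
      next
        case False
        then have "char_poly Phi \<noteq> char_poly Psi" using Phi by (auto simp: t0_def flip_def)
        then have "char_poly Phi = bar (char_poly Psi)" "bar (char_poly Psi) \<noteq> char_poly Psi"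
          using Phi(3) by (auto simp: doubleton_eq_iff)
        then have "cj \<noteq> id" by (auto simp: pbar_def)
        then have "eps = 1" using eps_inv by blast
        then show ?thesis using Phi TypeI ju by (simp add: form_def one_pCons)
      qed
      ultimately have "?Y = (if \<beta>' = \<beta> then form eps mu cs \<beta> else 0)" unfolding Y by simp
      then show ?thesis by simp
    next
      case (TypeII Psi g)
      then have good: "good_summand cj eps (TypeII Psi g)" using gcs ju by (metis nth_mem)
      then have e1: "eps = 1" and fb: "frobenius_block Psi" and bq: "bar (char_poly Psi) = char_poly Psi" by auto
      have inj: "inj_on (\<lambda>i::nat. (i, False)) A" for A by (simp add: inj_on_def)
      have ann: "ann cj cs \<beta> = char_poly Psi" using TypeII ju by (simp add: ann_def)
      have "\<beta> \<in> (\<lambda>i. (i, False)) ` grp Psi cs" "\<beta>' \<in> (\<lambda>i. (i, False)) ` grp Psi cs"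
        unfolding gens_of_selfdual_block[OF gcs fb bq e1, symmetric] using \<beta> ann by auto
      then have jj: "j \<in> grp Psi cs" "j' \<in> grp Psi cs" "u = False" "u' = False" using ju by auto
      obtain g' where g': "cs ! j' = TypeII Psi g'" using jj(2) by (auto simp: grp_def)
      let ?Z = "\<Sum>l\<in>grp Psi bs. bar (T Psi l j') * spoly (bs ! l) * T Psi l j"
      have "?Y = mu Psi * ?Z"
        unfolding ann gens_of_selfdual_block[OF gbs fb bq e1] sum.reindex[OF inj] sum_distrib_left
      proof (rule sum.cong)
        fix l assume l: "l \<in> grp Psi bs"
        then have "twin bs (l, False) = (l, False)" "form eps mu bs (l, False) = mu Psi * spoly (bs ! l)"
          by (auto simp: grp_def twin_def form_def)
        moreover have "twin cs \<beta>' = \<beta>'" using g' jj ju by (simp add: twin_def)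
        moreover have "s \<beta>' (l, False) = T Psi l j'" "s \<beta> (l, False) = T Psi l j"
          using l g' TypeII ju by (auto simp: s_def)
        ultimately show "((\<lambda>\<alpha>. bar (s (twin cs \<beta>') (twin bs \<alpha>)) * form eps mu bs \<alpha> * s \<beta> \<alpha>) \<circ> (\<lambda>i. (i, False))) l
            = mu Psi * (bar (T Psi l j') * spoly (bs ! l) * T Psi l j)"
          by (simp add: mult_ac)
      qed simp
      moreover have "(if \<beta>' = \<beta> then form eps mu cs \<beta> else 0) = mu Psi * (if j' = j then spoly (cs ! j') else 0)"
        using ju jj TypeII by (auto simp: form_def)
      ultimately have eq: "?Y - (if \<beta>' = \<beta> then form eps mu cs \<beta> else 0) = mu Psi * (?Z - (if j' = j then spoly (cs ! j') else 0))"
        by (simp only: right_diff_distrib)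
      have "char_poly Psi dvd mu Psi * (?Z - (if j' = j then spoly (cs ! j') else 0))"
        using T[OF jj(2,1)] by (rule dvd_mult)
      then show ?thesis unfolding eq by (simp only: ann)
    qed
  qed
  then show ?thesis by blast
qed

end


section \<open>Matrix pairs as modules of vectors\<close>

text \<open>Vectors of all lengths live in one type: a vector of length n is a function vanishing from n on.\<close>

definition fin_vecs :: "nat \<Rightarrow> (nat \<Rightarrow> 'a::zero) set" where
  "fin_vecs n = {v. \<forall>i\<ge>n. v i = 0}"

definition stdv :: "nat \<Rightarrow> nat \<Rightarrow> 'a::{zero,one}" where
  "stdv j = (\<lambda>i. if i = j then 1 else 0)"

definition scale :: "'a::times \<Rightarrow> (nat \<Rightarrow> 'a) \<Rightarrow> nat \<Rightarrow> 'a" where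
  "scale a v = (\<lambda>i. a * v i)"

definition mat_act :: "'a::field mat \<Rightarrow> (nat \<Rightarrow> 'a) \<Rightarrow> nat \<Rightarrow> 'a" where
  "mat_act A v = (\<lambda>i. if i < dim_row A then \<Sum>j<dim_col A. A $$ (i,j) * v j else 0)"

text \<open>Horner's scheme on vectors: recursion over \<open>pCons\<close> yields the module laws
  by induction. Constants scale the whole function, also outside \<open>fin_vecs n\<close>, so that
  1 acts as the identity on the entire type, as \<open>herm_module\<close> requires.\<close>

definition poly_act :: "'a::field mat \<Rightarrow> 'a poly \<Rightarrow> (nat \<Rightarrow> 'a) \<Rightarrow> nat \<Rightarrow> 'a" where
  "poly_act A f v = fold_coeffs (\<lambda>a w. scale a v + mat_act A w) f 0"

definition pairing :: "('a \<Rightarrow> 'a) \<Rightarrow> nat \<Rightarrow> (nat \<Rightarrow> 'a::field) \<Rightarrow> (nat \<Rightarrow> 'a) \<Rightarrow> 'a" where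
  "pairing cj n u w = (\<Sum>i<n. cj (u i) * w i)"

definition mat_form :: "('a \<Rightarrow> 'a) \<Rightarrow> 'a::field mat \<Rightarrow> (nat \<Rightarrow> 'a) \<Rightarrow> (nat \<Rightarrow> 'a) \<Rightarrow> 'a" where
  "mat_form cj F u v = pairing cj (dim_row F) u (mat_act F v)"

lemma scale_simps [simp]: "scale a (0::nat \<Rightarrow> 'a::field) = 0" "scale (0::'a) v = 0" "scale 1 v = v"
  "scale a (scale b v) = scale (a * b) v"
  by (auto simp: scale_def fun_eq_iff)
lemma scale_apply: "scale a v i = a * v i" by (simp add: scale_def)
lemma scale_add: "scale a (u + v :: nat \<Rightarrow> 'a::field) = scale a u + scale a v"
  "scale (a + b) v = scale a v + scale b v"
  by (auto simp: scale_def fun_eq_iff algebra_simps)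

lemma mat_act_0 [simp]: "mat_act A 0 = 0" by (auto simp: mat_act_def fun_eq_iff)
lemma mat_act_add: "mat_act A (u + v) = mat_act A u + mat_act A v"
  by (auto simp: mat_act_def fun_eq_iff sum.distrib algebra_simps)
lemma mat_act_scale: "mat_act A (scale a v) = scale a (mat_act A v)"
  by (auto simp: mat_act_def fun_eq_iff sum_distrib_left mult.left_commute scale_apply)
lemma mat_act_in: "A \<in> carrier_mat n m \<Longrightarrow> mat_act A v \<in> fin_vecs n"
  by (auto simp: mat_act_def fin_vecs_def)
lemma mat_act_cong: "(\<And>j. j < dim_col A \<Longrightarrow> u j = v j) \<Longrightarrow> mat_act A u = mat_act A v"
  by (auto simp: mat_act_def fun_eq_iff)
lemma mat_act_mult:
  assumes "A \<in> carrier_mat n m" "B \<in> carrier_mat m k"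
  shows "mat_act (A * B) v = mat_act A (mat_act B v)"
proof
  fix i
  show "mat_act (A * B) v i = mat_act A (mat_act B v) i"
  proof (cases "i < n")
    case True
    have "mat_act (A * B) v i = (\<Sum>j<k. (\<Sum>l<m. A $$ (i,l) * B $$ (l,j)) * v j)"
      using assms True by (simp add: mat_act_def scalar_prod_def atLeast0LessThan)
    also have "\<dots> = (\<Sum>l<m. A $$ (i,l) * (\<Sum>j<k. B $$ (l,j) * v j))"
      unfolding sum_distrib_left sum_distrib_right by (subst sum.swap) (simp add: mult.assoc)
    also have "\<dots> = mat_act A (mat_act B v) i"
      using assms True by (auto simp: mat_act_def intro!: sum.cong)
    finally show ?thesis .
  qed (use assms in \<open>simp add: mat_act_def\<close>)
qed
lemma mat_act_one: "mat_act (1\<^sub>m n) v = (\<lambda>i. if i < n then v i else 0)"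
  by (auto simp: mat_act_def fun_eq_iff one_mat_def if_distrib[of "\<lambda>x. x * _"] cong: if_cong)
lemma mat_act_one_fin: "v \<in> fin_vecs n \<Longrightarrow> mat_act (1\<^sub>m n) v = v"
  by (auto simp: mat_act_one fin_vecs_def fun_eq_iff)
lemma mat_act_smult: "mat_act (a \<cdot>\<^sub>m A) v = scale a (mat_act A v)"
  by (auto simp: mat_act_def fun_eq_iff sum_distrib_left mult.assoc scale_apply)
lemma mat_act_stdv: "A \<in> carrier_mat n m \<Longrightarrow> i < n \<Longrightarrow> j < m \<Longrightarrow> mat_act A (stdv j) i = A $$ (i,j)"
  by (simp add: mat_act_def stdv_def if_distrib cong: if_cong)
lemma stdv_in: "j < n \<Longrightarrow> stdv j \<in> fin_vecs n" by (auto simp: stdv_def fin_vecs_def)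

lemma fin_vecs_expand:
  assumes "v \<in> fin_vecs n"
  shows "v = (\<Sum>j<n. scale (v j) (stdv j :: nat \<Rightarrow> 'a::field))"
proof
  fix i
  have sa: "(\<Sum>j\<in>A. F j) i = (\<Sum>j\<in>A. F j i)" for F :: "nat \<Rightarrow> nat \<Rightarrow> 'a" and A
    by (induction A rule: infinite_finite_induct) auto
  have "(\<Sum>j<n. scale (v j) (stdv j :: nat \<Rightarrow> 'a)) i = (\<Sum>j<n. if i = j then v j else 0)"
    unfolding sa by (rule sum.cong) (auto simp: stdv_def scale_apply)
  also have "\<dots> = v i" using assms by (auto simp: fin_vecs_def)
  finally show "v i = (\<Sum>j<n. scale (v j) (stdv j :: nat \<Rightarrow> 'a)) i" by simp
qed

lemma poly_act_0 [simp]: "poly_act A 0 v = 0" by (simp add: poly_act_def)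
lemma poly_act_pCons: "poly_act A (pCons a f) v = scale a v + mat_act A (poly_act A f v)"
  by (cases "a = 0 \<and> f = 0") (auto simp: poly_act_def fold_coeffs_pCons_not_0_0_eq fold_coeffs_pCons_coeff_not_0_eq)

lemma poly_act_add: "poly_act A f (u + v) = poly_act A f u + poly_act A f v"
  by (induction f) (simp_all only: poly_act_0 poly_act_pCons scale_add mat_act_add add_ac add_0_left)
lemma add_poly_act: "poly_act A (f + g) v = poly_act A f v + poly_act A g v"
proof (induction f arbitrary: g)
  case 0
  then show ?case by simp
next
  case (pCons a f)
  show ?case by (cases g, simp only: add_pCons poly_act_pCons pCons scale_add mat_act_add, simp only: add_ac)
qed
lemma poly_act_smult: "poly_act A (Polynomial.smult a f) v = scale a (poly_act A f v)"
  by (induction f) (simp_all only: poly_act_0 poly_act_pCons smult_0_right smult_pCons scale_add mat_act_scale scale_simps)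
lemma poly_act_mat: "poly_act A f (mat_act A v) = mat_act A (poly_act A f v)"
  by (induction f) (simp_all only: poly_act_0 poly_act_pCons mat_act_add mat_act_scale mat_act_0)
lemma poly_act_mult: "poly_act A (f * g) v = poly_act A f (poly_act A g v)"
  by (induction f) (auto simp: poly_act_pCons add_poly_act poly_act_smult)
lemma poly_act_const: "poly_act A [:a:] v = scale a v" by (simp add: poly_act_pCons)
lemma poly_act_1: "poly_act A 1 v = v" by (simp add: one_pCons poly_act_const)
lemma poly_act_in: "A \<in> carrier_mat n n \<Longrightarrow> v \<in> fin_vecs n \<Longrightarrow> poly_act A f v \<in> fin_vecs n"
proof (induction f)
  case (pCons a f)
  then show ?case using mat_act_in[OF pCons.prems(1), of "poly_act A f v"]
    by (auto simp: poly_act_pCons fin_vecs_def scale_apply)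
qed (simp add: fin_vecs_def)

lemma poly_act_intertwine:
  assumes "\<And>v. mat_act A (mat_act S v) = mat_act S (mat_act B v)"
  shows "poly_act A f (mat_act S v) = mat_act S (poly_act B f v)"
  by (induction f) (simp_all only: poly_act_0 poly_act_pCons mat_act_add mat_act_scale mat_act_0 assms)

context involution
begin

lemma pairing_add: "pairing cj n u (v + w) = pairing cj n u v + pairing cj n u w"
  by (simp add: pairing_def sum.distrib algebra_simps)
lemma pairing_scale: "pairing cj n u (scale a w) = a * pairing cj n u w"
  by (simp add: pairing_def sum_distrib_left mult.left_commute scale_apply)
lemma pairing_sym: "cj (pairing cj n u w) = pairing cj n w u"
  by (simp add: pairing_def cj_sum cj_mult mult.commute)
lemma pairing_adjoint:
  assumes S: "S \<in> carrier_mat n m"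
  shows "pairing cj m u (mat_act (cstar cj S) w) = pairing cj n (mat_act S u) w"
proof -
  have "pairing cj m u (mat_act (cstar cj S) w) = (\<Sum>i<m. \<Sum>k<n. cj (u i) * (cj (S $$ (k,i)) * w k))"
    using S by (simp add: pairing_def mat_act_def cstar_def sum_distrib_left)
  also have "\<dots> = (\<Sum>k<n. \<Sum>i<m. cj (S $$ (k,i) * u i) * w k)"
    by (subst sum.swap) (simp add: cj_mult mult_ac)
  also have "\<dots> = pairing cj n (mat_act S u) w"
    using S by (simp add: pairing_def mat_act_def cj_sum sum_distrib_right)
  finally show ?thesis .
qed
lemma pairing_cong: "(\<And>i. i < n \<Longrightarrow> u i = u' i) \<Longrightarrow> (\<And>i. i < n \<Longrightarrow> v i = v' i) \<Longrightarrow> pairing cj n u v = pairing cj n u' v'"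
  by (simp add: pairing_def)
lemma pairing_stdv: "i < n \<Longrightarrow> pairing cj n (stdv i) w = w i"
proof -
  assume "i < n"
  have "pairing cj n (stdv i) w = (\<Sum>k<n. if k = i then w k else 0)"
    unfolding pairing_def by (rule sum.cong) (auto simp: stdv_def)
  then show ?thesis using \<open>i < n\<close> by simp
qed

lemma mat_form_add: "mat_form cj F u (v + w) = mat_form cj F u v + mat_form cj F u w"
  by (simp add: mat_form_def mat_act_add pairing_add)
lemma mat_form_scale: "mat_form cj F u (scale a w) = a * mat_form cj F u w"
  by (simp add: mat_form_def mat_act_scale pairing_scale)

lemma cstar_carrier: "A \<in> carrier_mat n m \<Longrightarrow> cstar cj A \<in> carrier_mat m n"
  by (auto simp: cstar_def)

lemma mat_form_congruence:
  assumes "F \<in> carrier_mat n n" "S \<in> carrier_mat n m"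
  shows "mat_form cj (cstar cj S * F * S) u v = mat_form cj F (mat_act S u) (mat_act S v)"
proof -
  note c = cstar_carrier[OF assms(2)]
  have "mat_act (cstar cj S * F * S) v = mat_act (cstar cj S) (mat_act F (mat_act S v))"
    by (simp only: mat_act_mult[OF mult_carrier_mat[OF c assms(1)] assms(2)] mat_act_mult[OF c assms(1)])
  then show ?thesis using assms c by (simp add: mat_form_def pairing_adjoint)
qed

lemma mat_form_stdv: "F \<in> carrier_mat n n \<Longrightarrow> i < n \<Longrightarrow> j < n \<Longrightarrow> mat_form cj F (stdv i) (stdv j) = F $$ (i,j)"
  by (simp add: mat_form_def pairing_stdv mat_act_stdv)

end

section \<open>Selfadjoint matrix pairs and their frames\<close>

locale herm_setting = involution cj for cj :: "'a::field \<Rightarrow> 'a" +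
  fixes eps :: 'a
  assumes two: "(2::'a) \<noteq> 0" and eps: "eps = 1 \<or> eps = -1" and eps_inv: "cj \<noteq> id \<longrightarrow> eps = 1"
begin

lemma eps2: "eps * (eps * y) = y" using eps by auto

text \<open>Symmetry and selfadjointness are stated for arbitrary functions, as in
  \<open>herm_module\<close>; the form of an n by n matrix sees only the first n entries.
  Nondegeneracy makes sense only on \<open>fin_vecs n\<close>.\<close>

definition herm_pair :: "nat \<Rightarrow> 'a mat \<Rightarrow> 'a mat \<Rightarrow> bool" where
  "herm_pair n A F \<longleftrightarrow> A \<in> carrier_mat n n \<and> F \<in> carrier_mat n n
     \<and> (\<forall>u v. mat_form cj F v u = eps * cj (mat_form cj F u v))
     \<and> (\<forall>u v. mat_form cj F (mat_act A u) v = mat_form cj F u (mat_act A v))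
     \<and> (\<forall>u\<in>fin_vecs n. (\<forall>w\<in>fin_vecs n. mat_form cj F w u = 0) \<longrightarrow> u = 0)"

lemma herm_pairI:
  assumes A: "A \<in> carrier_mat n n" and F: "F \<in> carrier_mat n n" and d: "det F \<noteq> 0"
    and sym: "cstar cj F = eps \<cdot>\<^sub>m F" and adj: "F * A = cstar cj A * F"
  shows "herm_pair n A F"
  unfolding herm_pair_def
proof (intro conjI allI ballI impI)
  fix u v
  have "cj (mat_form cj F u v) = pairing cj n (mat_act F v) u" using F by (simp add: mat_form_def pairing_sym)
  also have "\<dots> = pairing cj n v (mat_act (cstar cj F) u)" by (rule pairing_adjoint[OF F, symmetric])
  also have "\<dots> = eps * mat_form cj F v u" using F by (simp add: sym mat_act_smult pairing_scale mat_form_def)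
  finally show "mat_form cj F v u = eps * cj (mat_form cj F u v)" by (simp add: eps2)
  have "mat_form cj F (mat_act A u) v = pairing cj n u (mat_act (cstar cj A) (mat_act F v))"
    using F by (simp add: mat_form_def pairing_adjoint[OF A])
  also have "\<dots> = pairing cj n u (mat_act F (mat_act A v))"
    by (simp add: mat_act_mult[OF cstar_carrier[OF A] F, symmetric] mat_act_mult[OF F A, symmetric] adj)
  finally show "mat_form cj F (mat_act A u) v = mat_form cj F u (mat_act A v)" using F by (simp add: mat_form_def)
next
  fix u assume u: "u \<in> fin_vecs n" "\<forall>w\<in>fin_vecs n. mat_form cj F w u = 0"
  have "mat_act F u i = 0" if "i < n" for i
    using u(2) stdv_in[OF that] F that by (auto simp: mat_form_def pairing_stdv)
  then have "mat_act F u = 0" using mat_act_in[OF F, of u] by (auto simp: fin_vecs_def fun_eq_iff) (metis not_le)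
  moreover have "mat_act (adj_mat F) (mat_act F u) = scale (det F) u"
    by (simp add: mat_act_mult[OF adj_mat(1)[OF F] F, symmetric] adj_mat(3)[OF F] mat_act_smult mat_act_one_fin[OF u(1)])
  ultimately have "scale (det F) u = 0" by simp
  then show "u = 0" using d by (auto simp: fun_eq_iff scale_apply)
qed (use A F in auto)

lemma herm_pair_module: "herm_pair n A F \<Longrightarrow> herm_module cj eps (poly_act A) (mat_form cj F)"
proof
  assume H: "herm_pair n A F"
  show "(2::'a) \<noteq> 0" "eps = 1 \<or> eps = -1" "cj \<noteq> id \<longrightarrow> eps = 1" using two eps eps_inv by auto
  show "poly_act A f (u + v) = poly_act A f u + poly_act A f v" for f u v by (rule poly_act_add)
  show "poly_act A (f + g) v = poly_act A f v + poly_act A g v" for f g v by (rule add_poly_act)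
  show "poly_act A (f * g) v = poly_act A f (poly_act A g v)" for f g v by (rule poly_act_mult)
  show "poly_act A 1 v = v" for v by (rule poly_act_1)
  show "mat_form cj F u (v + w) = mat_form cj F u v + mat_form cj F u w" for u v w by (rule mat_form_add)
  show "mat_form cj F u (poly_act A [:a:] v) = a * mat_form cj F u v" for u v a
    by (simp add: poly_act_const mat_form_scale)
  show sym: "mat_form cj F v u = eps * cj (mat_form cj F u v)" for u v using H unfolding herm_pair_def by blast
  have adj: "mat_form cj F (mat_act A u) v = mat_form cj F u (mat_act A v)" for u v using H unfolding herm_pair_def by blast
  have addl: "mat_form cj F (u + v) w = mat_form cj F u w + mat_form cj F v w" for u v w
    using sym[of "u + v" w] sym[of u w] sym[of v w] by (simp add: mat_form_add cj_add algebra_simps)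
  have cjeps: "cj eps = eps" using eps by (auto simp: cj_minus)
  have scl: "mat_form cj F (scale a u) w = cj a * mat_form cj F u w" for a u w
    using sym[of "scale a u" w] sym[of u w] by (simp add: mat_form_scale cj_mult)
  show "mat_form cj F (poly_act A f u) v = mat_form cj F u (poly_act A (bar f) v)" for f u v
  proof (induction f arbitrary: v)
    case 0
    have "mat_form cj F 0 v = 0" using scl[of 0 0 v] by simp
    moreover have "mat_form cj F u 0 = 0" using mat_form_scale[of F u 0 0] by simp
    ultimately show ?case by (simp only: poly_act_0 bar_0)
  next
    case (pCons a f)
    then show ?case
      by (simp only: poly_act_pCons bar_pCons addl scl adj mat_form_add mat_form_scale poly_act_mat)
  qed
qed

lemma fin_vecs_submodule:
  assumes "herm_pair n A F"
  shows "herm_module.submodule (poly_act A) (fin_vecs n)" "herm_module.nondegenerate (mat_form cj F) (fin_vecs n)"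
proof -
  interpret herm_module cj eps "poly_act A" "mat_form cj F" by (rule herm_pair_module[OF assms])
  have A: "A \<in> carrier_mat n n" using assms unfolding herm_pair_def by blast
  show "submodule (fin_vecs n)" unfolding submodule_def using poly_act_in[OF A] by (auto simp: fin_vecs_def)
  show "nondegenerate (fin_vecs n)" unfolding nondegenerate_def using assms unfolding herm_pair_def by blast
qed

abbreviation pframe :: "nat \<Rightarrow> 'a mat \<times> 'a mat \<Rightarrow> ('a mat \<Rightarrow> 'a poly) \<Rightarrow> 'a summand list \<Rightarrow> (nat \<times> bool \<Rightarrow> nat \<Rightarrow> 'a) \<Rightarrow> bool" where
  "pframe n P mu bs x \<equiv> herm_module.frame cj (poly_act (fst P)) (mat_form cj (snd P)) (fin_vecs n)
     (gens bs) (ann cj bs) (twin bs) (form eps mu bs) x"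

lemma pframe_exists:
  assumes H: "herm_pair n A F" and mu: "form_units cj eps mu"
  shows "\<exists>bs x. (\<forall>b\<in>set bs. good_summand cj eps b) \<and> pframe n (A, F) mu bs x"
proof -
  interpret herm_module cj eps "poly_act A" "mat_form cj F" by (rule herm_pair_module[OF H])
  have "\<exists>u. w = (\<Sum>t\<in>stdv ` {..<n}. poly_act A [:u t:] t)" if w: "w \<in> fin_vecs n" for w
  proof -
    have inj: "inj_on (stdv :: nat \<Rightarrow> nat \<Rightarrow> 'a) {..<n}"
      unfolding inj_on_def stdv_def by (metis zero_neq_one)
    let ?u = "\<lambda>t. w (the_inv_into {..<n} stdv t)"
    have "(\<Sum>t\<in>stdv ` {..<n}. poly_act A [:?u t:] t) = (\<Sum>j<n. scale (w j) (stdv j))"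
      unfolding sum.reindex[OF inj] by (rule sum.cong) (simp_all add: poly_act_const the_inv_into_f_f[OF inj])
    then show ?thesis using fin_vecs_expand[OF w] by metis
  qed
  then show ?thesis using sframe_exists[OF mu fin_vecs_submodule[OF H], of "stdv ` {..<n}"] by auto
qed

lemma mat_act_inverse:
  fixes S :: "'a mat"
  assumes S: "S \<in> carrier_mat n n" "det S \<noteq> 0"
  shows "\<exists>R\<in>carrier_mat n n. \<forall>v\<in>fin_vecs n. mat_act S (mat_act R v) = v"
proof
  let ?R = "(1 / det S) \<cdot>\<^sub>m adj_mat S"
  show R: "?R \<in> carrier_mat n n" using adj_mat(1)[OF S(1)] by simp
  show "\<forall>v\<in>fin_vecs n. mat_act S (mat_act ?R v) = v"
  proof
    fix v :: "nat \<Rightarrow> 'a" assume v: "v \<in> fin_vecs n"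
    have "mat_act S (mat_act ?R v) = scale (1 / det S) (mat_act (S * adj_mat S) v)"
      by (simp add: mat_act_smult mat_act_scale mat_act_mult[OF S(1) adj_mat(1)[OF S(1)]])
    also have "\<dots> = v" using S(2) by (simp add: adj_mat(2)[OF S(1)] mat_act_smult mat_act_one_fin[OF v])
    finally show "mat_act S (mat_act ?R v) = v" .
  qed
qed

text \<open>S intertwines B with A and carries the form G to F, so applying S to the generators
  preserves all data of a frame; invertibility of S preserves spanning.\<close>

lemma pframe_transport:
  assumes eq: "pair_equiv cj (A, F) (B, G)" and H: "herm_pair n A F" and H': "herm_pair m B G"
    and x: "pframe m (B, G) mu bs x"
  shows "n = m" "\<exists>x'. pframe n (A, F) mu bs x'"
proof -
  obtain S k where S: "A \<in> carrier_mat k k" "F \<in> carrier_mat k k" "B \<in> carrier_mat k k" "G \<in> carrier_mat k k"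
    "S \<in> carrier_mat k k" "det S \<noteq> 0" "A * S = S * B" "G = cstar cj S * F * S"
    using eq unfolding pair_equiv_def by auto
  have kn: "k = n" "k = m" using S H H' unfolding herm_pair_def by auto
  then show "n = m" by simp
  note S = S[unfolded kn(1)]
  have nm: "m = n" using kn by simp
  interpret P: herm_module cj eps "poly_act A" "mat_form cj F" by (rule herm_pair_module[OF H])
  interpret Q: herm_module cj eps "poly_act B" "mat_form cj G" by (rule herm_pair_module[OF H'])
  have Sact: "poly_act A f (mat_act S v) = mat_act S (poly_act B f v)" for f v
    by (rule poly_act_intertwine) (simp add: mat_act_mult[OF S(1,5), symmetric] mat_act_mult[OF S(5,3), symmetric] S(7))
  have Sform: "mat_form cj F (mat_act S u) (mat_act S v) = mat_form cj G u v" for u v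
    unfolding S(8) by (rule mat_form_congruence[OF S(2,5), symmetric])
  have x': "Q.frame_gens (fin_vecs n) (gens bs) (ann cj bs) (twin bs) (form eps mu bs) x"
    and sp: "\<forall>w\<in>fin_vecs n. \<exists>u. w = Q.comb (gens bs) u x"
    using x by (simp_all add: Q.frame_def nm)
  note X = Q.frame_gensD[OF x']
  have comb: "P.comb (gens bs) u (\<lambda>\<alpha>. mat_act S (x \<alpha>)) = mat_act S (Q.comb (gens bs) u x)" for u
  proof -
    have "mat_act S (\<Sum>\<alpha>\<in>I. f \<alpha>) = (\<Sum>\<alpha>\<in>I. mat_act S (f \<alpha>))" for f :: "nat \<times> bool \<Rightarrow> nat \<Rightarrow> 'a" and I
      by (induction I rule: infinite_finite_induct) (simp_all add: mat_act_add del: plus_fun_apply zero_fun_apply)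
    then show ?thesis by (simp add: P.comb_def Q.comb_def Sact)
  qed
  have "P.frame_gens (fin_vecs n) (gens bs) (ann cj bs) (twin bs) (form eps mu bs) (\<lambda>\<alpha>. mat_act S (x \<alpha>))"
    unfolding P.frame_gens_def
  proof (intro conjI ballI allI)
    show "P.frame_data (gens bs) (ann cj bs) (twin bs) (form eps mu bs)" using X(1) .
    fix \<alpha> assume a: "\<alpha> \<in> gens bs"
    show "mat_act S (x \<alpha>) \<in> fin_vecs n" by (rule mat_act_in[OF S(5)])
    show "poly_act A (ann cj bs \<alpha>) (mat_act S (x \<alpha>)) = 0" by (simp add: Sact X(3)[OF a])
    fix \<beta> g assume b: "\<beta> \<in> gens bs"
    show "mat_form cj F (mat_act S (x (twin bs \<alpha>))) (poly_act A g (mat_act S (x \<beta>)))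
      = (if \<alpha> = \<beta> then top_coeff (ann cj bs \<alpha>) (form eps mu bs \<alpha> * g) else 0)"
      by (simp only: Sact Sform X(4)[OF a b])
  qed
  moreover have "\<exists>u. w = P.comb (gens bs) u (\<lambda>\<alpha>. mat_act S (x \<alpha>))" if w: "w \<in> fin_vecs n" for w
  proof -
    obtain R where R: "R \<in> carrier_mat n n" "\<forall>v\<in>fin_vecs n. mat_act S (mat_act R v) = v"
      using mat_act_inverse[OF S(5,6)] by blast
    obtain u where "mat_act R w = Q.comb (gens bs) u x" using sp mat_act_in[OF R(1)] by blast
    then have "w = P.comb (gens bs) u (\<lambda>\<alpha>. mat_act S (x \<alpha>))" using R(2) w comb by metis
    then show ?thesis by blast
  qed
  ultimately show "\<exists>x'. pframe n (A, F) mu bs x'" by (auto simp: P.frame_def)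
qed

text \<open>The columns of the transition matrix are the images of the standard vectors under the isometry.\<close>
lemma pair_equiv_of_frames:
  assumes H: "herm_pair n A F" and H': "herm_pair m B G"
    and x: "pframe n (A, F) mu bs x" and y: "pframe m (B, G) mu bs y"
  shows "pair_equiv cj (A, F) (B, G)"
proof -
  interpret P: herm_module cj eps "poly_act A" "mat_form cj F" by (rule herm_pair_module[OF H])
  interpret Q: herm_module cj eps "poly_act B" "mat_form cj G" by (rule herm_pair_module[OF H'])
  note W1 = fin_vecs_submodule[OF H] and W2 = fin_vecs_submodule[OF H']
  have C: "A \<in> carrier_mat n n" "F \<in> carrier_mat n n" "B \<in> carrier_mat m m" "G \<in> carrier_mat m m"
    using H H' unfolding herm_pair_def by auto
  have X: "P.frame_gens (fin_vecs n) (gens bs) (ann cj bs) (twin bs) (form eps mu bs) x"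
    and sx: "\<forall>w\<in>fin_vecs n. \<exists>u. w = P.comb (gens bs) u x" using x by (simp_all add: P.frame_def)
  have Y: "Q.frame_gens (fin_vecs m) (gens bs) (ann cj bs) (twin bs) (form eps mu bs) y"
    and sy: "\<forall>w\<in>fin_vecs m. \<exists>u. w = Q.comb (gens bs) u y" using y by (simp_all add: Q.frame_def)
  have xf: "P.frame (fin_vecs n) (gens bs) (ann cj bs) (twin bs) (form eps mu bs) x"
    and yf: "Q.frame (fin_vecs m) (gens bs) (ann cj bs) (twin bs) (form eps mu bs) y" using x y by simp_all
  obtain \<phi> where "\<forall>u. \<phi> (Q.comb (gens bs) u y) = P.comb (gens bs) u x"
    using frame_isometry[OF herm_pair_module[OF H'] herm_pair_module[OF H] yf xf] by (rule exE)
  then have \<phi>: "\<phi> (Q.comb (gens bs) u y) = P.comb (gens bs) u x" for u by (rule spec)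
  obtain \<psi> where "\<forall>u. \<psi> (P.comb (gens bs) u x) = Q.comb (gens bs) u y"
    using frame_isometry[OF herm_pair_module[OF H] herm_pair_module[OF H'] xf yf] by (rule exE)
  then have \<psi>: "\<psi> (P.comb (gens bs) u x) = Q.comb (gens bs) u y" for u by (rule spec)
  have Pin: "P.comb (gens bs) u x \<in> fin_vecs n" for u by (rule P.comb_in[OF W1(1) P.frame_gensD(2)[OF X]])
  have Qin: "Q.comb (gens bs) u y \<in> fin_vecs m" for u by (rule Q.comb_in[OF W2(1) Q.frame_gensD(2)[OF Y]])
  have \<phi>in: "\<phi> w \<in> fin_vecs n" and \<psi>\<phi>: "\<psi> (\<phi> w) = w" if w: "w \<in> fin_vecs m" for w
  proof -
    obtain u where u: "w = Q.comb (gens bs) u y" using sy w by blast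
    show "\<phi> w \<in> fin_vecs n" "\<psi> (\<phi> w) = w" unfolding u \<phi> \<psi> by (rule Pin, rule refl)
  qed
  have \<psi>in: "\<psi> w \<in> fin_vecs m" and \<phi>\<psi>: "\<phi> (\<psi> w) = w" if w: "w \<in> fin_vecs n" for w
  proof -
    obtain u where u: "w = P.comb (gens bs) u x" using sx w by blast
    show "\<psi> w \<in> fin_vecs m" "\<phi> (\<psi> w) = w" unfolding u \<phi> \<psi> by (rule Qin, rule refl)
  qed
  have \<phi>add: "\<phi> (v + w) = \<phi> v + \<phi> w" if vw: "v \<in> fin_vecs m" "w \<in> fin_vecs m" for v w
  proof -
    obtain a b where "v = Q.comb (gens bs) a y" "w = Q.comb (gens bs) b y" using sy vw by blast
    then show ?thesis by (simp only: Q.comb_add \<phi> P.comb_add)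
  qed
  have \<phi>act: "\<phi> (poly_act B f w) = poly_act A f (\<phi> w)" if w: "w \<in> fin_vecs m" for f w
  proof -
    obtain a where "w = Q.comb (gens bs) a y" using sy w by blast
    then show ?thesis by (simp only: Q.act_comb \<phi> P.act_comb)
  qed
  have \<phi>form: "mat_form cj F (\<phi> v) (\<phi> w) = mat_form cj G v w" if vw: "v \<in> fin_vecs m" "w \<in> fin_vecs m" for v w
  proof -
    obtain a b where ab: "v = Q.comb (gens bs) a y" "w = Q.comb (gens bs) b y" using sy vw by blast
    have "mat_form cj F (\<phi> v) (poly_act A 1 (\<phi> w)) = mat_form cj G v (poly_act B 1 w)"
      unfolding ab \<phi> P.frame_form[OF X] Q.frame_form[OF Y] ..
    then show ?thesis by simp
  qed
  have \<psi>add: "\<psi> (v + w) = \<psi> v + \<psi> w" if vw: "v \<in> fin_vecs n" "w \<in> fin_vecs n" for v w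
  proof -
    obtain a b where "v = P.comb (gens bs) a x" "w = P.comb (gens bs) b x" using sx vw by blast
    then show ?thesis by (simp only: Q.comb_add \<psi> P.comb_add)
  qed
  have \<psi>act: "\<psi> (poly_act A f w) = poly_act B f (\<psi> w)" if w: "w \<in> fin_vecs n" for f w
  proof -
    obtain a where "w = P.comb (gens bs) a x" using sx w by blast
    then show ?thesis by (simp only: Q.act_comb \<psi> P.act_comb)
  qed
  \<comment> \<open>A linear map between spaces of finite vectors is given by the matrix of its
    values on \<open>stdv\<close>. This is applied to the isometry and to its inverse, which so far
    exist only as functions.\<close>
  have linear: "mat_act (mat l k (\<lambda>(i,j). \<theta> (stdv j) i)) w = \<theta> w"
    if add: "\<And>v w. v \<in> fin_vecs k \<Longrightarrow> w \<in> fin_vecs k \<Longrightarrow> \<theta> (v + w) = \<theta> v + \<theta> w"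
      and sc: "\<And>a v. v \<in> fin_vecs k \<Longrightarrow> \<theta> (scale a v) = scale a (\<theta> v)"
      and inn: "\<And>v. v \<in> fin_vecs k \<Longrightarrow> \<theta> v \<in> fin_vecs l" and w: "w \<in> fin_vecs k"
    for \<theta> :: "(nat \<Rightarrow> 'a) \<Rightarrow> nat \<Rightarrow> 'a" and l k w
  proof -
    have z: "(0::nat \<Rightarrow> 'a) \<in> fin_vecs k" by (simp add: fin_vecs_def)
    have \<theta>0: "\<theta> 0 = 0" using sc[OF z, of 0] by simp
    have part: "(\<Sum>j<r. scale (w j) (stdv j)) \<in> fin_vecs k \<and>
        \<theta> (\<Sum>j<r. scale (w j) (stdv j)) = (\<Sum>j<r. scale (w j) (\<theta> (stdv j)))" if "r \<le> k" for r
      using that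
    proof (induction r)
      case 0
      then show ?case using z \<theta>0 by (simp del: plus_fun_apply zero_fun_apply)
    next
      case (Suc r)
      have st: "(stdv r :: nat \<Rightarrow> 'a) \<in> fin_vecs k" using Suc.prems by (simp add: stdv_in)
      then have st': "scale (w r) (stdv r) \<in> fin_vecs k" by (simp add: fin_vecs_def scale_apply)
      have cl: "u + v \<in> fin_vecs k" if "u \<in> fin_vecs k" "v \<in> fin_vecs k" for u v :: "nat \<Rightarrow> 'a"
        using that by (simp add: fin_vecs_def)
      show ?case using Suc st st' by (simp add: add sc cl del: plus_fun_apply zero_fun_apply)
    qed
    have sa: "(\<Sum>j\<in>I. f j) i = (\<Sum>j\<in>I. f j i)" for f :: "nat \<Rightarrow> nat \<Rightarrow> 'a" and I i
      by (induction I rule: infinite_finite_induct) auto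
    have e: "\<theta> w = (\<Sum>j<k. scale (w j) (\<theta> (stdv j)))"
      using part[of k] fin_vecs_expand[OF w] by simp
    show ?thesis
    proof
      fix i
      show "mat_act (mat l k (\<lambda>(i,j). \<theta> (stdv j) i)) w i = \<theta> w i"
      proof (cases "i < l")
        case True
        then show ?thesis unfolding e sa by (simp add: mat_act_def mult.commute scale_apply)
      next
        case False
        then show ?thesis using inn[OF w] by (simp add: mat_act_def fin_vecs_def)
      qed
    qed
  qed
  define S where "S = mat n m (\<lambda>(i,j). \<phi> (stdv j) i)"
  define R where "R = mat m n (\<lambda>(i,j). \<psi> (stdv j) i)"
  have Sc: "S \<in> carrier_mat n m" "R \<in> carrier_mat m n" by (auto simp: S_def R_def)
  have S\<phi>: "mat_act S w = \<phi> w" if "w \<in> fin_vecs m" for w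
    unfolding S_def by (rule linear[OF \<phi>add _ \<phi>in that]) (use \<phi>act[of _ "[:_:]"] in \<open>simp_all add: poly_act_const\<close>)
  have R\<psi>: "mat_act R w = \<psi> w" if "w \<in> fin_vecs n" for w
    unfolding R_def by (rule linear[OF \<psi>add _ \<psi>in that]) (use \<psi>act[of _ "[:_:]"] in \<open>simp_all add: poly_act_const\<close>)
  have SR: "S * R = 1\<^sub>m n"
  proof (rule eq_matI)
    fix i j assume "i < dim_row (1\<^sub>m n)" "j < dim_col (1\<^sub>m n)"
    then have ij: "i < n" "j < n" by auto
    have "(S * R) $$ (i,j) = mat_act (S * R) (stdv j) i" using Sc ij by (simp add: mat_act_stdv[of _ n n])
    also have "\<dots> = stdv j i" using S\<phi>[OF \<psi>in[OF stdv_in[OF ij(2)]]] R\<psi>[OF stdv_in[OF ij(2)]] \<phi>\<psi>[OF stdv_in[OF ij(2)]]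
      by (simp add: mat_act_mult[OF Sc])
    finally show "(S * R) $$ (i,j) = 1\<^sub>m n $$ (i,j)" using ij by (simp add: stdv_def)
  qed (use Sc in auto)
  have RS: "R * S = 1\<^sub>m m"
  proof (rule eq_matI)
    fix i j assume "i < dim_row (1\<^sub>m m)" "j < dim_col (1\<^sub>m m)"
    then have ij: "i < m" "j < m" by auto
    have "(R * S) $$ (i,j) = mat_act (R * S) (stdv j) i" using Sc ij by (simp add: mat_act_stdv[of _ m m])
    also have "\<dots> = stdv j i" using R\<psi>[OF \<phi>in[OF stdv_in[OF ij(2)]]] S\<phi>[OF stdv_in[OF ij(2)]] \<psi>\<phi>[OF stdv_in[OF ij(2)]]
      by (simp add: mat_act_mult[OF Sc(2,1)])
    finally show "(R * S) $$ (i,j) = 1\<^sub>m m $$ (i,j)" using ij by (simp add: stdv_def)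
  qed (use Sc in auto)
  \<comment> \<open>Divisibility by 0 is equality, so the counting lemma with modulus 0 compares the
    sizes of matrices that are inverse to each other.\<close>
  have le: "k \<le> l" if "X \<in> carrier_mat k l" "Y \<in> carrier_mat l k" "X * Y = 1\<^sub>m k" for X Y :: "'a mat" and k l
  proof -
    have "card {0..<k} \<le> card {0..<l}"
    proof (rule left_inverse_mod_card_le[where m = 0 and R = "\<lambda>i k. X $$ (i,k)" and S = "\<lambda>k j. Y $$ (k,j)"])
      fix a b assume ab: "a \<in> {0..<k}" "b \<in> {0..<k}"
      have "(\<Sum>j\<in>{0..<l}. X $$ (a,j) * Y $$ (j,b)) = (X * Y) $$ (a,b)" using that(1,2) ab by (simp add: scalar_prod_def)
      then show "0 dvd (\<Sum>j\<in>{0..<l}. X $$ (a,j) * Y $$ (j,b)) - (if a = b then 1 else 0)"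
        using that(3) ab by simp
    qed auto
    then show ?thesis by simp
  qed
  have nm: "m = n" using le[OF Sc SR] le[OF Sc(2,1) RS] by simp
  note Sc = Sc[unfolded nm] and C = C[unfolded nm]
  have "det S * det R = 1" using det_mult[OF Sc] SR by simp
  then have "det S \<noteq> 0" by auto
  moreover have "A * S = S * B"
  proof (rule eq_matI)
    fix i j assume "i < dim_row (S * B)" "j < dim_col (S * B)"
    then have ij: "i < n" "j < n" using Sc C by auto
    have sj: "(stdv j :: nat \<Rightarrow> 'a) \<in> fin_vecs m" using ij nm by (simp add: stdv_in)
    have Bj: "mat_act B (stdv j) = poly_act B [:0,1:] (stdv j)" "mat_act A w = poly_act A [:0,1:] w" for w
      by (simp_all add: poly_act_pCons)
    have "mat_act (A * S) (stdv j) = mat_act (S * B) (stdv j)"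
      using S\<phi>[OF sj] S\<phi>[OF poly_act_in[OF C(3)[folded nm] sj, of "[:0,1:]"]] \<phi>act[OF sj, of "[:0,1:]"]
      by (simp add: mat_act_mult[OF C(1) Sc(1)] mat_act_mult[OF Sc(1) C(3)] Bj)
    then show "(A * S) $$ (i,j) = (S * B) $$ (i,j)"
      using mat_act_stdv[of "A * S" n n i j] mat_act_stdv[of "S * B" n n i j] Sc C ij by simp
  qed (use Sc C in auto)
  moreover have "G = cstar cj S * F * S"
  proof (rule eq_matI)
    fix i j assume "i < dim_row (cstar cj S * F * S)" "j < dim_col (cstar cj S * F * S)"
    then have ij: "i < n" "j < n" using Sc C cstar_carrier[OF Sc(1)] by auto
    have s: "(stdv i :: nat \<Rightarrow> 'a) \<in> fin_vecs m" "(stdv j :: nat \<Rightarrow> 'a) \<in> fin_vecs m" using ij nm by (simp_all add: stdv_in)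
    have "mat_form cj (cstar cj S * F * S) (stdv i) (stdv j) = mat_form cj G (stdv i) (stdv j)"
      unfolding mat_form_congruence[OF C(2) Sc(1)] S\<phi>[OF s(1)] S\<phi>[OF s(2)] by (rule \<phi>form[OF s])
    moreover have "cstar cj S * F * S \<in> carrier_mat n n" using Sc C cstar_carrier[OF Sc(1)] by auto
    ultimately show "G $$ (i,j) = (cstar cj S * F * S) $$ (i,j)"
      using mat_form_stdv[OF _ ij] C by metis
  qed (use Sc C cstar_carrier[OF Sc(1)] in auto)
  ultimately show ?thesis unfolding pair_equiv_def using Sc C
    by (intro exI[of _ n] exI[of _ S]) simp
qed

end


section \<open>The cyclic module of a Frobenius block\<close>

definition vec_poly :: "nat \<Rightarrow> (nat \<Rightarrow> 'a::field) \<Rightarrow> 'a poly" where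
  "vec_poly n v = (\<Sum>i<n. monom (v i) i)"

lemma coeff_vec_poly: "coeff (vec_poly n v) k = (if k < n then v k else 0)"
  by (simp add: vec_poly_def coeff_sum)

lemma degree_vec_poly:
  assumes "0 < n"
  shows "degree (vec_poly n v) < n"
proof -
  have "degree (vec_poly n v) \<le> n - 1" by (rule degree_le) (auto simp: coeff_vec_poly)
  then show ?thesis using assms by simp
qed

text \<open>In the basis 1, x, ..., x^(n-1) the companion matrix is multiplication by x modulo q:
  the coefficient of x^n in x r is the coefficient of r at n - 1, and that multiple of q is
  subtracted.\<close>

lemma companion_mat_act:
  assumes q: "monic q" "degree q > 0" and r: "degree r < degree q"
  shows "mat_act (companion q) (coeff r) = coeff (pCons 0 r - Polynomial.smult (coeff r (degree q - 1)) q)"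
proof
  fix i
  let ?n = "degree q"
  show "mat_act (companion q) (coeff r) i = coeff (pCons 0 r - Polynomial.smult (coeff r (?n - 1)) q) i"
  proof (cases "i < ?n")
    case True
    have "mat_act (companion q) (coeff r) i
      = (\<Sum>j<?n. (if j = ?n - 1 then - coeff q i * coeff r j else 0) + (if 0 < i \<and> j = i - 1 then coeff r j else 0))"
      using True by (auto simp: mat_act_def companion_def intro!: sum.cong)
    also have "\<dots> = - coeff q i * coeff r (?n - 1) + (if 0 < i then coeff r (i - 1) else 0)"
      using True q(2) by (auto simp: sum.distrib sum.delta)
    also have "\<dots> = coeff (pCons 0 r - Polynomial.smult (coeff r (?n - 1)) q) i"
      by (cases i) auto
    finally show ?thesis .
  next
    case False
    have "coeff (pCons 0 r - Polynomial.smult (coeff r (?n - 1)) q) i = 0"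
    proof (cases "i = ?n")
      case True
      obtain k where "?n = Suc k" using q(2) gr0_implies_Suc by blast
      then show ?thesis using q True by (simp add: coeff_pCons)
    next
      case neq: False
      then obtain k where k: "i = Suc k" "k \<ge> ?n" using False by (cases i) auto
      then show ?thesis using r by (auto simp: coeff_eq_0)
    qed
    then show ?thesis using False by (simp add: mat_act_def companion_def)
  qed
qed

text \<open>With \<open>stdv 0\<close> as the class of 1, the vectors of a block become the
  remainders modulo q.\<close>

lemma companion_poly_act:
  assumes q: "monic q" "degree q > 0"
  shows "poly_act (companion q) f (stdv 0) = coeff (f mod q)"
proof (induction f)
  case 0
  show ?case by (simp add: fun_eq_iff)
next
  case (pCons a f)
  have q0: "q \<noteq> 0" using q by auto
  let ?r = "f mod q"
  have r: "degree ?r < degree q" using degree_mod_less[OF q0, of f] q by auto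
  obtain n where n: "degree q = Suc n" using q gr0_implies_Suc by blast
  have b: "coeff (pCons a ?r) (degree q) / coeff q (degree q) = coeff ?r (degree q - 1)" using q n by simp
  have "pCons a f mod q = pCons a ?r - Polynomial.smult (coeff ?r (degree q - 1)) q"
    unfolding mod_pCons[OF q0] b ..
  also have "\<dots> = [:a:] + (pCons 0 ?r - Polynomial.smult (coeff ?r (degree q - 1)) q)" by simp
  finally have m: "pCons a f mod q = [:a:] + (pCons 0 ?r - Polynomial.smult (coeff ?r (degree q - 1)) q)" .
  have "poly_act (companion q) (pCons a f) (stdv 0) i = coeff (pCons a f mod q) i" for i
    unfolding poly_act_pCons pCons.IH companion_mat_act[OF q r] m
    by (auto simp: scale_apply stdv_def coeff_pCons split: nat.split)
  then show ?case by (simp add: fun_eq_iff)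
qed

lemma companion_generates:
  assumes q: "monic q" "degree q > 0" and v: "v \<in> fin_vecs (degree q)"
  shows "poly_act (companion q) (vec_poly (degree q) v) (stdv 0) = v"
  unfolding companion_poly_act[OF q]
  using v degree_vec_poly[OF q(2), of v] by (auto simp: fun_eq_iff coeff_vec_poly fin_vecs_def mod_poly_less)

text \<open>\<open>A ^\<^sub>m 0\<close> is the identity of size n and cuts off the entries from n
  on, whereas \<open>poly_act\<close> scales the whole function; the factor
  \<open>1\<^sub>m n\<close> accounts for the difference.\<close>

lemma poly_mat_act:
  assumes A: "A \<in> carrier_mat n n"
  shows "mat_act (poly_mat f A) v = mat_act (1\<^sub>m n) (poly_act A f v)" "poly_mat f A \<in> carrier_mat n n"
proof -
  let ?T = "\<lambda>xs. foldr (\<lambda>i M. M + coeff f i \<cdot>\<^sub>m (A ^\<^sub>m i)) xs (0\<^sub>m (dim_row A) (dim_col A))"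
  have pw: "mat_act (A ^\<^sub>m i) v = mat_act (1\<^sub>m n) (poly_act A (monom 1 i) v)" for i v
  proof (induction i arbitrary: v)
    case 0
    then show ?case using A by (simp add: poly_act_1)
  next
    case (Suc i)
    have "mat_act (A ^\<^sub>m Suc i) v = mat_act (A ^\<^sub>m i) (mat_act A v)"
      using A mat_act_mult[OF pow_carrier_mat[OF A] A] by simp
    also have "mat_act A v = poly_act A [:0,1:] v"
      by (simp only: poly_act_pCons poly_act_0 scale_simps mat_act_0 add_0_left add_0_right)
    also have "mat_act (A ^\<^sub>m i) \<dots> = mat_act (1\<^sub>m n) (poly_act A (monom 1 i * [:0,1:]) v)"
      by (simp only: Suc.IH poly_act_mult)
    also have "monom 1 i * [:0,1:] = (monom 1 (Suc i) :: 'a poly)" by (simp add: monom_Suc mult.commute)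
    finally show ?case .
  qed
  have madd: "mat_act (X + Y) v = mat_act X v + mat_act Y v" if "X \<in> carrier_mat n n" "Y \<in> carrier_mat n n" for X Y :: "'a mat"
    using that by (auto simp: mat_act_def fun_eq_iff algebra_simps sum.distrib)
  have T: "?T xs \<in> carrier_mat n n \<and> mat_act (?T xs) v = mat_act (1\<^sub>m n) (poly_act A (sum_list (map (\<lambda>i. monom (coeff f i) i) xs)) v)" for xs
  proof (induction xs)
    case Nil
    have "mat_act (0\<^sub>m n n) v = 0" by (auto simp: mat_act_def fun_eq_iff)
    then show ?case using A by (auto simp del: zero_fun_apply)
  next
    case (Cons i xs)
    let ?M = "coeff f i \<cdot>\<^sub>m (A ^\<^sub>m i)"
    have M: "?M \<in> carrier_mat n n" using A by simp
    have "mat_act (?T xs + ?M) v = mat_act (?T xs) v + scale (coeff f i) (mat_act (A ^\<^sub>m i) v)"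
      using madd[OF _ M] Cons.IH by (simp only: mat_act_smult)
    also have "\<dots> = mat_act (1\<^sub>m n) (poly_act A (sum_list (map (\<lambda>i. monom (coeff f i) i) xs)) v + poly_act A (Polynomial.smult (coeff f i) (monom 1 i)) v)"
      using Cons.IH by (simp only: pw mat_act_add poly_act_smult mat_act_scale)
    also have "\<dots> = mat_act (1\<^sub>m n) (poly_act A (sum_list (map (\<lambda>i. monom (coeff f i) i) (i # xs))) v)"
      by (simp only: add_poly_act[symmetric] smult_monom mult_1_right list.map sum_list.Cons add.commute)
    finally show ?case using Cons.IH M by simp
  qed
  have "sum_list (map (\<lambda>i. monom (coeff f i) i) [0..<Suc (degree f)]) = (\<Sum>i\<le>degree f. monom (coeff f i) i)"
    by (simp only: sum_list_distinct_conv_sum_set[OF distinct_upt] set_upt atLeast0LessThan lessThan_Suc_atMost)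
  also have "\<dots> = f" by (rule poly_as_sum_of_monoms)
  finally have s: "sum_list (map (\<lambda>i. monom (coeff f i) i) [0..<Suc (degree f)]) = f" .
  show "mat_act (poly_mat f A) v = mat_act (1\<^sub>m n) (poly_act A f v)"
    unfolding poly_mat_def conjunct2[OF T] s ..
  show "poly_mat f A \<in> carrier_mat n n" unfolding poly_mat_def by (rule conjunct1[OF T])
qed

section \<open>Direct sums\<close>

definition shift :: "nat \<Rightarrow> (nat \<Rightarrow> 'a::zero) \<Rightarrow> nat \<Rightarrow> 'a" where
  "shift n v = (\<lambda>i. if i < n then 0 else v (i - n))"

definition tail :: "nat \<Rightarrow> (nat \<Rightarrow> 'a) \<Rightarrow> nat \<Rightarrow> 'a" where
  "tail n v = (\<lambda>i. v (n + i))"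

definition head :: "nat \<Rightarrow> (nat \<Rightarrow> 'a::zero) \<Rightarrow> nat \<Rightarrow> 'a" where
  "head n v = (\<lambda>i. if i < n then v i else 0)"

lemma tail_shift [simp]: "tail n (shift n v) = v" by (simp add: tail_def shift_def)
lemma tail_fin: "v \<in> fin_vecs n \<Longrightarrow> tail n v = (0 :: nat \<Rightarrow> 'a::field)" by (auto simp: tail_def fin_vecs_def fun_eq_iff)
lemma head_shift_tail: "head n v + shift n (tail n v) = (v :: nat \<Rightarrow> 'a::field)"
  by (auto simp: head_def shift_def tail_def fun_eq_iff)
lemma head_fin: "head n v \<in> fin_vecs n" by (auto simp: head_def fin_vecs_def)
lemma shift_fin: "v \<in> fin_vecs m \<Longrightarrow> shift n v \<in> fin_vecs (n + m)" by (auto simp: shift_def fin_vecs_def)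
lemma tail_in: "v \<in> fin_vecs (n + m) \<Longrightarrow> tail n v \<in> fin_vecs m" by (auto simp: tail_def fin_vecs_def)
lemma fin_vecs_mono: "v \<in> fin_vecs n \<Longrightarrow> v \<in> fin_vecs (n + m)" by (auto simp: fin_vecs_def)
lemma shift_0 [simp]: "shift n (0::nat \<Rightarrow> 'a::field) = 0" by (auto simp: shift_def fun_eq_iff)
lemma shift_add: "shift n (u + v :: nat \<Rightarrow> 'a::field) = shift n u + shift n v" by (auto simp: shift_def fun_eq_iff)
lemma shift_scale: "shift n (scale a (v :: nat \<Rightarrow> 'a::field)) = scale a (shift n v)" by (auto simp: shift_def fun_eq_iff scale_apply)
lemma tail_add: "tail n (u + v :: nat \<Rightarrow> 'a::field) = tail n u + tail n v" by (auto simp: tail_def fun_eq_iff)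

lemma sum_lessThan_split: "(\<Sum>j<n+m. f j) = (\<Sum>j<n. f j) + (\<Sum>j<m. f (n + j))" for f :: "nat \<Rightarrow> 'a::comm_monoid_add"
  by (induction m) (auto simp: add.assoc)

lemma dsum_mat_carrier: "A \<in> carrier_mat n n \<Longrightarrow> B \<in> carrier_mat m m \<Longrightarrow> dsum_mat A B \<in> carrier_mat (n + m) (n + m)"
  by (simp add: dsum_mat_def)

lemma mat_act_dsum:
  assumes A: "A \<in> carrier_mat n n" and B: "B \<in> carrier_mat m m"
  shows "mat_act (dsum_mat A B) v = mat_act A v + shift n (mat_act B (tail n v))"
proof
  fix i
  show "mat_act (dsum_mat A B) v i = (mat_act A v + shift n (mat_act B (tail n v))) i"
  proof (cases "i < n")
    case True
    then show ?thesis using A B by (simp add: mat_act_def dsum_mat_def sum_lessThan_split shift_def)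
  next
    case False
    then show ?thesis using A B by (auto simp: mat_act_def dsum_mat_def sum_lessThan_split shift_def tail_def)
  qed
qed

lemma mat_act_shift: "A \<in> carrier_mat k n \<Longrightarrow> mat_act A (shift n v) = 0"
  by (auto simp: mat_act_def shift_def fun_eq_iff)

lemma mat_act_head: "A \<in> carrier_mat k n \<Longrightarrow> mat_act A (head n v) = mat_act A v"
  by (auto simp: mat_act_def head_def fun_eq_iff)

lemma poly_act_dsum:
  assumes A: "A \<in> carrier_mat n n" and B: "B \<in> carrier_mat m m"
  shows "v \<in> fin_vecs n \<Longrightarrow> poly_act (dsum_mat A B) f v = poly_act A f v"
    "poly_act (dsum_mat A B) f (shift n w) = shift n (poly_act B f w)"
proof -
  show "v \<in> fin_vecs n \<Longrightarrow> poly_act (dsum_mat A B) f v = poly_act A f v"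
  proof (induction f)
    case (pCons a f)
    then show ?case
      by (simp only: poly_act_pCons mat_act_dsum[OF A B] tail_fin[OF poly_act_in[OF A pCons.prems]] mat_act_0 shift_0 add_0_right)
  qed simp
  show "poly_act (dsum_mat A B) f (shift n w) = shift n (poly_act B f w)"
    by (induction f) (simp_all only: poly_act_0 shift_0 poly_act_pCons mat_act_dsum[OF A B] mat_act_shift[OF A]
        tail_shift shift_add shift_scale add_0_left)
qed

context involution
begin

lemma pairing_split: "pairing cj (n + m) u w = pairing cj n u w + pairing cj m (tail n u) (tail n w)"
  by (simp add: pairing_def sum_lessThan_split tail_def)

lemma pairing_0 [simp]: "pairing cj n 0 w = 0" "pairing cj n w 0 = 0"
  by (simp_all add: pairing_def)

lemma mat_form_dsum:
  assumes F: "F \<in> carrier_mat n n" and G: "G \<in> carrier_mat m m"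
  shows "mat_form cj (dsum_mat F G) u v = mat_form cj F u v + mat_form cj G (tail n u) (tail n v)"
proof -
  have 1: "pairing cj n u (mat_act F v + shift n (mat_act G (tail n v))) = pairing cj n u (mat_act F v)"
    by (rule pairing_cong) (auto simp: shift_def)
  have "tail n (mat_act F v) = 0" by (rule tail_fin[OF mat_act_in[OF F]])
  then have 2: "tail n (mat_act F v + shift n (mat_act G (tail n v))) = mat_act G (tail n v)"
    by (simp only: tail_add tail_shift add_0_left)
  have "dim_row (dsum_mat F G) = n + m" using F G by (simp add: dsum_mat_def)
  then show ?thesis using F G unfolding mat_form_def mat_act_dsum[OF F G]
    by (simp only: pairing_split 1 2 carrier_matD)
qed

lemma mat_form_shift: "F \<in> carrier_mat n n \<Longrightarrow> mat_form cj F u (shift n v) = 0"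
  by (simp add: mat_form_def mat_act_shift del: zero_fun_apply)
lemma mat_form_head: "F \<in> carrier_mat n n \<Longrightarrow> mat_form cj F u (head n v) = mat_form cj F u v"
  by (simp add: mat_form_def mat_act_head)
lemma mat_form_0: "mat_form cj F 0 v = 0" "mat_form cj F v 0 = 0"
  by (simp_all add: mat_form_def del: zero_fun_apply)
lemma mat_form_cong_left:
  "F \<in> carrier_mat n n \<Longrightarrow> (\<And>i. i < n \<Longrightarrow> u i = u' i) \<Longrightarrow> mat_form cj F u v = mat_form cj F u' v"
  unfolding mat_form_def by (intro pairing_cong) auto

end

context herm_setting
begin

lemma herm_pair_dsum:
  assumes P: "herm_pair n A F" and Q: "herm_pair m B G"
  shows "herm_pair (n + m) (dsum_mat A B) (dsum_mat F G)"
proof -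
  have A: "A \<in> carrier_mat n n" and F: "F \<in> carrier_mat n n"
    and Fs: "\<And>u v. mat_form cj F v u = eps * cj (mat_form cj F u v)"
    and Fa: "\<And>u v. mat_form cj F (mat_act A u) v = mat_form cj F u (mat_act A v)"
    and Fn: "\<And>u. u \<in> fin_vecs n \<Longrightarrow> (\<And>w. w \<in> fin_vecs n \<Longrightarrow> mat_form cj F w u = 0) \<Longrightarrow> u = 0"
    using P unfolding herm_pair_def by blast+
  have B: "B \<in> carrier_mat m m" and G: "G \<in> carrier_mat m m"
    and Gs: "\<And>u v. mat_form cj G v u = eps * cj (mat_form cj G u v)"
    and Ga: "\<And>u v. mat_form cj G (mat_act B u) v = mat_form cj G u (mat_act B v)"
    and Gn: "\<And>u. u \<in> fin_vecs m \<Longrightarrow> (\<And>w. w \<in> fin_vecs m \<Longrightarrow> mat_form cj G w u = 0) \<Longrightarrow> u = 0"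
    using Q unfolding herm_pair_def by blast+
  note form = mat_form_dsum[OF F G] and act = mat_act_dsum[OF A B]
  show ?thesis unfolding herm_pair_def
  proof (intro conjI allI ballI impI)
    fix u v
    show "mat_form cj (dsum_mat F G) v u = eps * cj (mat_form cj (dsum_mat F G) u v)"
      unfolding form using Fs[of v u] Gs[of "tail n v" "tail n u"] by (simp add: cj_add distrib_left)
    have t: "tail n (mat_act A w + shift n (mat_act B (tail n w))) = mat_act B (tail n w)" for w
      by (simp only: tail_add tail_fin[OF mat_act_in[OF A]] tail_shift add_0_left)
    have 1: "mat_form cj F (mat_act A u + shift n (mat_act B (tail n u))) v = mat_form cj F (mat_act A u) v"
      by (rule mat_form_cong_left[OF F]) (simp add: shift_def)
    have 2: "mat_form cj F u (mat_act A v + shift n (mat_act B (tail n v))) = mat_form cj F u (mat_act A v)"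
      unfolding mat_form_add mat_form_shift[OF F] by simp
    show "mat_form cj (dsum_mat F G) (mat_act (dsum_mat A B) u) v = mat_form cj (dsum_mat F G) u (mat_act (dsum_mat A B) v)"
      unfolding form act t 1 2 Fa Ga ..
  next
    fix u assume u: "u \<in> fin_vecs (n + m)" and z: "\<forall>w\<in>fin_vecs (n + m). mat_form cj (dsum_mat F G) w u = 0"
    have "head n u = 0"
    proof (rule Fn[OF head_fin])
      fix w :: "nat \<Rightarrow> 'a" assume w: "w \<in> fin_vecs n"
      show "mat_form cj F w (head n u) = 0"
        using z[rule_format, OF fin_vecs_mono[OF w]] unfolding form tail_fin[OF w] mat_form_0 mat_form_head[OF F] by simp
    qed
    moreover have "tail n u = 0"
    proof (rule Gn[OF tail_in[OF u]])
      fix w :: "nat \<Rightarrow> 'a" assume w: "w \<in> fin_vecs m"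
      have "mat_form cj F (shift n w) u = mat_form cj F 0 u" by (rule mat_form_cong_left[OF F]) (simp add: shift_def)
      then show "mat_form cj G w (tail n u) = 0"
        using z[rule_format, OF shift_fin[OF w]] unfolding form tail_shift mat_form_0 by simp
    qed
    ultimately show "u = 0" using head_shift_tail[of n u] by (simp only: shift_0 add_0_right)
  qed (use A F B G in \<open>auto intro: dsum_mat_carrier\<close>)
qed

definition gframe :: "nat \<Rightarrow> 'a mat \<times> 'a mat \<Rightarrow> ('a mat \<Rightarrow> 'a poly) \<Rightarrow> 'a summand \<Rightarrow> bool" where
  "gframe n P mu b \<longleftrightarrow> herm_pair n (fst P) (snd P) \<and> (\<exists>y. herm_module.frame cj (poly_act (fst P)) (mat_form cj (snd P)) (fin_vecs n)
     (sgens b) (sann cj b) (stwin b) (sform eps mu b) y)"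

text \<open>The shifted copy of the second module is the complement W' in
  \<open>sframe_Cons\<close>: it is orthogonal to the first block, and a vector splits into its head
  and its shifted tail.\<close>

lemma pframe_dsum:
  assumes P: "gframe n (A, F) mu b" and Q: "herm_pair m B G" and x: "pframe m (B, G) mu bs x"
  shows "\<exists>z. pframe (n + m) (dsum_mat A B, dsum_mat F G) mu (b # bs) z"
proof -
  have PA: "herm_pair n A F" using P by (simp add: gframe_def)
  interpret P: herm_module cj eps "poly_act A" "mat_form cj F" by (rule herm_pair_module[OF PA])
  interpret Q: herm_module cj eps "poly_act B" "mat_form cj G" by (rule herm_pair_module[OF Q])
  note S = herm_pair_dsum[OF PA Q]
  interpret S: herm_module cj eps "poly_act (dsum_mat A B)" "mat_form cj (dsum_mat F G)" by (rule herm_pair_module[OF S])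
  have C: "A \<in> carrier_mat n n" "F \<in> carrier_mat n n" "B \<in> carrier_mat m m" "G \<in> carrier_mat m m"
    using PA Q unfolding herm_pair_def by auto
  note pa = poly_act_dsum[OF C(1,3)] and form = mat_form_dsum[OF C(2,4)]
  obtain y where y: "P.frame (fin_vecs n) (sgens b) (sann cj b) (stwin b) (sform eps mu b) y"
    using P by (auto simp: gframe_def)
  have Y: "P.frame_gens (fin_vecs n) (sgens b) (sann cj b) (stwin b) (sform eps mu b) y"
    and sy: "\<forall>w\<in>fin_vecs n. \<exists>u. w = P.comb (sgens b) u y" using y by (simp_all add: P.frame_def)
  have X: "Q.frame_gens (fin_vecs m) (gens bs) (ann cj bs) (twin bs) (form eps mu bs) x"
    and sx: "\<forall>w\<in>fin_vecs m. \<exists>u. w = Q.comb (gens bs) u x" using x by (simp_all add: Q.frame_def)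
  note Y' = P.frame_gensD[OF Y] and X' = Q.frame_gensD[OF X]
  have form1: "mat_form cj (dsum_mat F G) u v = mat_form cj F u v" if "u \<in> fin_vecs n" for u v
    unfolding form tail_fin[OF that] mat_form_0 by simp
  have form2: "mat_form cj (dsum_mat F G) (shift n u) (shift n v) = mat_form cj G u v" for u v
    unfolding form mat_form_shift[OF C(2)] tail_shift by simp
  have y1: "S.sgenerators (fin_vecs (n + m)) mu b y"
    unfolding S.frame_gens_def
  proof (intro conjI ballI allI)
    show "S.frame_data (sgens b) (sann cj b) (stwin b) (sform eps mu b)" by (rule Y'(1))
    fix \<alpha> assume a: "\<alpha> \<in> sgens b"
    show "y \<alpha> \<in> fin_vecs (n + m)" by (rule fin_vecs_mono[OF Y'(2)[OF a]])
    show "poly_act (dsum_mat A B) (sann cj b \<alpha>) (y \<alpha>) = 0" unfolding pa(1)[OF Y'(2)[OF a]] by (rule Y'(3)[OF a])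
    fix \<beta> g assume b: "\<beta> \<in> sgens b"
    show "mat_form cj (dsum_mat F G) (y (stwin b \<alpha>)) (poly_act (dsum_mat A B) g (y \<beta>)) =
      (if \<alpha> = \<beta> then top_coeff (sann cj b \<alpha>) (sform eps mu b \<alpha> * g) else 0)"
      unfolding pa(1)[OF Y'(2)[OF b]] form1[OF Y'(2)[OF P.frame_dataD(2)[OF Y'(1) a]]] by (rule Y'(4)[OF a b])
  qed
  let ?W = "shift n ` fin_vecs m :: (nat \<Rightarrow> 'a) set"
  have sm: "S.submodule ?W"
    unfolding S.submodule_def
  proof (intro conjI ballI allI)
    have "(0 :: nat \<Rightarrow> 'a) \<in> fin_vecs m" by (simp add: fin_vecs_def)
    then have "shift n (0 :: nat \<Rightarrow> 'a) \<in> ?W" by (rule imageI)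
    then show "0 \<in> ?W" by (simp only: shift_0)
    fix u f assume "u \<in> ?W"
    then obtain u' where u: "u = shift n u'" "u' \<in> fin_vecs m" by blast
    show "poly_act (dsum_mat A B) f u \<in> ?W" unfolding u(1) pa(2) using poly_act_in[OF C(3) u(2)] by blast
    fix v assume "v \<in> ?W"
    then obtain v' where v: "v = shift n v'" "v' \<in> fin_vecs m" by blast
    have "u' + v' \<in> fin_vecs m" using u v by (auto simp: fin_vecs_def)
    then show "u + v \<in> ?W" unfolding u(1) v(1) shift_add[symmetric] by blast
  qed
  have combS: "S.comb (gens bs) u (\<lambda>\<alpha>. shift n (x \<alpha>)) = shift n (Q.comb (gens bs) u x)" for u
  proof -
    have "shift n (\<Sum>\<alpha>\<in>I. f \<alpha>) = (\<Sum>\<alpha>\<in>I. shift n (f \<alpha>))" for f :: "nat \<times> bool \<Rightarrow> nat \<Rightarrow> 'a" and I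
      by (induction I rule: infinite_finite_induct) (simp_all add: shift_add del: plus_fun_apply zero_fun_apply)
    then show ?thesis by (simp only: S.comb_def Q.comb_def pa(2))
  qed
  have x1: "S.sframe ?W mu bs (\<lambda>\<alpha>. shift n (x \<alpha>))"
    unfolding S.frame_def S.frame_gens_def
  proof (intro conjI ballI allI)
    show "S.frame_data (gens bs) (ann cj bs) (twin bs) (form eps mu bs)" by (rule X'(1))
    fix w assume "w \<in> ?W"
    then obtain w' where w: "w = shift n w'" "w' \<in> fin_vecs m" by blast
    then obtain u where "w' = Q.comb (gens bs) u x" using sx by blast
    then show "\<exists>u. w = S.comb (gens bs) u (\<lambda>\<alpha>. shift n (x \<alpha>))" unfolding combS using w(1) by blast
  next
    fix \<alpha> assume a: "\<alpha> \<in> gens bs"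
    show "shift n (x \<alpha>) \<in> ?W" using X'(2)[OF a] by blast
    show "poly_act (dsum_mat A B) (ann cj bs \<alpha>) (shift n (x \<alpha>)) = 0" unfolding pa(2) X'(3)[OF a] by (rule shift_0)
    fix \<beta> g assume b: "\<beta> \<in> gens bs"
    show "mat_form cj (dsum_mat F G) (shift n (x (twin bs \<alpha>))) (poly_act (dsum_mat A B) g (shift n (x \<beta>))) =
      (if \<alpha> = \<beta> then top_coeff (ann cj bs \<alpha>) (form eps mu bs \<alpha> * g) else 0)"
      unfolding pa(2) form2 by (rule X'(4)[OF a b])
  qed
  have sub: "?W \<subseteq> fin_vecs (n + m)" using shift_fin by blast
  have orth: "mat_form cj (dsum_mat F G) (y t) w = 0" if t: "t \<in> sgens b" and w: "w \<in> ?W" for t w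
    using w unfolding form1[OF Y'(2)[OF t]] by (auto simp: mat_form_shift[OF C(2)])
  have split: "\<exists>u. w - S.comb (sgens b) u y \<in> ?W" if w: "w \<in> fin_vecs (n + m)" for w
  proof -
    obtain u where u: "head n w = P.comb (sgens b) u y" using sy head_fin by blast
    have "S.comb (sgens b) u y = P.comb (sgens b) u y"
      unfolding S.comb_def P.comb_def by (rule sum.cong[OF refl]) (rule pa(1)[OF Y'(2)])
    then have "w - S.comb (sgens b) u y = shift n (tail n w)"
      using head_shift_tail[of n w] u by (metis add_diff_cancel_left')
    then show ?thesis using tail_in[OF w] by blast
  qed
  from S.sframe_Cons[OF y1 x1 sub sm orth split] show ?thesis by auto
qed

end


section \<open>The canonical summands\<close>

lemma frobenius_companion:
  assumes "frobenius_block Phi"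
  shows "Phi = companion (char_poly Phi)" "monic (char_poly Phi)" "degree (char_poly Phi) > 0"
    "Phi \<in> carrier_mat (degree (char_poly Phi)) (degree (char_poly Phi))"
proof -
  show 1: "Phi = companion (char_poly Phi)" and "monic (char_poly Phi)" "degree (char_poly Phi) > 0"
    using assms prime_powerD unfolding frobenius_block_iff by auto
  show "Phi \<in> carrier_mat (degree (char_poly Phi)) (degree (char_poly Phi))"
    by (subst (1) 1) (simp add: companion_def)
qed

lemma frobenius_act:
  assumes "frobenius_block Phi"
  shows "poly_act Phi f (stdv 0) = coeff (f mod char_poly Phi)"
    "v \<in> fin_vecs (degree (char_poly Phi)) \<Longrightarrow> poly_act Phi (vec_poly (degree (char_poly Phi)) v) (stdv 0) = v"
    "poly_act Phi f (stdv 0) = 0 \<longleftrightarrow> char_poly Phi dvd f"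
proof -
  note F = frobenius_companion[OF assms]
  show 1: "poly_act Phi f (stdv 0) = coeff (f mod char_poly Phi)" for f
    using companion_poly_act[OF F(2,3)] F(1) by metis
  show "v \<in> fin_vecs (degree (char_poly Phi)) \<Longrightarrow> poly_act Phi (vec_poly (degree (char_poly Phi)) v) (stdv 0) = v"
    using companion_generates[OF F(2,3)] F(1) by metis
  have "coeff r = 0 \<longleftrightarrow> r = 0" for r :: "'a poly" by (auto simp: poly_eq_iff fun_eq_iff)
  then show "poly_act Phi f (stdv 0) = 0 \<longleftrightarrow> char_poly Phi dvd f"
    unfolding 1 by (simp only: dvd_eq_mod_eq_0)
qed

context involution
begin

lemma cstar_mult:
  assumes "A \<in> carrier_mat n m" "B \<in> carrier_mat m k"
  shows "cstar cj (A * B) = cstar cj B * cstar cj A"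
  by (rule eq_matI) (use assms in \<open>auto simp: cstar_def scalar_prod_def cj_sum cj_mult mult.commute\<close>)

text \<open>The Hankel matrix of the functional \<open>top_coeff q\<close> on K[x]/(q) serves as \<open>Phi_1\<close>.\<close>
lemma phi1_exists:
  assumes fb: "frobenius_block Phi" and bq: "bar (char_poly Phi) = char_poly Phi"
  shows "\<exists>M. is_phi1 cj Phi M"
proof -
  define q where "q = char_poly Phi"
  define n where "n = degree q"
  note F = frobenius_companion[OF fb, folded q_def, folded n_def] and act = frobenius_act[OF fb, folded q_def, folded n_def]
  have q0: "q \<noteq> 0" using F(3) n_def by auto
  define M where "M = mat n n (\<lambda>(i,j). top_coeff q (monom 1 (i + j)))"
  have M: "M \<in> carrier_mat n n" by (simp add: M_def)
  have small: "degree (r mod q) < n" for r using degree_mod_less[OF q0, of r] F(3) n_def by auto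
  have real: "cj (top_coeff q (monom 1 k)) = top_coeff q (monom 1 k)" for k
  proof -
    have "bar (monom 1 k) = monom 1 k" by (rule poly_eqI) (auto simp: coeff_bar)
    then show ?thesis using top_coeff_bar[of q "monom 1 k"] bq q_def by simp
  qed
  have Mact: "mat_act M (coeff r) i = top_coeff q (monom 1 i * r)" if "i < n" "degree r < n" for i r
  proof -
    have "r = (\<Sum>k<n. monom (coeff r k) k)"
      using that by (intro poly_eqI) (auto simp: coeff_sum coeff_eq_0)
    then have "top_coeff q (monom 1 i * r) = (\<Sum>k<n. top_coeff q (monom 1 i * monom (coeff r k) k))"
      by (metis sum_distrib_left top_coeff_sum)
    also have "\<dots> = (\<Sum>k<n. top_coeff q (monom 1 (i + k)) * coeff r k)"
    proof (rule sum.cong)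
      fix k
      have "monom 1 i * monom (coeff r k) k = Polynomial.smult (coeff r k) (monom 1 (i + k))"
        by (simp add: mult_monom smult_monom)
      then show "top_coeff q (monom 1 i * monom (coeff r k) k) = top_coeff q (monom 1 (i + k)) * coeff r k"
        by (simp add: top_coeff_smult mult.commute)
    qed simp
    finally show ?thesis using that by (simp add: mat_act_def M_def)
  qed
  \<comment> \<open>M Phi is again a Hankel matrix, with i + j replaced by i + j + 1. Symmetry of
    both matrices, together with \<open>real\<close>, makes them Hermitian.\<close>
  have MPhi: "(M * Phi) $$ (i,j) = top_coeff q (monom 1 (Suc (i + j)))" if ij: "i < n" "j < n" for i j
  proof -
    have "coeff (monom 1 j :: 'a poly) = stdv j" by (auto simp: stdv_def fun_eq_iff)
    moreover have "monom 1 j mod q = (monom 1 j :: 'a poly)"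
      using ij by (intro mod_poly_less) (simp add: degree_monom_eq n_def)
    ultimately have "stdv j = poly_act Phi (monom 1 j) (stdv 0)" using act(1)[of "monom 1 j"] by simp
    moreover have "mat_act Phi v = poly_act Phi [:0,1:] v" for v
      by (simp only: poly_act_pCons poly_act_0 scale_simps mat_act_0 add_0_left add_0_right)
    ultimately have "mat_act Phi (stdv j) = poly_act Phi ([:0,1:] * monom 1 j) (stdv 0)" by (simp only: poly_act_mult)
    also have "[:0,1:] * monom 1 j = (monom 1 (Suc j) :: 'a poly)" by (simp add: monom_Suc)
    finally have P: "mat_act Phi (stdv j) = coeff (monom 1 (Suc j) mod q)" by (simp only: act(1))
    have "(M * Phi) $$ (i,j) = mat_act M (mat_act Phi (stdv j)) i"
      using ij mat_act_stdv[of "M * Phi" n n i j] M F(4) by (simp add: mat_act_mult[OF M F(4)])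
    also have "\<dots> = top_coeff q (monom 1 i * (monom 1 (Suc j) mod q))"
      unfolding P by (rule Mact[OF ij(1) small])
    also have "\<dots> = top_coeff q (monom 1 i * monom 1 (Suc j))" by (simp add: top_coeff_def mod_mult_right_eq)
    finally show ?thesis by (simp add: mult_monom)
  qed
  have "det M \<noteq> 0"
  proof
    assume "det M = 0"
    then obtain v where v: "v \<in> carrier_vec n" "v \<noteq> 0\<^sub>v n" "M *\<^sub>v v = 0\<^sub>v n"
      using det_0_iff_vec_prod_zero_field[OF M] by blast
    \<comment> \<open>A kernel vector read as a polynomial is orthogonal to all monomials of degree
      below n, hence to all of K[x], so q divides it; its degree then makes it zero.\<close>
    define r where "r = vec_poly n (\<lambda>i. v $ i)"
    have dr: "degree r < n" using F(3) by (simp add: r_def n_def degree_vec_poly)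
    have cr: "coeff r k = v $ k" if "k < n" for k using that by (simp add: r_def coeff_vec_poly)
    have z: "top_coeff q (monom 1 i * r) = 0" if i: "i < n" for i
    proof -
      have "(M *\<^sub>v v) $ i = (\<Sum>j<n. M $$ (i,j) * v $ j)"
        using i v(1) M by (simp add: scalar_prod_def atLeast0LessThan)
      also have "\<dots> = mat_act M (coeff r) i" using i M cr by (simp add: mat_act_def)
      finally show ?thesis using v(3) i Mact[OF i dr] by simp
    qed
    have "q dvd r"
    proof (rule top_coeff_nondegenerate)
      show "0 < degree q" using F(3) n_def by simp
      fix g
      have e: "g mod q = (\<Sum>k<n. monom (coeff (g mod q) k) k)"
        using small[of g] by (intro poly_eqI) (auto simp: coeff_sum coeff_eq_0)
      have "(g mod q) * r = (\<Sum>k<n. monom (coeff (g mod q) k) k * r)"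
        by (subst (1) e) (rule sum_distrib_right)
      then have "top_coeff q ((g mod q) * r) = (\<Sum>k<n. top_coeff q (monom (coeff (g mod q) k) k * r))"
        by (simp only: top_coeff_sum)
      also have "\<dots> = 0"
      proof (rule sum.neutral, rule ballI)
        fix k assume "k \<in> {..<n}"
        moreover have "monom (coeff (g mod q) k) k * r = Polynomial.smult (coeff (g mod q) k) (monom 1 k * r)"
          by (metis mult_smult_left smult_monom mult_1_right)
        ultimately show "top_coeff q (monom (coeff (g mod q) k) k * r) = 0" using z by (simp add: top_coeff_smult)
      qed
      finally show "top_coeff q (r * g) = 0" by (simp add: top_coeff_def mod_mult_left_eq mult.commute[of r])
    qed
    then have "r = 0" using dvd_imp_degree_le[of q r] dr n_def by (cases "r = 0") auto
    then have "v = 0\<^sub>v n" using v(1) cr by (intro eq_vecI) auto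
    with v(2) show False by simp
  qed
  moreover have "M = cstar cj M"
    by (rule eq_matI) (auto simp: M_def cstar_def real add.commute)
  moreover have "M * Phi = cstar cj (M * Phi)"
  proof (rule eq_matI)
    fix i j assume "i < dim_row (cstar cj (M * Phi))" "j < dim_col (cstar cj (M * Phi))"
    then have ij: "i < n" "j < n" using M F(4) by (auto simp: cstar_def)
    have "cstar cj (M * Phi) $$ (i,j) = cj ((M * Phi) $$ (j,i))" using ij M F(4) by (simp add: cstar_def)
    then show "(M * Phi) $$ (i,j) = cstar cj (M * Phi) $$ (i,j)" using ij by (simp only: MPhi real add.commute)
  qed (use M F(4) in \<open>auto simp: cstar_def\<close>)
  moreover have "dim_row Phi = n" using F(4) by simp
  ultimately show ?thesis using M unfolding is_phi1_def by blast
qed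

end

section \<open>The matrix Phi_1 and the canonical summands as modules\<close>

context herm_setting
begin

lemma phi1_herm_pair:
  assumes e1: "eps = 1" and fb: "frobenius_block Phi" and M: "is_phi1 cj Phi M"
  shows "herm_pair (degree (char_poly Phi)) Phi M"
proof -
  note F = frobenius_companion[OF fb]
  let ?n = "degree (char_poly Phi)"
  have m: "M \<in> carrier_mat ?n ?n" "det M \<noteq> 0" "M = cstar cj M" "M * Phi = cstar cj (M * Phi)"
    using M F(4) unfolding is_phi1_def by auto
  show ?thesis
  proof (rule herm_pairI[OF F(4) m(1,2)])
    have "eps \<cdot>\<^sub>m M = M" using e1 by (intro eq_matI) auto
    then show "cstar cj M = eps \<cdot>\<^sub>m M" using m(3) by simp
    show "M * Phi = cstar cj Phi * M" using m(3,4) cstar_mult[OF m(1) F(4)] by metis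
  qed
qed

text \<open>\<open>stdv 0\<close> generates the module, so testing against it with all polynomials
  tests against all vectors.\<close>

lemma herm_pair_generator_nondegenerate:
  assumes fb: "frobenius_block Phi" and H: "herm_pair (degree (char_poly Phi)) Phi M"
    and z: "\<And>g. mat_form cj M (stdv 0) (poly_act Phi g (poly_act Phi f (stdv 0))) = 0"
  shows "char_poly Phi dvd f"
proof -
  interpret herm_module cj eps "poly_act Phi" "mat_form cj M" by (rule herm_pair_module[OF H])
  note F = frobenius_companion[OF fb] and act = frobenius_act[OF fb]
  let ?n = "degree (char_poly Phi)"
  have s0: "stdv 0 \<in> fin_vecs ?n" using F(3) by (simp add: stdv_in)
  have "mat_form cj M w (poly_act Phi f (stdv 0)) = 0" if w: "w \<in> fin_vecs ?n" for w
  proof -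
    define u where "u = vec_poly ?n w"
    have "w = poly_act Phi u (stdv 0)" unfolding u_def using act(2)[OF w] by simp
    then show ?thesis using z[of "bar u"] by (simp add: h_adj)
  qed
  then have "poly_act Phi f (stdv 0) = 0"
    using H poly_act_in[OF F(4) s0] unfolding herm_pair_def by blast
  then show ?thesis using act(3)[of f] by simp
qed

text \<open>Converse to \<open>phi1_exists\<close>: since chi_Phi kills the generator, its conjugate
  does so by adjunction and nondegeneracy. The two polynomials then divide each other, and both are
  monic.\<close>

lemma phi1_selfdual:
  assumes e1: "eps = 1" and fb: "frobenius_block Phi" and M: "is_phi1 cj Phi M"
  shows "bar (char_poly Phi) = char_poly Phi"
proof -
  note H = phi1_herm_pair[OF assms] and F = frobenius_companion[OF fb] and act = frobenius_act[OF fb]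
  interpret herm_module cj eps "poly_act Phi" "mat_form cj M" by (rule herm_pair_module[OF H])
  have chi0: "poly_act Phi (char_poly Phi) (stdv 0) = 0" using act(3)[of "char_poly Phi"] by simp
  have "char_poly Phi dvd bar (char_poly Phi)"
  proof (rule herm_pair_generator_nondegenerate[OF fb H])
    fix g
    have "poly_act Phi g (poly_act Phi (bar (char_poly Phi)) (stdv 0)) = poly_act Phi (bar (char_poly Phi)) (poly_act Phi g (stdv 0))"
      by (rule act_comm)
    then show "mat_form cj M (stdv 0) (poly_act Phi g (poly_act Phi (bar (char_poly Phi)) (stdv 0))) = 0"
      by (simp only: h_adj[symmetric] chi0 mat_form_0)
  qed
  moreover from this have "bar (char_poly Phi) dvd char_poly Phi" using bar_dvd_bar[of "char_poly Phi" "bar (char_poly Phi)"] by simp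
  ultimately show ?thesis using F(2) bar_monic[OF F(2)] by (intro poly_dvd_antisym) auto
qed

lemma valid_summand_iff: "valid_summand cj eps b \<longleftrightarrow> good_summand cj eps b"
proof (cases b)
  case (TypeI Phi)
  then show ?thesis using phi1_exists phi1_selfdual by auto
next
  case (TypeII Phi f)
  then show ?thesis using phi1_exists phi1_selfdual by auto
qed

text \<open>The polynomial that serves as mu for the chosen matrices: it records the form of
  \<open>phi1 Phi\<close> on the cyclic generator \<open>stdv 0\<close>. Its existence comes from
  \<open>h_represent\<close>.\<close>

definition phi1_form :: "('a mat \<Rightarrow> 'a mat) \<Rightarrow> 'a mat \<Rightarrow> 'a poly" where
  "phi1_form phi1 Phi = (SOME g. degree g < degree (char_poly Phi)
     \<and> (\<forall>u. mat_form cj (phi1 Phi) (stdv 0) (poly_act Phi u (stdv 0)) = top_coeff (char_poly Phi) (g * u)))"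

text \<open>Selfconjugacy reflects the symmetry of the form, as for J in \<open>split_off\<close>.
  If p_Phi divided the polynomial, the nonzero vector p_Phi^(k-1) \<open>stdv 0\<close> would be
  orthogonal to everything.\<close>

lemma phi1_form:
  assumes e1: "eps = 1" and fb: "frobenius_block Phi" and M: "is_phi1 cj Phi (phi1 Phi)"
  shows "mat_form cj (phi1 Phi) (stdv 0) (poly_act Phi u (stdv 0)) = top_coeff (char_poly Phi) (phi1_form phi1 Phi * u)"
    "bar (phi1_form phi1 Phi) = phi1_form phi1 Phi" "\<not> p_of Phi dvd phi1_form phi1 Phi"
proof -
  note H = phi1_herm_pair[OF assms] and F = frobenius_companion[OF fb] and act = frobenius_act[OF fb]
    and bq = phi1_selfdual[OF assms]
  interpret herm_module cj eps "poly_act Phi" "mat_form cj (phi1 Phi)" by (rule herm_pair_module[OF H])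
  let ?q = "char_poly Phi" and ?g = "phi1_form phi1 Phi" and ?e = "stdv 0 :: nat \<Rightarrow> 'a"
  have "\<exists>g. degree g < degree ?q \<and> (\<forall>u. mat_form cj (phi1 Phi) ?e (poly_act Phi u ?e) = top_coeff ?q (g * u))"
    by (rule h_represent[OF F(3)]) (use act(3)[of "char_poly Phi"] in simp)
  then have G: "degree ?g < degree ?q \<and> (\<forall>u. mat_form cj (phi1 Phi) ?e (poly_act Phi u ?e) = top_coeff ?q (?g * u))"
    unfolding phi1_form_def by (rule someI_ex)
  have g: "degree ?g < degree ?q" "mat_form cj (phi1 Phi) ?e (poly_act Phi u ?e) = top_coeff ?q (?g * u)" for u
    by (rule conjunct1[OF G], rule spec[OF conjunct2[OF G]])
  show "mat_form cj (phi1 Phi) ?e (poly_act Phi u ?e) = top_coeff ?q (?g * u)" by (rule g(2))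
  have "?q dvd ?g - bar ?g"
  proof (rule top_coeff_nondegenerate[OF F(3)])
    fix u
    have "top_coeff ?q (?g * u) = cj (top_coeff ?q (?g * bar u))"
      using h_sym_act[of ?e u ?e] e1 by (simp add: g(2))
    also have "\<dots> = top_coeff ?q (bar ?g * u)" using top_coeff_bar[of ?q "?g * bar u"] bq by (simp add: bar_mult)
    finally show "top_coeff ?q ((?g - bar ?g) * u) = 0" by (simp add: left_diff_distrib top_coeff_diff)
  qed
  moreover have "degree (?g - bar ?g) \<le> degree ?g" by (rule degree_diff_le) auto
  ultimately show "bar ?g = ?g" using g(1) dvd_imp_degree_le[of ?q "?g - bar ?g"] by fastforce
  obtain k where k: "irreducible (p_of Phi)" "monic (p_of Phi)" "0 < k" "?q = p_of Phi ^ k"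
    using prime_base_frobenius[OF fb] by blast
  show "\<not> p_of Phi dvd ?g"
  proof
    assume p: "p_of Phi dvd ?g"
    have qk: "?q = p_of Phi * p_of Phi ^ (k - 1)" using k(3,4) by (simp add: power_eq_if)
    have "?q dvd p_of Phi ^ (k - 1)"
    proof (rule herm_pair_generator_nondegenerate[OF fb H])
      fix u
      have "?q dvd ?g * (u * p_of Phi ^ (k - 1))" unfolding qk using p by (intro mult_dvd_mono) auto
      then show "mat_form cj (phi1 Phi) ?e (poly_act Phi u (poly_act Phi (p_of Phi ^ (k - 1)) ?e)) = 0"
        by (simp only: act_mult[symmetric] g(2) top_coeff_dvd)
    qed
    moreover have p0: "p_of Phi \<noteq> 0" using k(1) by auto
    ultimately have "degree ?q \<le> degree (p_of Phi ^ (k - 1))" by (intro dvd_imp_degree_le) auto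
    moreover have "degree ?q = degree (p_of Phi) + degree (p_of Phi ^ (k - 1))"
      using p0 by (subst qk) (simp add: degree_mult_eq)
    ultimately show False using irreducible_degree_pos[OF k(1)] by simp
  qed
qed

text \<open>f(Phi) acts on the cyclic module as multiplication by f, so the recorded polynomial
  changes from mu to mu f. The form stays nondegenerate because f, being nonzero of degree below deg
  p_Phi, is prime to p_Phi.\<close>

lemma gframe_TypeII:
  assumes g: "good_summand cj eps (TypeII Phi f)" and M: "is_phi1 cj Phi (phi1 Phi)"
    and mu: "form_units cj eps (phi1_form phi1)"
  shows "gframe (degree (char_poly Phi)) (summand_pair cj eps phi1 (TypeII Phi f)) (phi1_form phi1) (TypeII Phi f)"
proof -
  have e1: "eps = 1" and fb: "frobenius_block Phi" and bf: "bar f = f" using g by auto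
  note H = phi1_herm_pair[OF e1 fb M] and F = frobenius_companion[OF fb] and act = frobenius_act[OF fb]
  interpret herm_module cj eps "poly_act Phi" "mat_form cj (phi1 Phi)" by (rule herm_pair_module[OF H])
  let ?n = "degree (char_poly Phi)" and ?F = "phi1 Phi * poly_mat f Phi"
  have Mc: "phi1 Phi \<in> carrier_mat ?n ?n" using H unfolding herm_pair_def by blast
  note P = poly_mat_act[OF F(4), of f]
  have form: "mat_form cj ?F u v = mat_form cj (phi1 Phi) u (poly_act Phi f v)" for u v
  proof -
    have "mat_act ?F v = mat_act (phi1 Phi) (mat_act (1\<^sub>m ?n) (poly_act Phi f v))"
      by (simp only: mat_act_mult[OF Mc P(2)] P(1))
    also have "\<dots> = mat_act (phi1 Phi) (poly_act Phi f v)"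
      using Mc by (intro mat_act_cong) (simp add: mat_act_one)
    finally show ?thesis using Mc by (simp add: mat_form_def)
  qed
  have s0: "stdv 0 \<in> fin_vecs ?n" using F(3) by (simp add: stdv_in)
  obtain k where k: "irreducible (p_of Phi)" "monic (p_of Phi)" "0 < k" "char_poly Phi = p_of Phi ^ k"
    using prime_base_frobenius[OF fb] by blast
  have HF: "herm_pair ?n Phi ?F"
    unfolding herm_pair_def
  proof (intro conjI allI ballI impI)
    show "Phi \<in> carrier_mat ?n ?n" "?F \<in> carrier_mat ?n ?n" using F(4) Mc P(2) by auto
    fix u v
    show "mat_form cj ?F v u = eps * cj (mat_form cj ?F u v)"
      unfolding form using h_sym_act[of v f u] by (simp add: bf)
    have "mat_form cj (phi1 Phi) (mat_act Phi u) w = mat_form cj (phi1 Phi) u (mat_act Phi w)" for w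
      using H unfolding herm_pair_def by blast
    then show "mat_form cj ?F (mat_act Phi u) v = mat_form cj ?F u (mat_act Phi v)"
      unfolding form by (simp only: poly_act_mat)
  next
    fix u assume u: "u \<in> fin_vecs ?n" and z: "\<forall>w\<in>fin_vecs ?n. mat_form cj ?F w u = 0"
    define c where "c = vec_poly ?n u"
    have uc: "u = poly_act Phi c (stdv 0)" unfolding c_def using act(2)[OF u] by simp
    have "char_poly Phi dvd f * c"
    proof (rule herm_pair_generator_nondegenerate[OF fb H])
      fix b
      have "mat_form cj ?F (poly_act Phi (bar b) (stdv 0)) u = 0" using z poly_act_in[OF F(4) s0] by blast
      then show "mat_form cj (phi1 Phi) (stdv 0) (poly_act Phi b (poly_act Phi (f * c) (stdv 0))) = 0"
        unfolding form h_adj uc by (simp add: act_mult)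
    qed
    then have "char_poly Phi dvd c"
      unfolding k(4) using power_dvd_cancel[OF k(1) good_form_unit(1)[OF g mu]] by blast
    then show "u = 0" unfolding uc using act(3)[of c] by simp
  qed
  interpret G: herm_module cj eps "poly_act Phi" "mat_form cj ?F" by (rule herm_pair_module[OF HF])
  have "G.sgenerators (fin_vecs ?n) (phi1_form phi1) (TypeII Phi f) (\<lambda>t. stdv 0)"
  proof (rule G.sgenerators_TypeII[OF g mu s0])
    show "poly_act Phi (char_poly Phi) (stdv 0) = 0" using act(3)[of "char_poly Phi"] by simp
    fix b
    show "mat_form cj ?F (stdv 0) (poly_act Phi b (stdv 0)) = top_coeff (char_poly Phi) (phi1_form phi1 Phi * f * b)"
      unfolding form act_mult[symmetric] phi1_form(1)[where ?phi1.0 = phi1, OF e1 fb M] by (simp add: mult.assoc)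
  qed
  moreover have "\<exists>u. w = G.comb (sgens (TypeII Phi f)) u (\<lambda>t. stdv 0)" if w: "w \<in> fin_vecs ?n" for w
    by (rule exI[of _ "\<lambda>t. vec_poly ?n w"]) (use act(2)[OF w] in \<open>simp add: G.comb_def\<close>)
  ultimately have "G.frame (fin_vecs ?n) (sgens (TypeII Phi f)) (sann cj (TypeII Phi f)) (stwin (TypeII Phi f))
      (sform eps (phi1_form phi1) (TypeII Phi f)) (\<lambda>t. stdv 0)" unfolding G.frame_def by blast
  then show ?thesis unfolding gframe_def using HF by (simp only: summand_pair.simps fst_conv snd_conv) blast
qed

text \<open>Both halves of the space are isotropic, the first is the cyclic module of Phi, and the
  form makes the second its conjugate dual. That the dual is cyclic as well reflects that
  \<open>top_coeff\<close> generates all functionals.\<close>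

lemma gframe_TypeI:
  assumes g: "good_summand cj eps (TypeI Phi)" and mu: "form_units cj eps mu"
  defines "n \<equiv> degree (char_poly Phi)"
  shows "gframe (n + n) (summand_pair cj eps phi1 (TypeI Phi)) mu (TypeI Phi)"
proof -
  have fb: "frobenius_block Phi" using g by simp
  note F = frobenius_companion[OF fb, folded n_def] and act = frobenius_act[OF fb, folded n_def]
  note F4 = F(4)
  have Pc: "Phi \<in> carrier_mat n n" using F(4) unfolding n_def .
  let ?A = "dsum_mat Phi (cstar cj Phi)"
  let ?F = "four_block_mat (0\<^sub>m n n) (eps \<cdot>\<^sub>m 1\<^sub>m n) (1\<^sub>m n) (0\<^sub>m n n)"
  have A: "?A \<in> carrier_mat (n + n) (n + n)" by (rule dsum_mat_carrier[OF Pc cstar_carrier[OF Pc]])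
  have Fc: "?F \<in> carrier_mat (n + n) (n + n)" by simp
  note Aact = mat_act_dsum[OF Pc cstar_carrier[OF Pc]]
    and pact = poly_act_dsum[OF Pc cstar_carrier[OF Pc]]
  have Fact: "mat_act ?F v i = (if i < n then eps * v (n + i) else if i < n + n then v (i - n) else 0)" for v i
  proof -
    have d: "(\<Sum>j<n. (if i = j then 1 else 0) * v' j) = (if i < n then v' i else 0)" for i and v' :: "nat \<Rightarrow> 'a"
    proof -
      have "(\<Sum>j<n. (if i = j then 1 else 0) * v' j) = (\<Sum>j<n. if i = j then v' j else 0)" by (rule sum.cong) auto
      then show ?thesis by simp
    qed
    show ?thesis
    proof (cases "i < n")
      case True
      then have "mat_act ?F v i = (\<Sum>j<n. eps * ((if i = j then 1 else 0) * v (n + j)))"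
        by (simp add: mat_act_def sum_lessThan_split mult.assoc)
      also have "\<dots> = eps * (\<Sum>j<n. (if i = j then 1 else 0) * v (n + j))" by (rule sum_distrib_left[symmetric])
      finally show ?thesis using d[of i "\<lambda>j. v (n + j)"] True by simp
    next
      case False
      show ?thesis
      proof (cases "i < n + n")
        case True
        have lt: "i - n < n" using True False by simp
        have "mat_act ?F v i = (\<Sum>j<n. (if i - n = j then 1 else 0) * v j)"
          using False True lt by (simp add: mat_act_def sum_lessThan_split)
        then show ?thesis using d[of "i - n" v] lt False True by simp
      qed (use False in \<open>simp add: mat_act_def\<close>)
    qed
  qed
  have form: "mat_form cj ?F u v = eps * pairing cj n u (tail n v) + pairing cj n (tail n u) v" for u v
  proof -
    have "pairing cj n u (mat_act ?F v) = pairing cj n u (scale eps (tail n v))"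
      by (rule pairing_cong) (auto simp: Fact scale_apply tail_def)
    moreover have "pairing cj n (tail n u) (tail n (mat_act ?F v)) = pairing cj n (tail n u) v"
      by (rule pairing_cong) (auto simp: Fact tail_def)
    ultimately show ?thesis by (simp add: mat_form_def pairing_split pairing_scale)
  qed
  have pd: "pairing cj n u (mat_act Phi w) = pairing cj n (mat_act (cstar cj Phi) u) w" for u w
    using pairing_adjoint[OF Pc, of w u] pairing_sym by metis
  have t0: "tail n (mat_act Phi v) = 0" for v by (rule tail_fin[OF mat_act_in[OF Pc]])
  have hp: "pairing cj n u (mat_act Phi v + shift n w) = pairing cj n u (mat_act Phi v)"
    "pairing cj n (mat_act Phi v + shift n w) u = pairing cj n (mat_act Phi v) u" for u v w
    by (rule pairing_cong; simp add: shift_def)+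
  have HF: "herm_pair (n + n) ?A ?F"
    unfolding herm_pair_def
  proof (intro conjI allI ballI impI)
    show "?A \<in> carrier_mat (n + n) (n + n)" "?F \<in> carrier_mat (n + n) (n + n)" using A Fc by auto
    fix u v
    have ce: "cj eps = eps" using eps by (auto simp: cj_minus)
    show "mat_form cj ?F v u = eps * cj (mat_form cj ?F u v)"
      unfolding form by (simp add: cj_add cj_mult pairing_sym ce distrib_left eps2)
    show "mat_form cj ?F (mat_act ?A u) v = mat_form cj ?F u (mat_act ?A v)"
      unfolding form Aact tail_add t0 tail_shift add_0_left hp pd pairing_adjoint[OF Pc] ..
  next
    fix u assume u: "u \<in> fin_vecs (n + n)" and z: "\<forall>w\<in>fin_vecs (n + n). mat_form cj ?F w u = 0"
    have ui: "mat_act ?F u i = 0" if i: "i < n + n" for i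
      using z[rule_format, OF stdv_in[OF i]] i by (simp add: mat_form_def pairing_stdv)
    have "u i = 0" for i
    proof (cases "i < n")
      case True
      then show ?thesis using ui[of "n + i"] by (simp add: Fact)
    next
      case False
      show ?thesis
      proof (cases "i < n + n")
        case True
        then have "i - n < n" "n + (i - n) = i" using False by auto
        then show ?thesis using ui[of "i - n"] eps by (auto simp: Fact)
      qed (use u in \<open>simp add: fin_vecs_def\<close>)
    qed
    then show "u = 0" by (simp add: fun_eq_iff)
  qed
  interpret herm_module cj eps "poly_act ?A" "mat_form cj ?F" by (rule herm_pair_module[OF HF])
  let ?q = "char_poly Phi"
  have n0: "0 < n" using F(3) by (simp add: n_def)
  define d where "d = (stdv 0 :: nat \<Rightarrow> 'a)"
  \<comment> \<open>Pairing with the last standard vector of the second half extracts the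
    coefficient of x^(n-1), so e represents \<open>top_coeff\<close> on the first half.\<close>
  define e where "e = shift n (stdv (n - 1) :: nat \<Rightarrow> 'a)"
  have dn: "d \<in> fin_vecs n" using n0 by (simp add: d_def stdv_in)
  have dW: "d \<in> fin_vecs (n + n)" by (rule fin_vecs_mono[OF dn])
  have eW: "e \<in> fin_vecs (n + n)" unfolding e_def using n0 by (intro shift_fin stdv_in) simp
  have gd: "poly_act ?A f d = coeff (f mod ?q)" for f
    unfolding pact(1)[OF dn] unfolding d_def by (rule act(1))
  have gdn: "poly_act ?A f d \<in> fin_vecs n" for f
    unfolding pact(1)[OF dn] by (rule poly_act_in[OF Pc dn])
  have ge: "poly_act ?A f e = shift n (poly_act (cstar cj Phi) f (stdv (n - 1)))" for f
    unfolding e_def by (rule pact(2))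
  have first: "mat_form cj ?F u v = 0" if "u \<in> fin_vecs n" "v \<in> fin_vecs n" for u v
    unfolding form tail_fin[OF that(1)] tail_fin[OF that(2)] by simp
  have pshift: "pairing cj n (shift n u) v = 0" "pairing cj n v (shift n u) = 0" for u v :: "nat \<Rightarrow> 'a"
    by (simp_all add: pairing_def shift_def)
  have second: "mat_form cj ?F (shift n u) (shift n v) = 0" for u v
    unfolding form pshift tail_shift by simp
  have ed: "mat_form cj ?F e (poly_act ?A f d) = top_coeff ?q f" for f
    using n0 unfolding form tail_fin[OF gdn] unfolding e_def tail_shift gd
    by (simp add: pairing_stdv top_coeff_def n_def)
  have span1: "\<exists>f. v = poly_act ?A f d" if "v \<in> fin_vecs n" for v
    unfolding pact(1)[OF dn] unfolding d_def by (rule exI[of _ "vec_poly n v"]) (rule act(2)[OF that, symmetric])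
  have qd: "poly_act ?A ?q d = 0" unfolding gd by (simp add: fun_eq_iff)
  \<comment> \<open>Read off from the form: the vector is orthogonal to the first half because
    chi_Phi kills d, and to the second half because that half is isotropic.\<close>
  have qe: "poly_act ?A (bar ?q) e = 0"
  proof -
    have "mat_form cj ?F w (poly_act ?A (bar ?q) e) = 0" if w: "w \<in> fin_vecs (n + n)" for w
    proof -
      obtain f where f: "head n w = poly_act ?A f d" using span1[OF head_fin] by blast
      have "mat_form cj ?F (head n w) (poly_act ?A (bar ?q) e) = 0"
        unfolding f h_adj[symmetric] act_comm[of ?q] qd by simp
      moreover have "mat_form cj ?F (shift n (tail n w)) (poly_act ?A (bar ?q) e) = 0"
        unfolding ge by (rule second)
      ultimately have "mat_form cj ?F (head n w + shift n (tail n w)) (poly_act ?A (bar ?q) e) = 0"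
        by (simp only: h_add_left add_0_left)
      then show ?thesis by (simp only: head_shift_tail)
    qed
    moreover have "poly_act ?A (bar ?q) e \<in> fin_vecs (n + n)" by (rule poly_act_in[OF A eW])
    ultimately show ?thesis using HF unfolding herm_pair_def by blast
  qed
  have gens: "sgenerators (fin_vecs (n + n)) mu (TypeI Phi) (\<lambda>t. if t then e else d)"
  proof (rule sgenerators_TypeI[OF g mu dW eW qd qe ed])
    show "mat_form cj ?F d (poly_act ?A f d) = 0" for f by (rule first[OF dn gdn])
    show "mat_form cj ?F e (poly_act ?A f e) = 0" for f unfolding ge unfolding e_def by (rule second)
  qed
  \<comment> \<open>Spanning is obtained from the projection: the remainder r is orthogonal to all
    multiples of d, which removes its second half, and then to all multiples of e, which removes the
    rest.\<close>
  have "\<exists>u. w = comb (sgens (TypeI Phi)) u (\<lambda>t. if t then e else d)" if w: "w \<in> fin_vecs (n + n)" for w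
  proof -
    obtain u where u: "\<forall>\<alpha>\<in>sgens (TypeI Phi). \<forall>f. mat_form cj ?F (if \<alpha> then e else d)
        (poly_act ?A f (w - comb (sgens (TypeI Phi)) u (\<lambda>t. if t then e else d))) = 0"
      using frame_proj[OF gens] by blast
    define r where "r = w - comb (sgens (TypeI Phi)) u (\<lambda>t. if t then e else d)"
    have ud: "mat_form cj ?F d (poly_act ?A f r) = 0" for f using u[rule_format, of False f] by (simp add: r_def)
    have ue: "mat_form cj ?F e (poly_act ?A f r) = 0" for f using u[rule_format, of True f] by (simp add: r_def)
    have sub: "submodule (fin_vecs (n + n))" by (rule fin_vecs_submodule(1)[OF HF])
    have "comb (sgens (TypeI Phi)) u (\<lambda>t. if t then e else d) \<in> fin_vecs (n + n)"
      by (rule comb_in[OF sub]) (use dW eW in auto)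
    then have rW: "r \<in> fin_vecs (n + n)" unfolding r_def by (rule submodule_diff[OF sub w])
    have "tail n r i = 0" for i
    proof (cases "i < n")
      case True
      obtain f where f: "stdv i = poly_act ?A f d" using span1[OF stdv_in[OF True]] by blast
      have "mat_form cj ?F (stdv i) r = mat_form cj ?F d (poly_act ?A (bar f) r)" unfolding f by (rule h_adj)
      then have "eps * tail n r i = 0" using ud True unfolding form tail_fin[OF stdv_in[OF True]] by (simp add: pairing_stdv)
      then show ?thesis using eps by auto
    next
      case False
      then show ?thesis using rW by (simp add: tail_def fin_vecs_def)
    qed
    then have "tail n r = 0" by (simp add: fun_eq_iff)
    then have "r = head n r" using head_shift_tail[of n r] by (simp only: shift_0 add_0_right)
    then have "r \<in> fin_vecs n" using head_fin by metis
    then obtain f where f: "r = poly_act ?A f d" using span1 by blast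
    have "top_coeff ?q (f * b) = 0" for b
      using ue[of b] unfolding f act_mult[symmetric] ed by (simp add: mult.commute)
    then have "?q dvd f" by (rule top_coeff_nondegenerate[OF F(3)[unfolded n_def]])
    then have "r = 0" unfolding f by (rule act_dvd[OF _ qd])
    then show ?thesis unfolding r_def by auto
  qed
  with gens have "frame (fin_vecs (n + n)) (sgens (TypeI Phi)) (sann cj (TypeI Phi)) (stwin (TypeI Phi))
      (sform eps mu (TypeI Phi)) (\<lambda>t. if t then e else d)" unfolding frame_def by blast
  moreover have "summand_pair cj eps phi1 (TypeI Phi) = (?A, ?F)" using Pc by simp
  ultimately show ?thesis unfolding gframe_def using HF by (simp only: fst_conv snd_conv) blast
qed

lemma canonical_pair_frame:
  assumes phi1: "\<And>Phi. frobenius_block Phi \<Longrightarrow> (\<exists>M. is_phi1 cj Phi M) \<Longrightarrow> is_phi1 cj Phi (phi1 Phi)"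
    and mu: "form_units cj eps (phi1_form phi1)"
  shows "\<forall>b\<in>set bs. good_summand cj eps b \<Longrightarrow>
    \<exists>n. herm_pair n (fst (canonical_pair cj eps phi1 bs)) (snd (canonical_pair cj eps phi1 bs))
      \<and> (\<exists>x. pframe n (canonical_pair cj eps phi1 bs) (phi1_form phi1) bs x)"
proof (induction bs)
  case Nil
  have f0: "fin_vecs 0 = {0 :: nat \<Rightarrow> 'a}" by (auto simp: fin_vecs_def fun_eq_iff)
  have H: "herm_pair 0 (0\<^sub>m 0 0) (0\<^sub>m 0 0)" unfolding herm_pair_def f0 by (simp add: mat_form_def pairing_def)
  interpret herm_module cj eps "poly_act (0\<^sub>m 0 0)" "mat_form cj (0\<^sub>m 0 0)" by (rule herm_pair_module[OF H])
  show ?case using H sframe_Nil[of "phi1_form phi1"] f0 by (intro exI[of _ 0]) (simp add: canonical_pair_def)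
next
  case (Cons b bs)
  let ?P = "canonical_pair cj eps phi1 bs" and ?b = "summand_pair cj eps phi1 b"
  obtain m x where m: "herm_pair m (fst ?P) (snd ?P)" "pframe m ?P (phi1_form phi1) bs x" using Cons by auto
  have "\<exists>n. gframe n ?b (phi1_form phi1) b"
  proof (cases b)
    case (TypeI Phi)
    then show ?thesis using gframe_TypeI[OF _ mu, of Phi phi1] Cons.prems by auto
  next
    case (TypeII Phi f)
    then have g: "good_summand cj eps (TypeII Phi f)" using Cons.prems by simp
    then have "is_phi1 cj Phi (phi1 Phi)" using phi1 phi1_exists by auto
    then show ?thesis using gframe_TypeII[OF g _ mu] TypeII by blast
  qed
  then obtain n where n: "gframe n (fst ?b, snd ?b) (phi1_form phi1) b" by auto
  have c: "canonical_pair cj eps phi1 (b # bs) = (dsum_mat (fst ?b) (fst ?P), dsum_mat (snd ?b) (snd ?P))"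
    by (simp add: canonical_pair_def)
  have "herm_pair (n + m) (dsum_mat (fst ?b) (fst ?P)) (dsum_mat (snd ?b) (snd ?P))"
    by (rule herm_pair_dsum[OF _ m(1)]) (use n in \<open>simp add: gframe_def\<close>)
  moreover have "\<exists>z. pframe (n + m) (dsum_mat (fst ?b) (fst ?P), dsum_mat (snd ?b) (snd ?P)) (phi1_form phi1) (b # bs) z"
    by (rule pframe_dsum[OF n m(1)]) (use m(2) in simp)
  ultimately show ?case unfolding c by auto
qed

end

theorem theorem6:
  fixes cj :: "'a::field \<Rightarrow> 'a" and eps :: 'a and phi1 :: "'a mat \<Rightarrow> 'a mat"
  assumes inv: "is_involution cj"
    and char: "(2::'a) \<noteq> 0"
    and eps: "eps = 1 \<or> eps = -1"
    and eps_inv: "cj \<noteq> id \<longrightarrow> eps = 1"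
    and phi1: "\<And>Phi. frobenius_block Phi \<Longrightarrow> (\<exists>M. is_phi1 cj Phi M) \<Longrightarrow> is_phi1 cj Phi (phi1 Phi)"
  shows "(\<forall>n A F. A \<in> carrier_mat n n \<and> F \<in> carrier_mat n n \<and> det F \<noteq> 0
            \<and> cstar cj F = eps \<cdot>\<^sub>m F \<and> F * A = cstar cj A * F
          \<longrightarrow> (\<exists>bs. (\<forall>b\<in>set bs. valid_summand cj eps b)
                  \<and> pair_equiv cj (A, F) (canonical_pair cj eps phi1 bs)))
       \<and> (\<forall>bs cs. (\<forall>b\<in>set bs. valid_summand cj eps b) \<and> (\<forall>c\<in>set cs. valid_summand cj eps c)
          \<longrightarrow> (pair_equiv cj (canonical_pair cj eps phi1 bs) (canonical_pair cj eps phi1 cs)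
               \<longleftrightarrow> summands_related cj bs cs))"
proof -
  interpret herm_setting cj eps by unfold_locales (fact inv char eps eps_inv)+
  define mu where "mu = phi1_form phi1"
  have mu: "form_units cj eps mu"
    unfolding form_units_def mu_def using phi1_form(2,3)[where ?phi1.0 = phi1] phi1 phi1_exists by blast
  have canon: "\<exists>n x. herm_pair n (fst (canonical_pair cj eps phi1 bs)) (snd (canonical_pair cj eps phi1 bs))
      \<and> pframe n (canonical_pair cj eps phi1 bs) mu bs x" if "\<forall>b\<in>set bs. good_summand cj eps b" for bs
    using canonical_pair_frame[OF phi1 mu[unfolded mu_def] that] unfolding mu_def by blast
  show ?thesis unfolding valid_summand_iff
  proof (intro conjI allI impI)
    fix n A F
    assume *: "A \<in> carrier_mat n n \<and> F \<in> carrier_mat n n \<and> det F \<noteq> 0 \<and> cstar cj F = eps \<cdot>\<^sub>m F \<and> F * A = cstar cj A * F"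
    then have H: "herm_pair n A F" by (intro herm_pairI) auto
    obtain bs x where bs: "\<forall>b\<in>set bs. good_summand cj eps b" and x: "pframe n (A, F) mu bs x"
      using pframe_exists[OF H mu] by blast
    obtain m y where y: "herm_pair m (fst (canonical_pair cj eps phi1 bs)) (snd (canonical_pair cj eps phi1 bs))"
      "pframe m (canonical_pair cj eps phi1 bs) mu bs y" using canon[OF bs] by blast
    have "pair_equiv cj (A, F) (fst (canonical_pair cj eps phi1 bs), snd (canonical_pair cj eps phi1 bs))"
      by (rule pair_equiv_of_frames[OF H y(1) x]) (use y(2) in simp)
    then show "\<exists>bs. (\<forall>b\<in>set bs. good_summand cj eps b) \<and> pair_equiv cj (A, F) (canonical_pair cj eps phi1 bs)"
      using bs by (intro exI[of _ bs]) simp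
  next
    fix bs cs
    assume *: "(\<forall>b\<in>set bs. good_summand cj eps b) \<and> (\<forall>c\<in>set cs. good_summand cj eps c)"
    let ?P = "canonical_pair cj eps phi1 bs" and ?Q = "canonical_pair cj eps phi1 cs"
    obtain n x where x: "herm_pair n (fst ?P) (snd ?P)" "pframe n ?P mu bs x" using canon * by blast
    obtain m y where y: "herm_pair m (fst ?Q) (snd ?Q)" "pframe m ?Q mu cs y" using canon * by blast
    interpret P: herm_module cj eps "poly_act (fst ?P)" "mat_form cj (snd ?P)" by (rule herm_pair_module[OF x(1)])
    show "pair_equiv cj ?P ?Q = summands_related cj bs cs"
    proof
      assume "pair_equiv cj ?P ?Q"
      \<comment> \<open>The frame of the second pair is carried into the module of the first, so
        that \<open>related_of_frames\<close> applies to two frames of one module.\<close>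
      then have "\<exists>x'. pframe n (fst ?P, snd ?P) mu cs x'"
        using pframe_transport(2)[OF _ x(1) y(1), where mu = mu and bs = cs and x = y] y(2) by simp
      then show "summands_related cj bs cs" using P.related_of_frames[of bs cs mu] * mu x(2) by auto
    next
      assume "summands_related cj bs cs"
      then obtain z where z: "pframe n ?P mu cs z"
        using P.frame_of_related[OF _ _ mu fin_vecs_submodule(1)[OF x(1)] x(2)] * by blast
      have "pair_equiv cj (fst ?P, snd ?P) (fst ?Q, snd ?Q)"
        by (rule pair_equiv_of_frames[OF x(1) y(1), where mu = mu and bs = cs and x = z and y = y]) (use z y(2) in simp_all)
      then show "pair_equiv cj ?P ?Q" by simp
    qed
  qed
qed

end
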